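(* Let $\Omega\subset\mathbb{C}$ be an $n$-connected quadrature domain of finite area such that no boundary component of $\Omega$ is a point. If $H$ is any meromorphic function on $\Omega$ that extends meromorphically to the double of $\Omega$, then $H'$ also extends meromorphically to the double of $\Omega$. Furthermore, $H$ is an algebraic function.
   Context: A domain $\Omega\subset\mathbb{C}$ that is $n$-connected with no boundary component a point is a quadrature domain if there exist finitely many points $w_1,\dots,w_N\in\Omega$, non-negative integers $n_j$ and complex numbers $c_{jk}$ such that $\int_\Omega f\,dA=\sum_{j=1}^N\sum_{k=0}^{n_j}c_{jk}f^{(k)}(w_j)$ for every square-integrable holomorphic $f$ on $\Omega$. Such $\Omega$ is conformally equivalent via a map $\Phi$ to a bounded domain $\widetilde\Omega$ whose boundary consists of $n$ disjoint simple closed real-analytic curves; $\widetilde\Omega$ has a compact (Schottky) double. A meromorphic function $h$ on $\Omega$ extends meromorphically to the double of $\Omega$ if $h\circ\Phi^{-1}$ extends to a meromorphic function on the double of $\widetilde\Omega$. A function $H$ of one complex variable is algebraic if $P(z,H(z))\equiv0$ for some nonzero polynomial $P$. *)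

theory Defs
  imports "HOL-Complex_Analysis.Complex_Analysis" "HOL-Computational_Algebra.Polynomial"
begin

text \<open>Connectivity measured in the Riemann sphere: the bounded components of the
  complement, plus one component containing \<infinity> when the complement is unbounded.\<close>
definition n_connected :: "complex set \<Rightarrow> nat \<Rightarrow> bool" where
  "n_connected \<Omega> n \<longleftrightarrow>
     finite {C \<in> components (- \<Omega>). bounded C} \<and>
     n = card {C \<in> components (- \<Omega>). bounded C} + (if bounded (- \<Omega>) then 0 else 1)"

definition no_point_boundary_component :: "complex set \<Rightarrow> bool" where
  "no_point_boundary_component \<Omega> \<longleftrightarrow> (\<forall>C \<in> components (- \<Omega>). \<not> (\<exists>a. C = {a}))"

definition quadrature_domain :: "complex set \<Rightarrow> bool" where
  "quadrature_domain \<Omega> \<longleftrightarrow>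
     (\<exists>W :: complex set. \<exists>N :: complex \<Rightarrow> nat. \<exists>c :: complex \<Rightarrow> nat \<Rightarrow> complex.
        finite W \<and> W \<subseteq> \<Omega> \<and>
        (\<forall>f. f holomorphic_on \<Omega> \<and> (\<lambda>z. (norm (f z))^2) integrable_on \<Omega> \<longrightarrow>
             integral \<Omega> f = (\<Sum>w\<in>W. \<Sum>k\<le>N w. c w k * (deriv ^^ k) f w)))"

definition analytic_jordan_curve :: "(complex \<Rightarrow> complex) \<Rightarrow> bool" where
  "analytic_jordan_curve G \<longleftrightarrow>
     (\<exists>S. open S \<and> \<real> \<subseteq> S \<and> G holomorphic_on S) \<and>
     (\<forall>t::real. G (of_real (t + 1)) = G (of_real t)) \<and>
     inj_on (\<lambda>t::real. G (of_real t)) {0..<1} \<and>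
     (\<forall>t::real. deriv G (of_real t) \<noteq> 0)"

definition curve_image :: "(complex \<Rightarrow> complex) \<Rightarrow> complex set" where
  "curve_image G = (\<lambda>t::real. G (of_real t)) ` {0..1}"

definition analytic_boundary_domain :: "complex set \<Rightarrow> nat \<Rightarrow> (nat \<Rightarrow> complex \<Rightarrow> complex) \<Rightarrow> bool" where
  "analytic_boundary_domain D m G \<longleftrightarrow>
     open D \<and> connected D \<and> D \<noteq> {} \<and> bounded D \<and>
     (\<forall>i<m. analytic_jordan_curve (G i)) \<and>
     (\<forall>i<m. \<forall>j<m. i \<noteq> j \<longrightarrow> curve_image (G i) \<inter> curve_image (G j) = {}) \<and>
     frontier D = (\<Union>i<m. curve_image (G i))"

text \<open>Meromorphic functions on the Schottky double of such a domain D.  A meromorphic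
  function on the double is given by its restriction h to D and by g, where
  g w = conj (F (reflected copy of w)), g meromorphic on D.  Near the boundary point
  G i t0 the double has the holomorphic chart s \<mapsto> G i s on the side of D and
  s \<mapsto> (reflected copy of G i (cnj s)) on the other side; meromorphy there means
  the glued function is meromorphic in s.\<close>
definition extends_to_double_of ::
    "complex set \<Rightarrow> nat \<Rightarrow> (nat \<Rightarrow> complex \<Rightarrow> complex) \<Rightarrow> (complex \<Rightarrow> complex) \<Rightarrow> bool" where
  "extends_to_double_of D m G h \<longleftrightarrow>
     h meromorphic_on D \<and>
     (\<exists>g. g meromorphic_on D \<and>
        (\<forall>i<m. \<forall>t0::real. \<exists>e>0. \<exists>M. M meromorphic_on ball (of_real t0) e \<and>
            (\<forall>s\<in>ball (of_real t0) e. G i s \<in> D \<longrightarrow>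
                 (\<forall>\<^sub>F x in at s. M x = h (G i x))) \<and>
            (\<forall>s\<in>ball (of_real t0) e. G i (cnj s) \<in> D \<longrightarrow>
                 (\<forall>\<^sub>F x in at s. M x = cnj (g (G i (cnj x)))))))"

definition extends_to_double :: "complex set \<Rightarrow> (complex \<Rightarrow> complex) \<Rightarrow> bool" where
  "extends_to_double \<Omega> h \<longleftrightarrow>
     (\<exists>D m G \<Phi> \<Psi>. analytic_boundary_domain D m G \<and>
        \<Phi> holomorphic_on \<Omega> \<and> \<Psi> holomorphic_on D \<and> \<Phi> ` \<Omega> = D \<and>
        (\<forall>z\<in>\<Omega>. \<Psi> (\<Phi> z) = z) \<and> (\<forall>w\<in>D. \<Phi> (\<Psi> w) = w) \<and>
        extends_to_double_of D m G (h \<circ> \<Psi>))"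

text \<open>Algebraic: P(z, H z) = 0 identically (off a discrete set, as H is meromorphic)
  for a nonzero polynomial P in two variables, represented as a polynomial in w
  whose coefficients are polynomials in z.\<close>
definition algebraic_on :: "complex set \<Rightarrow> (complex \<Rightarrow> complex) \<Rightarrow> bool" where
  "algebraic_on \<Omega> H \<longleftrightarrow>
     (\<exists>P :: complex poly poly. P \<noteq> 0 \<and>
        (\<forall>z\<in>\<Omega>. \<forall>\<^sub>F x in at z. poly (map_poly (\<lambda>c. poly c x) P) (H x) = 0))"

end

theory Submission
  imports Defs
begin

text \<open>
  Let \<open>\<Psi> : D \<rightarrow> \<Omega>\<close> be the conformal map from the analytically bounded domain. Pulled back to \<open>D\<close>, the
  quadrature identity applied to \<open>\<Phi>' / (\<zeta> - \<Phi>)\<close> says that the area Cauchy transform \<open>C\<close> of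
  \<open>cnj \<Psi>'\<close> is a rational function \<open>R\<close> outside \<open>closure D\<close>, with poles in \<open>D\<close>. Inside \<open>D\<close> the function
  \<open>C - \<pi> cnj \<Psi>\<close> is holomorphic, and \<open>C\<close> has no jump across the boundary although \<open>\<Psi>'\<close> is only square
  integrable. Hence \<open>S = cnj \<Psi> + (R - C) / \<pi>\<close> is meromorphic on \<open>D\<close> and \<open>cnj \<Psi> - S\<close> tends to 0 at the
  boundary; by reflection the pair \<open>(\<Psi>, S)\<close> is a meromorphic function on the double, that is, the
  coordinate \<open>z\<close> extends to the double. So \<open>H' = dH / dz\<close> extends as well, and \<open>H\<close> and \<open>z\<close> are
  algebraically dependent: the polynomials of bidegree at most \<open>k\<close> in \<open>z\<close> and \<open>H\<close> form a space of
  quadratic dimension in \<open>k\<close>, removing all poles costs linearly many conditions, and a holomorphic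
  function on the double is constant by the maximum principle.
\<close>

section \<open>Lebesgue measure on the complex plane and change of variables\<close>

unbundle no fps_syntax

text \<open>The test function is chosen so that the Jacobian \<open>|\<Psi>'|^2\<close> of the
  pull-back and the relation \<open>\<Phi>'(\<Psi>) \<Psi>' = 1\<close> leave only the conjugate of
  \<open>\<Psi>'\<close> divided by \<open>\<zeta> - w\<close>, while its squared norm becomes the
  integral of \<open>1 / |\<zeta> - w|^2\<close> over the bounded set \<open>D\<close>. Its
  derivatives at the nodes are polynomials in \<open>1 / (\<zeta> - \<Phi> w)\<close>. The obstacle
  is the boundary. \<open>\<Omega>\<close> is only known to have finite area, so a priori
  \<open>\<Psi>\<close> has neither a bound nor boundary values, and Stokes' formula up to the
  boundary cannot be used. What survives is a statement about differences: the Cauchy transform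
  takes asymptotically equal values at a point and at its mirror image in a boundary chart.
  Reflection is therefore carried out for two functions \<open>p\<close>, \<open>q\<close> of which
  only \<open>p - cnj q\<close> is known to tend to 0. The double is never built as a surface. A
  function on it is a pair of functions on \<open>D\<close>, the second one conjugated, together
  with glued functions on discs around boundary parameters.\<close>

lemma lborel_complex_eq_distr:
  "(lborel :: complex measure) = distr (lborel \<Otimes>\<^sub>M lborel) borel (\<lambda>(x, y). Complex x y)"
proof (rule lborel_eqI)
  show "sets (distr (lborel \<Otimes>\<^sub>M lborel) borel (\<lambda>(x, y). Complex x y)) = sets borel" by simp
next
  have m: "(\<lambda>(x, y). Complex x y) \<in> borel_measurable (lborel \<Otimes>\<^sub>M lborel)"
    unfolding Complex_eq by measurable
  fix l u :: complex
  assume le: "\<And>b. b \<in> Basis \<Longrightarrow> l \<bullet> b \<le> u \<bullet> b"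
  have le': "Re l \<le> Re u" "Im l \<le> Im u"
    using le[of 1] le[of \<i>] by (auto simp: Basis_complex_def inner_complex_def)
  have pre: "(\<lambda>(x, y). Complex x y) -` box l u \<inter> space (lborel \<Otimes>\<^sub>M lborel)
     = box (Re l) (Re u) \<times> box (Im l) (Im u)"
    by (auto simp: in_box_complex_iff space_pair_measure)
  have "emeasure (distr (lborel \<Otimes>\<^sub>M lborel) borel (\<lambda>(x, y). Complex x y)) (box l u)
      = emeasure (lborel \<Otimes>\<^sub>M lborel) (box (Re l) (Re u) \<times> box (Im l) (Im u))"
    by (subst emeasure_distr[OF m]) (auto simp: pre)
  also have "\<dots> = ennreal (Re u - Re l) * ennreal (Im u - Im l)"
    using le' by (subst lborel.emeasure_pair_measure_Times) auto
  also have "\<dots> = (\<Prod>b\<in>Basis. (u - l) \<bullet> b)"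
    using le' by (simp add: Basis_complex_def inner_complex_def ennreal_mult)
  finally show "emeasure (distr (lborel \<Otimes>\<^sub>M lborel) borel (\<lambda>(x, y). Complex x y)) (box l u)
     = (\<Prod>b\<in>Basis. (u - l) \<bullet> b)" .
qed

text \<open>The change of variables theorem is stated with determinants of matrices, hence for
  \<open>real^2\<close>; this identity carries its result over to the complex plane.\<close>

lemma lborel_complex_eq_distr_vec:
  "(lborel :: complex measure) = distr (lborel :: (real^2) measure) borel (\<lambda>v. Complex (v$1) (v$2))"
proof (rule lborel_eqI)
  show "sets (distr (lborel :: (real^2) measure) borel (\<lambda>v. Complex (v$1) (v$2))) = sets borel" by simp
next
  have m: "(\<lambda>v::real^2. Complex (v$1) (v$2)) \<in> borel_measurable borel"
    unfolding Complex_eq by (intro borel_measurable_continuous_onI continuous_intros)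
  fix l u :: complex
  assume le: "\<And>b. b \<in> Basis \<Longrightarrow> l \<bullet> b \<le> u \<bullet> b"
  have le': "Re l \<le> Re u" "Im l \<le> Im u"
    using le[of 1] le[of \<i>] by (auto simp: Basis_complex_def inner_complex_def)
  have pre: "(\<lambda>v::real^2. Complex (v$1) (v$2)) -` box l u
     = box (vector [Re l, Im l]) (vector [Re u, Im u])"
    by (auto simp: in_box_complex_iff mem_box_cart forall_2)
  have B: "(Basis :: (real^2) set) = {axis 1 1, axis 2 1}"
    unfolding Basis_vec_def by (auto simp: UNIV_2)
  have "emeasure (distr (lborel :: (real^2) measure) borel (\<lambda>v. Complex (v$1) (v$2))) (box l u)
      = emeasure lborel (box (vector [Re l, Im l]) (vector [Re u, Im u]) :: (real^2) set)"
    using m by (subst emeasure_distr) (auto simp: pre)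
  also have "\<dots> = (\<Prod>b\<in>Basis. (u - l) \<bullet> b)"
    using le' 
    by (subst emeasure_lborel_box) (auto simp: B Basis_complex_def inner_complex_def inner_axis axis_eq_axis)
  finally show "emeasure (distr (lborel :: (real^2) measure) borel (\<lambda>v. Complex (v$1) (v$2))) (box l u)
     = (\<Prod>b\<in>Basis. (u - l) \<bullet> b)" .
qed

definition vec2c :: "real^2 \<Rightarrow> complex" where "vec2c v = Complex (v$1) (v$2)"
definition c2vec :: "complex \<Rightarrow> real^2" where "c2vec z = vector [Re z, Im z]"

lemma vec2c_c2vec [simp]: "vec2c (c2vec z) = z" and c2vec_vec2c [simp]: "c2vec (vec2c v) = v"
  by (auto simp: vec2c_def c2vec_def vec_eq_iff forall_2)

lemma bounded_linear_vec2c: "bounded_linear vec2c"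
  unfolding linear_conv_bounded_linear[symmetric]
  by (rule linearI) (auto simp: vec2c_def complex_eq_iff)

lemma bounded_linear_c2vec: "bounded_linear c2vec"
  unfolding linear_conv_bounded_linear[symmetric]
  by (rule linearI) (auto simp: c2vec_def vec_eq_iff forall_2)

lemma measurable_vec2c [measurable]: "vec2c \<in> borel_measurable borel"
  by (intro borel_measurable_continuous_onI linear_continuous_on bounded_linear_vec2c)

text \<open>For Borel functions, integrability with respect to \<open>lborel\<close> and to its
  completion agree, so the absolute integrals of the change of variables theorem can be read as
  Bochner integrals.\<close>

lemma absolutely_integrable_vec2c_iff:
  fixes g :: "complex \<Rightarrow> complex"
  assumes "set_borel_measurable borel S g"
  shows "(\<lambda>v. g (vec2c v)) absolutely_integrable_on (vec2c -` S) \<longleftrightarrow> set_integrable lborel S g"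
    and "set_integrable lborel S g \<Longrightarrow>
      integral (vec2c -` S) (\<lambda>v. g (vec2c v)) = (LINT z:S|lborel. g z)"
proof -
  let ?h = "\<lambda>z. indicator S z *\<^sub>R g z"
  have h [measurable]: "?h \<in> borel_measurable borel"
    using assms by (simp add: set_borel_measurable_def)
  have eq: "indicator (vec2c -` S) v *\<^sub>R g (vec2c v) = ?h (vec2c v)" for v
    by (auto simp: indicator_def)
  have J: "(lborel :: complex measure) = distr lborel borel vec2c"
    unfolding vec2c_def[abs_def] by (rule lborel_complex_eq_distr_vec)
  have "set_integrable lborel S g \<longleftrightarrow> integrable lborel (\<lambda>v. ?h (vec2c v))"
    unfolding set_integrable_def by (subst J, subst integrable_distr_eq) auto
  also have "\<dots> \<longleftrightarrow> integrable lebesgue (\<lambda>v. ?h (vec2c v))"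
    by (subst integrable_completion) auto
  finally show iff: "(\<lambda>v. g (vec2c v)) absolutely_integrable_on (vec2c -` S) \<longleftrightarrow> set_integrable lborel S g"
    unfolding set_integrable_def eq by simp
  assume "set_integrable lborel S g"
  then have "integral (vec2c -` S) (\<lambda>v. g (vec2c v)) = (LINT v:vec2c -` S|lebesgue. g (vec2c v))"
    using iff set_lebesgue_integral_eq_integral(2) by metis
  also have "\<dots> = integral\<^sup>L lebesgue (\<lambda>v. ?h (vec2c v))"
    unfolding set_lebesgue_integral_def eq ..
  also have "\<dots> = integral\<^sup>L lborel (\<lambda>v. ?h (vec2c v))"
    by (subst integral_completion) auto
  also have "\<dots> = (LINT z:S|lborel. g z)"
    unfolding set_lebesgue_integral_def
    using integral_distr[of vec2c lborel borel ?h, folded J] by simp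
  finally show "integral (vec2c -` S) (\<lambda>v. g (vec2c v)) = (LINT z:S|lborel. g z)" .
qed

text \<open>The integrand of the change of variables theorem is vector valued, so values as well as
  arguments are moved to \<open>real^2\<close>.\<close>

lemma absolutely_integrable_c2vec_iff:
  fixes h :: "'a::euclidean_space \<Rightarrow> complex"
  shows "(\<lambda>x. c2vec (h x)) absolutely_integrable_on S \<longleftrightarrow> h absolutely_integrable_on S"
    and "h absolutely_integrable_on S \<Longrightarrow> integral S (\<lambda>x. c2vec (h x)) = c2vec (integral S h)"
proof -
  show "(\<lambda>x. c2vec (h x)) absolutely_integrable_on S \<longleftrightarrow> h absolutely_integrable_on S"
    using absolutely_integrable_linear[OF _ bounded_linear_c2vec, where f = h and s = S]
      absolutely_integrable_linear[OF _ bounded_linear_vec2c, where f = "\<lambda>x. c2vec (h x)" and s = S]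
    by (auto simp: o_def)
  assume "h absolutely_integrable_on S"
  then have "h integrable_on S" by (rule set_lebesgue_integral_eq_integral)
  from integral_linear[OF this bounded_linear_c2vec]
  show "integral S (\<lambda>x. c2vec (h x)) = c2vec (integral S h)" by (simp add: o_def)
qed

text \<open>The real derivative of a holomorphic map is multiplication by some
  \<open>p + i q\<close>; its matrix has the rows \<open>(p, -q)\<close> and \<open>(q, p)\<close>
  and determinant \<open>p^2 + q^2\<close>. Both directions of the equivalence are used: finite area
  passes from \<open>\<Omega>\<close> to \<open>D\<close>, integrability of the kernels from
  \<open>D\<close> to \<open>\<Omega>\<close>.\<close>

proposition holomorphic_change_of_variables:
  fixes F :: "complex \<Rightarrow> complex"
  assumes S: "open S" and hol: "\<phi> holomorphic_on S" and inj: "inj_on \<phi> S"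
    and F: "set_borel_measurable borel (\<phi> ` S) F"
  shows "set_integrable lborel S (\<lambda>z. (cmod (deriv \<phi> z))\<^sup>2 *\<^sub>R F (\<phi> z)) \<longleftrightarrow> set_integrable lborel (\<phi> ` S) F"
    and "set_integrable lborel (\<phi> ` S) F \<Longrightarrow>
      (LINT z:S|lborel. (cmod (deriv \<phi> z))\<^sup>2 *\<^sub>R F (\<phi> z)) = (LINT w:\<phi> ` S|lborel. F w)"
proof -
  define g where "g = c2vec \<circ> \<phi> \<circ> vec2c"
  define g' where "g' v = c2vec \<circ> ((*) (deriv \<phi> (vec2c v))) \<circ> vec2c" for v
  let ?S = "vec2c -` S"
  define D where "D z = (cmod (deriv \<phi> z))\<^sup>2 *\<^sub>R F (\<phi> z)" for z
  have openT: "open (\<phi> ` S)"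
    using open_mapping_thm3[OF hol S inj] .
  have contphi: "continuous_on S \<phi>" using hol by (rule holomorphic_on_imp_continuous_on)
  have mS: "?S \<in> sets lebesgue"
    using S by (intro sets_completionI_sets) (simp add: borel_open open_vimage linear_continuous_on bounded_linear_vec2c)
  have der: "(g has_derivative g' v) (at v within ?S)" if "v \<in> ?S" for v
  proof -
    have "(\<phi> has_derivative ((*) (deriv \<phi> (vec2c v)))) (at (vec2c v))"
      using that S hol by (intro has_field_derivative_imp_has_derivative holomorphic_derivI) auto
    then have "((c2vec \<circ> (\<phi> \<circ> vec2c)) has_derivative (c2vec \<circ> ((*) (deriv \<phi> (vec2c v)) \<circ> vec2c))) (at v)"
      by (intro diff_chain_at bounded_linear_imp_has_derivative bounded_linear_vec2c bounded_linear_c2vec)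
    then show ?thesis unfolding g_def g'_def by (simp add: o_assoc has_derivative_at_withinI)
  qed
  have injg: "inj_on g ?S"
    using inj unfolding g_def inj_on_def by (metis c2vec_vec2c comp_apply vec2c_c2vec vimage_eq)
  have img: "g ` ?S = vec2c -` (\<phi> ` S)"
  proof (intro equalityI subsetI)
    fix x assume "x \<in> vec2c -` (\<phi> ` S)"
    then obtain y where "vec2c x = \<phi> y" "y \<in> S" by auto
    then show "x \<in> g ` ?S"
      by (intro image_eqI[of _ _ "c2vec y"]) (auto simp: g_def simp flip: \<open>vec2c x = \<phi> y\<close>)
  qed (auto simp: g_def)
  have det: "\<bar>det (matrix (g' v))\<bar> = (cmod (deriv \<phi> (vec2c v)))\<^sup>2" for v
    by (auto simp: det_2 matrix_def g'_def c2vec_def vec2c_def axis_def cmod_power2)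
       (auto simp: power2_eq_square)
  have Dm: "set_borel_measurable borel S D"
  proof -
    have 1: "(\<lambda>z. indicator (\<phi> ` S) z *\<^sub>R F z) \<in> borel_measurable borel"
      using F by (simp add: set_borel_measurable_def)
    have "(\<lambda>z. if z \<in> S then \<phi> z else 0) = (\<lambda>z. indicator S z *\<^sub>R \<phi> z)"
      by auto
    then have 2: "(\<lambda>z. if z \<in> S then \<phi> z else 0) \<in> borel_measurable borel"
      using borel_measurable_continuous_on_indicator[OF _ contphi] S by simp
    have 3: "(\<lambda>z. indicator S z *\<^sub>R (of_real ((cmod (deriv \<phi> z))\<^sup>2) :: complex)) \<in> borel_measurable borel"
      using S hol by (intro borel_measurable_continuous_on_indicator continuous_intros
          holomorphic_on_imp_continuous_on holomorphic_deriv) auto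
    have "(\<lambda>z. (indicator S z *\<^sub>R of_real ((cmod (deriv \<phi> z))\<^sup>2)) *
        (indicator (\<phi> ` S) (if z \<in> S then \<phi> z else 0) *\<^sub>R F (if z \<in> S then \<phi> z else 0))) \<in> borel_measurable borel"
      using 1 2 3 by (intro borel_measurable_times) (auto intro: measurable_compose[OF 2 1])
    also have "(\<lambda>z. (indicator S z *\<^sub>R of_real ((cmod (deriv \<phi> z))\<^sup>2)) *
        (indicator (\<phi> ` S) (if z \<in> S then \<phi> z else 0) *\<^sub>R F (if z \<in> S then \<phi> z else 0))) =
       (\<lambda>z. indicator S z *\<^sub>R D z)"
      by (auto simp: indicator_def D_def fun_eq_iff scaleR_conv_of_real)
    finally show ?thesis by (simp add: set_borel_measurable_def)
  qed
  have Deq: "\<bar>det (matrix (g' v))\<bar> *\<^sub>R (c2vec (F (vec2c (g v)))) = c2vec (D (vec2c v))" for v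
    unfolding det D_def g_def
    by (simp add: linear_scale[OF bounded_linear.linear[OF bounded_linear_c2vec]])
  note cov = has_absolute_integral_change_of_variables[OF mS der injg, of "\<lambda>v. c2vec (F (vec2c v))",
      unfolded Deq img]
  have eq1: "(\<lambda>v. c2vec (D (vec2c v))) absolutely_integrable_on ?S \<longleftrightarrow> set_integrable lborel S D"
    by (simp only: absolutely_integrable_c2vec_iff(1) absolutely_integrable_vec2c_iff(1)[OF Dm])
  have eq2: "(\<lambda>v. c2vec (F (vec2c v))) absolutely_integrable_on vec2c -` (\<phi> ` S) \<longleftrightarrow> set_integrable lborel (\<phi> ` S) F"
    by (simp only: absolutely_integrable_c2vec_iff(1) absolutely_integrable_vec2c_iff(1)[OF F])
  have iff: "set_integrable lborel S D \<longleftrightarrow> set_integrable lborel (\<phi> ` S) F"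
    using cov eq1 eq2 by blast
  then show "set_integrable lborel S (\<lambda>z. (cmod (deriv \<phi> z))\<^sup>2 *\<^sub>R F (\<phi> z)) \<longleftrightarrow> set_integrable lborel (\<phi> ` S) F"
    by (simp add: D_def[abs_def])
  assume int: "set_integrable lborel (\<phi> ` S) F"
  then have "integral ?S (\<lambda>v. c2vec (D (vec2c v))) = integral (vec2c -` (\<phi> ` S)) (\<lambda>v. c2vec (F (vec2c v)))"
    using cov eq2 by blast
  then have "c2vec (LINT z:S|lborel. D z) = c2vec (LINT z:\<phi> ` S|lborel. F z)"
    using int iff absolutely_integrable_c2vec_iff(2)[where h = "\<lambda>v. D (vec2c v)" and S = ?S]
      absolutely_integrable_c2vec_iff(2)[where h = "\<lambda>v. F (vec2c v)" and S = "vec2c -` (\<phi> ` S)"]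
      absolutely_integrable_vec2c_iff[OF Dm] absolutely_integrable_vec2c_iff[OF F] by simp
  then show "(LINT z:S|lborel. (cmod (deriv \<phi> z))\<^sup>2 *\<^sub>R F (\<phi> z)) = (LINT w:\<phi> ` S|lborel. F w)"
    unfolding D_def by (metis vec2c_c2vec)
qed

section \<open>Iterated integrals and logarithmic polar coordinates\<close>

lemma measurable_Complex_pair [measurable]:
  "(\<lambda>(x, y). Complex x y) \<in> borel_measurable (lborel \<Otimes>\<^sub>M lborel)"
  unfolding Complex_eq by measurable

lemma integrable_complex_iff_pair:
  fixes f :: "complex \<Rightarrow> complex"
  assumes [measurable]: "f \<in> borel_measurable borel"
  shows "integrable lborel f \<longleftrightarrow> integrable (lborel \<Otimes>\<^sub>M lborel) (\<lambda>(x, y). f (Complex x y))"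
  by (subst lborel_complex_eq_distr, subst integrable_distr_eq) (auto simp: case_prod_unfold)

lemma integral_complex_iterated:
  fixes f :: "complex \<Rightarrow> complex"
  assumes "integrable lborel f"
  shows "integral\<^sup>L lborel f = (LINT x|lborel. LINT y|lborel. f (Complex x y))"
proof -
  have [measurable]: "f \<in> borel_measurable borel" using assms by auto
  have "integral\<^sup>L lborel f = integral\<^sup>L (lborel \<Otimes>\<^sub>M lborel) (\<lambda>(x, y). f (Complex x y))"
    by (subst lborel_complex_eq_distr, subst integral_distr) (auto simp: case_prod_unfold)
  also have "\<dots> = (LINT x|lborel. LINT y|lborel. f (Complex x y))"
    using assms lborel_pair.integral_fst'[of "\<lambda>(x, y). f (Complex x y)"]
    by (simp add: integrable_complex_iff_pair)
  finally show ?thesis .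
qed

text \<open>Polar coordinates are the change of variables \<open>w = z + exp u\<close>; the image misses only a slit.\<close>
definition polar_strip :: "real set \<Rightarrow> complex set" where
  "polar_strip I = {u. Re u \<in> I \<and> 0 < Im u \<and> Im u < 2 * pi}"

definition log_annulus :: "complex \<Rightarrow> real set \<Rightarrow> complex set" where
  "log_annulus z I = {w. w \<noteq> z \<and> ln (cmod (w - z)) \<in> I}"

lemma open_polar_strip:
  assumes "open I" shows "open (polar_strip I)"
proof -
  have "polar_strip I = Re -` I \<inter> {u. 0 < Im u} \<inter> {u. Im u < 2 * pi}"
    by (auto simp: polar_strip_def)
  moreover have "open (Re -` I)" by (intro open_vimage assms continuous_intros)
  ultimately show ?thesis by (auto intro!: open_Int simp: open_halfspace_Im_gt open_halfspace_Im_lt)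
qed

lemma open_log_annulus:
  assumes "open I" shows "open (log_annulus z I)"
proof -
  have "log_annulus z I = (\<lambda>w. ln (cmod (w - z))) -` I \<inter> (- {z})"
    by (auto simp: log_annulus_def)
  moreover have "continuous_on (-{z}) (\<lambda>w. ln (cmod (w - z)))"
    by (intro continuous_intros) auto
  ultimately show ?thesis using assms by (metis continuous_on_open_vimage open_Compl closed_singleton)
qed

lemma null_sets_Im_eq: "{w::complex. Im w = c} \<in> null_sets lborel"
proof -
  have "{w::complex. Im w = c} = {w. \<i> \<bullet> w = c}"
    by (auto simp: inner_complex_def)
  then have "negligible {w::complex. Im w = c}"
    using negligible_hyperplane[of \<i> c] by simp
  moreover have "{w::complex. Im w = c} \<in> sets borel"
    by (intro borel_closed closed_Collect_eq continuous_intros)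
  ultimately show ?thesis
    by (simp add: null_sets_def negligible_iff_null_sets)
qed

text \<open>Only a half line is missing from the image, but the whole horizontal line through
  \<open>z\<close> is a null set and is simpler to name.\<close>

lemma log_annulus_minus_slit:
  "(\<lambda>u. z + exp u) ` polar_strip I \<subseteq> log_annulus z I"
  "log_annulus z I \<subseteq> (\<lambda>u. z + exp u) ` polar_strip I \<union> {w. Im w = Im z}"
proof -
  show "(\<lambda>u. z + exp u) ` polar_strip I \<subseteq> log_annulus z I"
    by (auto simp: polar_strip_def log_annulus_def)
  show "log_annulus z I \<subseteq> (\<lambda>u. z + exp u) ` polar_strip I \<union> {w. Im w = Im z}"
  proof
    fix w assume w: "w \<in> log_annulus z I"
    show "w \<in> (\<lambda>u. z + exp u) ` polar_strip I \<union> {w. Im w = Im z}"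
    proof (cases "Im w = Im z")
      case False
      then have ne: "z - w \<noteq> 0" and im: "Im (z - w) \<noteq> 0" by auto
      have "Im (Ln (z - w)) \<noteq> pi"
        using im ne by (simp add: Im_Ln_eq_pi)
      \<comment> \<open>The principal argument of the opposite vector \<open>z - w\<close> lies in
        \<open>(-pi, pi]\<close>. Adding \<open>\<i> * pi\<close> turns the vector back and moves
        the argument to \<open>(0, 2 * pi]\<close>; the right end is excluded because
        \<open>w\<close> is off the horizontal line.\<close>
      then have "Ln (z - w) + \<i> * pi \<in> polar_strip I"
        using w ne mpi_less_Im_Ln[OF ne] Im_Ln_le_pi[OF ne]
        by (auto simp: polar_strip_def log_annulus_def norm_minus_commute)
      then show ?thesis using ne 
        by (intro UnI1 image_eqI[of _ _ "Ln (z - w) + \<i> * pi"]) (auto simp: exp_add)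
    qed auto
  qed
qed

text \<open>The weight is the Jacobian \<open>|exp u|^2\<close>. The image of the strip differs from
  the annulus by a null set only.\<close>

lemma set_integral_polar:
  fixes F :: "complex \<Rightarrow> complex"
  assumes I: "open I" and F: "set_borel_measurable borel (log_annulus z I) F"
  shows "set_integrable lborel (polar_strip I) (\<lambda>u. exp (2 * Re u) *\<^sub>R F (z + exp u)) \<longleftrightarrow>
         set_integrable lborel (log_annulus z I) F"
    and "set_integrable lborel (log_annulus z I) F \<Longrightarrow>
      (LINT w:log_annulus z I|lborel. F w) =
      (LINT u:polar_strip I|lborel. exp (2 * Re u) *\<^sub>R F (z + exp u))"
proof -
  let ?\<phi> = "\<lambda>u. z + exp u"
  let ?T = "?\<phi> ` polar_strip I" and ?A = "log_annulus z I"
  have inj: "inj_on ?\<phi> (polar_strip I)"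
  proof (rule inj_onI)
    fix u v assume uv: "u \<in> polar_strip I" "v \<in> polar_strip I" "z + exp u = z + exp v"
    then have "exp u = exp v" by simp
    then obtain n :: int where n: "u = v + (of_int (2 * n) * pi) * \<i>" by (auto simp: exp_eq)
    have "Im u - Im v = 2 * of_int n * pi" using n by simp
    moreover have "\<bar>Im u - Im v\<bar> < 2 * pi" using uv by (auto simp: polar_strip_def)
    ultimately have "\<bar>real_of_int n\<bar> * (2 * pi) < 1 * (2 * pi)"
      by (simp add: abs_mult algebra_simps)
    then have "n = 0" by (simp add: mult_less_cancel_right) 
    then show "u = v" using n by simp
  qed
  have hol: "?\<phi> holomorphic_on polar_strip I" by (intro holomorphic_intros)
  have openT: "open ?T" using open_mapping_thm3[OF hol open_polar_strip[OF I] inj] .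
  have sub: "?T \<subseteq> ?A" and sub2: "?A \<subseteq> ?T \<union> {w. Im w = Im z}" by (fact log_annulus_minus_slit)+
  have ae: "AE w in lborel. indicator ?A w *\<^sub>R F w = indicator ?T w *\<^sub>R F w"
    using sub sub2 by (intro AE_I'[OF null_sets_Im_eq[of "Im z"]]) (auto simp: indicator_def)
  have mA: "(\<lambda>w. indicator ?A w *\<^sub>R F w) \<in> borel_measurable borel"
    using F by (simp add: set_borel_measurable_def)
  have "(\<lambda>w. indicator ?T w *\<^sub>R (indicator ?A w *\<^sub>R F w)) \<in> borel_measurable borel"
    using openT by (intro borel_measurable_scaleR mA) auto
  also have "(\<lambda>w. indicator ?T w *\<^sub>R (indicator ?A w *\<^sub>R F w)) = (\<lambda>w. indicator ?T w *\<^sub>R F w)"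
    using sub by (auto simp: indicator_def fun_eq_iff)
  finally have mT: "(\<lambda>w. indicator ?T w *\<^sub>R F w) \<in> borel_measurable borel" .
  then have mT': "set_borel_measurable borel ?T F" by (simp add: set_borel_measurable_def)
  have der: "deriv ?\<phi> u = exp u" for u
    by (intro DERIV_imp_deriv) (auto intro!: derivative_eq_intros)
  have fn: "(\<lambda>u. (cmod (deriv ?\<phi> u))\<^sup>2 *\<^sub>R F (?\<phi> u)) = (\<lambda>u. exp (2 * Re u) *\<^sub>R F (z + exp u))"
    by (simp add: der norm_exp_eq_Re exp_double)
  note cov = holomorphic_change_of_variables[OF open_polar_strip[OF I] hol inj mT', unfolded fn]
  have iff: "set_integrable lborel ?A F \<longleftrightarrow> set_integrable lborel ?T F"
    unfolding set_integrable_def using mA mT ae by (intro integrable_cong_AE) auto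
  show "set_integrable lborel (polar_strip I) (\<lambda>u. exp (2 * Re u) *\<^sub>R F (z + exp u)) \<longleftrightarrow>
         set_integrable lborel ?A F" using cov(1) iff by simp
  assume int: "set_integrable lborel ?A F"
  have "(LINT w:?A|lborel. F w) = (LINT w:?T|lborel. F w)"
    unfolding set_lebesgue_integral_def using mA mT ae by (intro integral_cong_AE) auto
  then show "(LINT w:?A|lborel. F w) =
      (LINT u:polar_strip I|lborel. exp (2 * Re u) *\<^sub>R F (z + exp u))"
    using cov(2) int iff by simp
qed

lemma set_integral_polar_strip_iterated:
  fixes G :: "complex \<Rightarrow> complex"
  assumes "set_integrable lborel (polar_strip I) G"
  shows "(LINT u:polar_strip I|lborel. G u) =
    (LINT x:I|lborel. LINT y:{0<..<2 * pi}|lborel. G (Complex x y))"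
  unfolding set_lebesgue_integral_def
  by (subst integral_complex_iterated[OF assms[unfolded set_integrable_def]])
     (auto simp: polar_strip_def indicator_def intro!: Bochner_Integration.integral_cong)

lemma set_integrable_polar_strip_Re:
  fixes k :: "real \<Rightarrow> complex"
  assumes "set_integrable lborel I k"
  shows "set_integrable lborel (polar_strip I) (\<lambda>u. k (Re u))"
    and "(LINT u:polar_strip I|lborel. k (Re u)) = 2 * pi * (LINT x:I|lborel. k x)"
proof -
  let ?k = "\<lambda>x. indicator I x *\<^sub>R k x" and ?Y = "{0<..<2 * pi}"
  have k: "integrable lborel ?k" using assms by (simp add: set_integrable_def)
  then have [measurable]: "?k \<in> borel_measurable borel" by auto
  have eq: "indicator (polar_strip I) u *\<^sub>R k (Re u) = indicator ?Y (Im u) *\<^sub>R ?k (Re u)" for u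
    by (auto simp: polar_strip_def indicator_def)
  have m: "(\<lambda>u. indicator ?Y (Im u) *\<^sub>R ?k (Re u)) \<in> borel_measurable borel"
    by measurable
  have "integrable (lborel \<Otimes>\<^sub>M lborel) (\<lambda>(x, y). indicator ?Y (Im (Complex x y)) *\<^sub>R ?k (Re (Complex x y)))"
  proof (rule lborel_pair.Fubini_integrable)
    show "integrable lborel (\<lambda>x. LINT y|lborel. norm (case (x, y) of (x, y) \<Rightarrow> indicator ?Y (Im (Complex x y)) *\<^sub>R ?k (Re (Complex x y))))"
      using integrable_mult_right[OF integrable_norm[OF k], of "2 * pi"] by (simp add: mult.assoc)
    show "AE x in lborel. integrable lborel (\<lambda>y. case (x, y) of (x, y) \<Rightarrow> indicator ?Y (Im (Complex x y)) *\<^sub>R ?k (Re (Complex x y)))"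
      by (auto intro!: integrable_scaleR_left)
  qed measurable
  then show int: "set_integrable lborel (polar_strip I) (\<lambda>u. k (Re u))"
    unfolding set_integrable_def eq by (subst integrable_complex_iff_pair[OF m]) simp
  have "(LINT u:polar_strip I|lborel. k (Re u)) = (LINT x:I|lborel. LINT y:?Y|lborel. k x)"
    by (subst set_integral_polar_strip_iterated[OF int]) simp
  also have "\<dots> = (LINT x:I|lborel. (2 * pi) *\<^sub>R k x)" 
    by (simp add: set_lebesgue_integral_def)
  finally show "(LINT u:polar_strip I|lborel. k (Re u)) = 2 * pi * (LINT x:I|lborel. k x)"
    by (simp add: scaleR_conv_of_real)
qed

section \<open>Cauchy kernels over discs\<close>

text \<open>In the coordinates \<open>z + exp u\<close> a disc about \<open>z\<close> is a strip
  unbounded to the left, and a power of the radius is an exponential in \<open>Re u\<close>; this is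
  integrability at the centre of the disc.\<close>

lemma set_integrable_exp_at_bot:
  fixes a c :: real assumes "a > 0"
  shows "set_integrable lborel {..<c} (\<lambda>x. exp (a * x))"
proof -
  have *: "((\<lambda>x. exp (a * x) / a) \<longlongrightarrow> 0) at_bot" "((\<lambda>x. exp (a * x) / a) \<longlongrightarrow> exp (a * c) / a) (at_left c)"
    using assms by (real_asymp, intro tendsto_intros) simp
  have "set_integrable lborel (einterval (-\<infinity>) (ereal c)) (\<lambda>x. exp (a * x))"
  proof (rule interval_integral_FTC_nonneg)
    show "(((\<lambda>x. exp (a * x) / a) \<circ> real_of_ereal) \<longlongrightarrow> 0) (at_right (-\<infinity>))"
      using * by (simp add: ereal_tendsto_simps)
    show "(((\<lambda>x. exp (a * x) / a) \<circ> real_of_ereal) \<longlongrightarrow> exp (a * c) / a) (at_left (ereal c))"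
      using * by (simp add: ereal_tendsto_simps)
  qed (use assms in \<open>auto intro!: derivative_eq_intros\<close>)
  then show ?thesis by (simp add: einterval_iff[abs_def] einterval_def lessThan_def)
qed

lemma set_integral_exp_at_top:
  fixes a c :: real assumes "a > 0"
  shows "set_integrable lborel {c<..} (\<lambda>x. exp (- a * x))"
    and "(LINT x:{c<..}|lborel. exp (- a * x)) = exp (- a * c) / a"
proof -
  have *: "((\<lambda>x. - exp (- a * x) / a) \<longlongrightarrow> 0) at_top" "((\<lambda>x. - exp (- a * x) / a) \<longlongrightarrow> - exp (- a * c) / a) (at_right c)"
    using assms by (real_asymp, intro tendsto_intros) simp
  note r = interval_integral_FTC_nonneg[of "ereal c" \<infinity> "\<lambda>x. - exp (- a * x) / a" "\<lambda>x. exp (- a * x)" "- exp (- a * c) / a" 0]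
  have e: "einterval (ereal c) \<infinity> = {c<..}" by (auto simp: einterval_iff)
  have "set_integrable lborel (einterval (ereal c) \<infinity>) (\<lambda>x. exp (- a * x))"
    by (rule r) (use assms * in \<open>auto intro!: derivative_eq_intros simp: ereal_tendsto_simps\<close>)
  then show "set_integrable lborel {c<..} (\<lambda>x. exp (- a * x))" by (simp add: e)
  have "(LBINT x=ereal c..\<infinity>. exp (- a * x)) = 0 - (- exp (- a * c) / a)"
    by (rule r) (use assms * in \<open>auto intro!: derivative_eq_intros simp: ereal_tendsto_simps\<close>)
  then show "(LINT x:{c<..}|lborel. exp (- a * x)) = exp (- a * c) / a"
    by (simp add: interval_lebesgue_integral_def e)
qed

lemma ball_eq_log_annulus:
  assumes "r > 0" shows "ball z r = insert z (log_annulus z {..<ln r})"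
  using assms by (auto simp: log_annulus_def dist_norm norm_minus_commute)

lemma set_integral_ball_log_annulus:
  fixes F :: "complex \<Rightarrow> complex"
  assumes "r > 0" "set_borel_measurable borel (ball z r) F"
  shows "set_borel_measurable borel (log_annulus z {..<ln r}) F"
    and "set_integrable lborel (ball z r) F \<longleftrightarrow> set_integrable lborel (log_annulus z {..<ln r}) F"
    and "(LINT w:ball z r|lborel. F w) = (LINT w:log_annulus z {..<ln r}|lborel. F w)"
proof -
  let ?A = "log_annulus z {..<ln r}"
  have B: "ball z r = insert z ?A" using ball_eq_log_annulus[OF assms(1)] .
  have ae: "AE w in lborel. indicator (ball z r) w *\<^sub>R F w = indicator ?A w *\<^sub>R F w"
    using AE_lborel_singleton[of z] by eventually_elim (auto simp: B indicator_def)
  have m: "(\<lambda>w. indicator (ball z r) w *\<^sub>R F w) \<in> borel_measurable borel"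
    using assms by (simp add: set_borel_measurable_def)
  have "(\<lambda>w. indicator ?A w *\<^sub>R (indicator (ball z r) w *\<^sub>R F w)) \<in> borel_measurable borel"
    using open_log_annulus[of "{..<ln r}" z] by (intro borel_measurable_scaleR m) auto
  also have "(\<lambda>w. indicator ?A w *\<^sub>R (indicator (ball z r) w *\<^sub>R F w)) = (\<lambda>w. indicator ?A w *\<^sub>R F w)"
    by (auto simp: B indicator_def fun_eq_iff)
  finally have m': "(\<lambda>w. indicator ?A w *\<^sub>R F w) \<in> borel_measurable borel" .
  then show "set_borel_measurable borel ?A F" by (simp add: set_borel_measurable_def)
  show "set_integrable lborel (ball z r) F \<longleftrightarrow> set_integrable lborel ?A F"
    unfolding set_integrable_def using m m' ae by (intro integrable_cong_AE) auto
  show "(LINT w:ball z r|lborel. F w) = (LINT w:?A|lborel. F w)"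
    unfolding set_lebesgue_integral_def using m m' ae by (intro integral_cong_AE) auto
qed

lemma set_borel_measurable_borel:
  fixes f :: "'a::topological_space \<Rightarrow> 'b::{second_countable_topology, real_normed_vector}"
  shows "A \<in> sets borel \<Longrightarrow> f \<in> borel_measurable borel \<Longrightarrow> set_borel_measurable borel A f"
  unfolding set_borel_measurable_def by (intro borel_measurable_scaleR) auto

lemma set_integrable_of_real_iff [simp]:
  "set_integrable M A (\<lambda>x. complex_of_real (f x)) \<longleftrightarrow> set_integrable M A f"
  unfolding set_integrable_def scaleR_conv_of_real of_real_mult[symmetric] complex_of_real_integrable_eq
  by simp

lemma borel_measurable_cauchy_kernel [measurable]:
  "(\<lambda>w. 1 / (\<zeta> - w :: complex)) \<in> borel_measurable borel"
  by (rule borel_measurable_continuous_countable_exceptions[of "{\<zeta>}"]) (auto intro!: continuous_intros)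

text \<open>The Jacobian \<open>exp (2 * Re u)\<close> outweighs the kernel, whose modulus is
  \<open>exp (- Re u)\<close>.\<close>

lemma set_integrable_cauchy_kernel_ball:
  "set_integrable lborel (ball \<zeta> r) (\<lambda>w. 1 / (\<zeta> - w :: complex))"
proof (cases "r > 0")
  case True
  have m: "set_borel_measurable borel (ball \<zeta> r) (\<lambda>w. 1 / (\<zeta> - w))"
    by (intro set_borel_measurable_borel borel_measurable_cauchy_kernel) auto
  have "set_integrable lborel (polar_strip {..<ln r}) (\<lambda>u. exp (2 * Re u) *\<^sub>R (1 / (\<zeta> - (\<zeta> + exp u))))"
  proof (rule set_integrable_bound)
    have "set_integrable lborel {..<ln r} (\<lambda>x. complex_of_real (exp (1 * x)))"
      using set_integrable_exp_at_bot[of 1] by (simp only: set_integrable_of_real_iff)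
    from set_integrable_polar_strip_Re(1)[OF this]
    show "set_integrable lborel (polar_strip {..<ln r}) (\<lambda>u. complex_of_real (exp (Re u)))" by simp
    show "set_borel_measurable lborel (polar_strip {..<ln r}) (\<lambda>u. exp (2 * Re u) *\<^sub>R (1 / (\<zeta> - (\<zeta> + exp u))))"
      using open_polar_strip[of "{..<ln r}"]
      by (auto simp: set_borel_measurable_def intro!: borel_measurable_continuous_on_indicator continuous_intros)
  qed (auto simp: norm_divide exp_double power2_eq_square)
  then show ?thesis
    using set_integral_polar(1)[OF _ set_integral_ball_log_annulus(1)[OF True m]]
      set_integral_ball_log_annulus(2)[OF True m] by simp
qed (auto simp: ball_empty set_integrable_def)

text \<open>The Jacobian turns the fourth power into \<open>exp (- 2 * Re u)\<close>, with integral
  \<open>1 / (2 * \<delta>^2)\<close> over \<open>Re u > ln \<delta>\<close>; the angle contributes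
  \<open>2 * pi\<close>. The fourth power arises as the square of the decay
  \<open>1 / |\<zeta> - w|^2\<close> of a difference of two Cauchy kernels.\<close>

lemma set_integral_norm_power4_outside:
  assumes "\<delta> > 0"
  shows "set_integrable lborel {w. \<delta> < cmod (w - \<zeta>)} (\<lambda>w. 1 / cmod (w - \<zeta>) ^ 4)"
    and "(LINT w:{w. \<delta> < cmod (w - \<zeta>)}|lborel. 1 / cmod (w - \<zeta>) ^ 4) = pi / \<delta>\<^sup>2"
proof -
  let ?F = "\<lambda>w. complex_of_real (1 / cmod (w - \<zeta>) ^ 4)"
  let ?I = "{ln \<delta><..}"
  have A: "{w. \<delta> < cmod (w - \<zeta>)} = log_annulus \<zeta> ?I"
  proof (rule set_eqI)
    fix w show "w \<in> {w. \<delta> < cmod (w - \<zeta>)} \<longleftrightarrow> w \<in> log_annulus \<zeta> ?I"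
      using assms by (cases "w = \<zeta>") (auto simp: log_annulus_def)
  qed
  have m: "set_borel_measurable borel (log_annulus \<zeta> ?I) ?F"
    using open_log_annulus[of ?I \<zeta>] by (intro set_borel_measurable_borel) auto
  have fn: "exp (2 * Re u) *\<^sub>R ?F (\<zeta> + exp u) = complex_of_real (exp (- 2 * Re u))" for u
  proof -
    have "exp (2 * Re u) * (1 / exp (Re u) ^ 4) = exp (2 * Re u - 4 * Re u)"
      unfolding exp_diff by (simp flip: exp_of_nat_mult)
    then show ?thesis
      by (simp add: norm_exp_eq_Re scaleR_conv_of_real flip: of_real_mult of_real_power of_real_divide)
  qed
  have 0: "set_integrable lborel ?I (\<lambda>x. complex_of_real (exp (- 2 * x)))"
    using set_integral_exp_at_top(1)[of 2] by (simp only: set_integrable_of_real_iff)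
  note 1 = set_integrable_polar_strip_Re[OF 0]
  have 2: "set_integrable lborel (log_annulus \<zeta> ?I) ?F"
    using set_integral_polar(1)[OF _ m] 1(1) unfolding fn by simp
  have "(LINT w:log_annulus \<zeta> ?I|lborel. ?F w) = (LINT u:polar_strip ?I|lborel. complex_of_real (exp (- 2 * Re u)))"
    using set_integral_polar(2)[OF _ m 2] unfolding fn by simp
  also have "\<dots> = 2 * pi * complex_of_real (LINT x:?I|lborel. exp (- 2 * x))"
    using 1(2) by (simp add: set_integral_complex_of_real)
  also have "(LINT x:?I|lborel. exp (- 2 * x)) = exp (- 2 * ln \<delta>) / 2"
    by (rule set_integral_exp_at_top) simp
  also have "exp (- 2 * ln \<delta>) = 1 / \<delta>\<^sup>2"
    using assms exp_double[of "ln \<delta>"] by (simp add: exp_minus field_simps)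
  finally have "(LINT w:log_annulus \<zeta> ?I|lborel. ?F w) = complex_of_real (pi / \<delta>\<^sup>2)"
    by simp
  then have "complex_of_real (LINT w:log_annulus \<zeta> ?I|lborel. 1 / cmod (w - \<zeta>) ^ 4) = complex_of_real (pi / \<delta>\<^sup>2)"
    by (simp only: set_integral_complex_of_real)
  then show "(LINT w:{w. \<delta> < cmod (w - \<zeta>)}|lborel. 1 / cmod (w - \<zeta>) ^ 4) = pi / \<delta>\<^sup>2"
    unfolding A of_real_eq_iff .
  show "set_integrable lborel {w. \<delta> < cmod (w - \<zeta>)} (\<lambda>w. 1 / cmod (w - \<zeta>) ^ 4)"
    unfolding A using 2 by (simp only: set_integrable_of_real_iff)
qed

text \<open>Cauchy's formula with \<open>u = z + \<rho> * cis y\<close> and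
  \<open>du = \<i> * \<rho> * cis y dy\<close>; the factor \<open>\<i>\<close> cancels on both
  sides.\<close>

lemma circle_average_cauchy:
  fixes f :: "complex \<Rightarrow> complex"
  assumes "f holomorphic_on ball z R" "0 < \<rho>" "\<rho> < R" "w \<in> ball z \<rho>"
  shows "(LINT y:{0<..<2 * pi}|lborel. f (z + \<rho> * cis y) * (\<rho> * cis y) / (z + \<rho> * cis y - w)) = 2 * pi * f w"
proof -
  let ?g = "\<lambda>y. f (z + \<rho> * cis y) * (\<rho> * cis y) / (z + \<rho> * cis y - w)"
  have sub: "cball z \<rho> \<subseteq> ball z R" using assms by auto
  have "((\<lambda>u. f u/(u-w)) has_contour_integral (2 * of_real pi * \<i> * f w)) (circlepath z \<rho>)"
    using assms sub
    by (intro Cauchy_integral_circlepath)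
       (auto intro: holomorphic_on_imp_continuous_on holomorphic_on_subset simp: dist_norm norm_minus_commute)
  then have "((\<lambda>y. f (z + \<rho> * cis y) / (z + \<rho> * cis y - w) * \<rho> * \<i> * cis y) has_integral (2 * of_real pi * \<i> * f w)) {0..2*pi}"
    unfolding circlepath_def by (subst (asm) has_contour_integral_part_circlepath_iff) auto
  from has_integral_mult_right[OF this, of "-\<i>"]
  have hi: "(?g has_integral (2 * pi * f w)) {0..2*pi}"
    by (simp add: field_simps)
  have cont: "continuous_on {0..2*pi} ?g"
  proof -
    have "continuous_on {0..2*pi} (\<lambda>y::real. f (z + \<rho> * cis y))"
      by (rule continuous_on_compose2[OF holomorphic_on_imp_continuous_on[OF assms(1)]])
         (use assms in \<open>auto intro!: continuous_intros simp: dist_norm norm_mult\<close>)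
    moreover have "z + \<rho> * cis y - w \<noteq> 0" for y
    proof
      assume "z + \<rho> * cis y - w = 0"
      then have "w - z = \<rho> * cis y" by (simp add: algebra_simps)
      then have "cmod (w - z) = \<rho>" using assms by (simp add: norm_mult)
      then show False using assms by (simp add: dist_norm norm_minus_commute)
    qed
    ultimately show ?thesis by (intro continuous_intros) auto
  qed
  then have "set_integrable lborel {0..2*pi} ?g" by (rule borel_integrable_atLeastAtMost')
  then have s: "set_integrable lborel {0<..<2*pi} ?g" by (rule set_integrable_subset) auto
  have "(LINT y:{0<..<2 * pi}|lborel. ?g y) = integral {0<..<2*pi} ?g"
    by (rule set_borel_integral_eq_integral[OF s])
  also have "\<dots> = integral {0..2*pi} ?g"
    by (rule integral_open_interval_real [symmetric])
  also have "\<dots> = 2 * pi * f w" using hi by (rule integral_unique)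
  finally show ?thesis .
qed

text \<open>On the circle \<open>cnj (cis y) = 1 / cis y\<close>, so the conjugate of the integrand
  is again holomorphic in \<open>u = z + \<rho> * cis y\<close>, with its pole at
  \<open>z + \<rho>^2 / cnj b\<close>. This is the mirror image of \<open>z + b\<close> in the
  circle, hence outside it if \<open>|b| < \<rho>\<close> and inside it if
  \<open>|b| > \<rho>\<close>.\<close>

lemma circle_average_cnj_kernel:
  fixes f :: "complex \<Rightarrow> complex"
  assumes f: "f holomorphic_on ball z R" and \<rho>: "0 < \<rho>" "\<rho> < R" and ne: "cmod b \<noteq> \<rho>"
  shows "(LINT y:{0<..<2 * pi}|lborel. cnj (f (z + \<rho> * cis y)) / (b - \<rho> * cis y)) =
     (if cmod b < \<rho> then 0 else 2 * pi * cnj (f (z + \<rho>\<^sup>2 / cnj b)) / b)"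
proof -
  let ?S = "{0<..<2 * pi}"
  have cis: "cnj (cis y) * cis y = 1" for y by (simp add: cis_cnj cis_mult)
  have nz: "b - \<rho> * cis y \<noteq> 0" for y
  proof
    assume "b - \<rho> * cis y = 0"
    then have "cmod b = cmod (\<rho> * cis y)" by simp
    then show False using ne \<rho> by (simp add: norm_mult)
  qed
  have eq: "cnj (f (z + \<rho> * cis y)) / (b - \<rho> * cis y) =
     cnj (f (z + \<rho> * cis y) * cis y / (cnj b * cis y - \<rho>))" for y
  proof -
    have "cnj (cnj b * cis y - \<rho>) = (b - \<rho> * cis y) * cnj (cis y)"
      using cis[of y] by (simp add: algebra_simps)
    moreover have "cnj (cis y) \<noteq> 0" by simp
    ultimately show ?thesis using nz[of y] by (simp only: complex_cnj_divide complex_cnj_mult) simp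
  qed
  have "(LINT y:?S|lborel. cnj (f (z + \<rho> * cis y)) / (b - \<rho> * cis y)) =
     cnj (LINT y:?S|lborel. f (z + \<rho> * cis y) * cis y / (cnj b * cis y - \<rho>))"
    unfolding eq set_lebesgue_integral_def by (simp only: complex_cnj_scaleR[symmetric] Bochner_Integration.integral_cnj)
  also have "(LINT y:?S|lborel. f (z + \<rho> * cis y) * cis y / (cnj b * cis y - \<rho>)) =
     (if cmod b < \<rho> then 0 else 2 * pi * f (z + \<rho>\<^sup>2 / cnj b) / cnj b)"
  proof (cases "cmod b < \<rho>")
    case True
    \<comment> \<open>The factor \<open>u - z\<close> makes \<open>g\<close> vanish at the centre,
      the point at which the averaging formula is applied to it.\<close>
    define g where "g u = f u * (u - z) / (\<rho> * (cnj b * (u - z) - \<rho>\<^sup>2))" for u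
    \<comment> \<open>For \<open>b \<noteq> 0\<close> the pole of \<open>g\<close> has distance
      \<open>\<rho>^2 / |b| > \<rho>\<close> from \<open>z\<close>, which leaves room for a disc
      slightly larger than the circle in which \<open>g\<close> is holomorphic.\<close>
    obtain R' where R': "\<rho> < R'" "R' \<le> R" "cmod b * R' < \<rho>\<^sup>2"
    proof (cases "b = 0")
      case True then show ?thesis using that[of R] \<rho> by simp
    next
      case False
      then have "\<rho> < min R (\<rho>\<^sup>2 / cmod b)" using True \<rho> by (simp add: field_simps power2_eq_square)
      then obtain R' where "\<rho> < R'" "R' < min R (\<rho>\<^sup>2 / cmod b)" using dense by blast
      then show ?thesis using that[of R'] False by (simp add: field_simps)
    qed
    have "cnj b * (u - z) \<noteq> \<rho>\<^sup>2" if "u \<in> ball z R'" for u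
    proof
      assume "cnj b * (u - z) = \<rho>\<^sup>2"
      then have "cmod (cnj b * (u - z)) = cmod (\<rho>\<^sup>2)" by simp
      then have "cmod b * cmod (u - z) = \<rho>\<^sup>2" by (simp add: norm_mult norm_power)
      moreover have "cmod b * cmod (u - z) \<le> cmod b * R'"
        using that by (intro mult_left_mono) (auto simp: dist_norm norm_minus_commute)
      ultimately show False using R' by simp
    qed
    then have "g holomorphic_on ball z R'"
      unfolding g_def using \<rho> R'
      by (intro holomorphic_intros holomorphic_on_subset[OF f]) (auto simp flip: of_real_power)
    from circle_average_cauchy[OF this \<rho>(1) R'(1), of z]
    have "(LINT y:?S|lborel. g (z + \<rho> * cis y) * (\<rho> * cis y) / (z + \<rho> * cis y - z)) = 0"
      using \<rho> by (simp add: g_def)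
    moreover have "g (z + \<rho> * cis y) * (\<rho> * cis y) / (z + \<rho> * cis y - z) =
        f (z + \<rho> * cis y) * cis y / (cnj b * cis y - \<rho>) * (1 / \<rho>)" for y
    proof -
      have "\<rho> * (cnj b * (\<rho> * cis y) - \<rho>\<^sup>2) = \<rho>\<^sup>2 * (cnj b * cis y - \<rho>)"
        by (simp add: algebra_simps power2_eq_square)
      then show ?thesis using \<rho> by (simp add: g_def power2_eq_square)
    qed
    ultimately have "(LINT y:?S|lborel. f (z + \<rho> * cis y) * cis y / (cnj b * cis y - \<rho>)) * (1 / \<rho>) = 0"
      by (simp only: set_integral_mult_left)
    then show ?thesis using True \<rho> by simp
  next
    case False
    then have b: "cmod b > \<rho>" "b \<noteq> 0" using ne \<rho> by auto
    have "cmod (\<rho>\<^sup>2 / cnj b) < \<rho>"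
      using b \<rho> by (simp add: norm_divide norm_mult field_simps power2_eq_square)
    then have "z + \<rho>\<^sup>2 / cnj b \<in> ball z \<rho>" by (simp add: dist_norm norm_minus_commute)
    from circle_average_cauchy[OF f \<rho> this]
    have *: "(LINT y:?S|lborel. f (z + \<rho> * cis y) * (\<rho> * cis y) / (z + \<rho> * cis y - (z + \<rho>\<^sup>2 / cnj b)))
      = 2 * pi * f (z + \<rho>\<^sup>2 / cnj b)" .
    have shift: "f (z + \<rho> * cis y) * cis y / (cnj b * cis y - \<rho>) = 
       f (z + \<rho> * cis y) * (\<rho> * cis y) / (z + \<rho> * cis y - (z + \<rho>\<^sup>2 / cnj b)) * (1 / cnj b)" for y
    proof -
      have "(z + \<rho> * cis y - (z + \<rho>\<^sup>2 / cnj b)) * cnj b = \<rho> * (cnj b * cis y - \<rho>)"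
        using b by (simp add: field_simps power2_eq_square)
      then have eq: "\<rho> * (cnj b * cis y - \<rho>) = cnj b * (z + \<rho> * cis y - (z + \<rho>\<^sup>2 / cnj b))"
        by (simp only: mult.commute)
      have gen: "u * v / w = u * (r * v) / t * (1 / s)" if "r * w = s * t" "r \<noteq> 0" "s \<noteq> 0"
        for u v w r s t :: complex
      proof -
        have "u * v / w = u * (r * v) / (r * w)" using that(2) by simp
        also have "\<dots> = u * (r * v) / t * (1 / s)" unfolding that(1) by simp
        finally show ?thesis .
      qed
      show ?thesis by (rule gen[OF eq]) (use \<rho> b in auto)
    qed
    have "(LINT y:?S|lborel. f (z + \<rho> * cis y) * cis y / (cnj b * cis y - \<rho>)) = 
       2 * pi * f (z + \<rho>\<^sup>2 / cnj b) * (1 / cnj b)"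
      unfolding shift set_integral_mult_left * ..
    then show ?thesis using False by simp
  qed
  finally show ?thesis by auto
qed

text \<open>A case of the Cauchy-Pompeiu formula, \<open>cnj (deriv \<Psi>)\<close> being the d-bar
  derivative of \<open>cnj \<Psi>\<close>, obtained by integrating over circles about
  \<open>z\<close>. Circles of radius greater than \<open>|\<zeta> - z|\<close> contribute 0. A
  smaller one contributes the derivative at the mirror image of \<open>\<zeta>\<close> in it. This
  point moves from \<open>z\<close> to \<open>\<zeta>\<close> as the circle grows until it passes
  through \<open>\<zeta>\<close>, and the fundamental theorem of calculus along its path yields the
  difference of values.\<close>

proposition area_integral_cnj_deriv_kernel:
  assumes \<Psi>: "\<Psi> holomorphic_on ball z R" and r: "0 < r" "r < R" and \<zeta>: "\<zeta> \<in> ball z r"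
  shows "set_integrable lborel (ball z r) (\<lambda>w. cnj (deriv \<Psi> w) / (\<zeta> - w))"
    and "(LINT w:ball z r|lborel. cnj (deriv \<Psi> w) / (\<zeta> - w)) = pi * cnj (\<Psi> \<zeta> - \<Psi> z)"
proof -
  let ?f = "deriv \<Psi>" and ?I = "{..<ln r}" and ?F = "\<lambda>w. cnj (deriv \<Psi> w) / (\<zeta> - w)"
  define b where "b = \<zeta> - z"
  have b: "cmod b < r" using \<zeta> by (simp add: b_def dist_norm norm_minus_commute)
  have f: "?f holomorphic_on ball z R" using \<Psi> by (intro holomorphic_deriv) auto
  have contf: "continuous_on (cball z r) ?f"
    using r by (intro holomorphic_on_imp_continuous_on holomorphic_on_subset[OF f]) auto
  have m: "set_borel_measurable borel (ball z r) ?F"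
  proof -
    have "(\<lambda>w. (indicator (ball z r) w *\<^sub>R cnj (?f w)) * (1 / (\<zeta> - w))) \<in> borel_measurable borel"
      using r by (intro borel_measurable_times borel_measurable_cauchy_kernel borel_measurable_continuous_on_indicator
          continuous_intros continuous_on_subset[OF contf]) auto
    then show ?thesis by (simp add: set_borel_measurable_def field_simps)
  qed
  have "bounded (?f ` cball z r)" by (intro compact_imp_bounded compact_continuous_image contf) auto
  then obtain B where B: "B > 0" "\<And>w. w \<in> cball z r \<Longrightarrow> cmod (?f w) \<le> B"
    unfolding bounded_pos by auto
  show int: "set_integrable lborel (ball z r) ?F"
  proof (rule set_integrable_bound)
    have "set_integrable lborel (ball z r) (\<lambda>w. 1 / (\<zeta> - w))"
    proof (rule set_integrable_subset[OF set_integrable_cauchy_kernel_ball[of \<zeta> "2 * r"]])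
      show "ball z r \<subseteq> ball \<zeta> (2 * r)"
      proof
        fix w assume "w \<in> ball z r"
        then show "w \<in> ball \<zeta> (2 * r)" using \<zeta> dist_triangle[of \<zeta> w z] by (auto simp: dist_commute)
      qed
    qed auto
    then show "set_integrable lborel (ball z r) (\<lambda>w. complex_of_real B * (1 / (\<zeta> - w)))"
      by (rule set_integrable_mult_right)
    show "AE w in lborel. w \<in> ball z r \<longrightarrow> norm (?F w) \<le> norm (complex_of_real B * (1 / (\<zeta> - w)))"
      using B by (intro AE_I2) (auto simp: norm_divide norm_mult intro!: divide_right_mono)
  qed (use m in \<open>simp add: set_borel_measurable_def\<close>)
  note ann = set_integral_ball_log_annulus[OF r(1) m]
  have intA: "set_integrable lborel (log_annulus z ?I) ?F" using int ann by simp
  let ?G = "\<lambda>u. exp (2 * Re u) *\<^sub>R ?F (z + exp u)"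
  have intG: "set_integrable lborel (polar_strip ?I) ?G"
    using set_integral_polar(1)[OF _ ann(1)] intA by simp
  \<comment> \<open>The contribution of the circle of radius \<open>exp x\<close>, Jacobian
    included.\<close>
  define K where "K x = (LINT y:{0<..<2 * pi}|lborel. ?G (Complex x y))" for x
  have K: "K x = (if cmod b < exp x then 0 else 2 * pi * complex_of_real (exp (2 * x)) * cnj (?f (z + complex_of_real (exp (2 * x)) / cnj b)) / b)"
    if "x < ln r" "cmod b \<noteq> exp x" for x
  proof -
    have lt: "exp x < r" using that(1) r by (metis exp_less_cancel_iff exp_ln)
    have "?G (Complex x y) = exp (2 * x) *\<^sub>R (cnj (?f (z + exp x * cis y)) / (b - exp x * cis y))" for y
      by (simp add: exp_eq_polar b_def algebra_simps)
    then have "K x = exp (2 * x) *\<^sub>R (LINT y:{0<..<2 * pi}|lborel. cnj (?f (z + exp x * cis y)) / (b - exp x * cis y))"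
      unfolding K_def by (simp only: set_integral_scaleR_right)
    also have "\<dots> = exp (2 * x) *\<^sub>R (if cmod b < exp x then 0 else 2 * pi * cnj (?f (z + (exp x)\<^sup>2 / cnj b)) / b)"
      using circle_average_cnj_kernel[OF f, of "exp x" b] lt r that(2) by simp
    moreover have "(complex_of_real (exp x))\<^sup>2 = complex_of_real (exp (2 * x))"
      by (simp add: exp_double)
    ultimately show ?thesis by (simp add: scaleR_conv_of_real)
  qed
  have "(LINT w:ball z r|lborel. ?F w) = (LINT u:polar_strip ?I|lborel. ?G u)"
    using ann set_integral_polar(2)[OF _ ann(1) intA] by simp
  also have "\<dots> = (LINT x:?I|lborel. K x)"
    unfolding K_def by (rule set_integral_polar_strip_iterated[OF intG])
  also have "\<dots> = pi * cnj (\<Psi> \<zeta> - \<Psi> z)"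
  proof (cases "b = 0")
    case True
    then have "(LINT x:?I|lborel. K x) = (LINT x:?I|lborel. 0)"
      using K by (intro set_lebesgue_integral_cong) auto
    then show ?thesis using True by (simp add: b_def)
  next
    case False
    let ?c = "ln (cmod b)"
    let ?k = "\<lambda>x::real. 2 * pi * complex_of_real (exp (2 * x)) * cnj (?f (z + complex_of_real (exp (2 * x)) / cnj b)) / b"
    let ?P = "\<lambda>x::real. pi * cnj (\<Psi> (z + complex_of_real (exp (2 * x)) / cnj b))"
    have cr: "?c < ln r" using b False by (intro ln_less_cancel_iff[THEN iffD2]) (use r in auto)
    have inb: "z + complex_of_real (exp (2 * x)) / cnj b \<in> ball z r" if "x \<le> ?c" for x :: real
    proof -
      have "exp (2 * x) \<le> exp (2 * ?c)" using that by simp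
      also have "\<dots> = cmod b * cmod b" using False by (simp add: exp_double power2_eq_square)
      finally have "exp (2 * x) / cmod b \<le> cmod b" using False by (simp add: field_simps)
      also have "\<dots> < r" using b by simp
      finally show ?thesis by (simp add: dist_norm norm_divide)
    qed
    have Keq: "K x = indicator {..<?c} x *\<^sub>R ?k x" if "x \<in> ?I" "x \<noteq> ?c" for x
    proof -
      have "cmod b \<noteq> exp x" using that False by (metis ln_exp)
      moreover have "cmod b < exp x \<longleftrightarrow> \<not> x < ?c"
        using that False by (metis exp_less_cancel_iff exp_ln not_less_iff_gr_or_eq zero_less_norm_iff)
      ultimately show ?thesis
        using K[of x] that by (auto simp: indicator_def)
    qed
    have e: "einterval (-\<infinity>) (ereal ?c) = {..<?c}" by (auto simp: einterval_iff)
    have cont: "isCont ?k x" if "x \<le> ?c" for x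
    proof -
      have "isCont ?f (z + complex_of_real (exp (2 * x)) / cnj b)"
        using f inb[OF that] r by (intro continuous_on_interior[OF holomorphic_on_imp_continuous_on[OF f]]) auto
      then show ?thesis using False
        by (intro continuous_intros continuous_at_compose[of x "\<lambda>x. z + complex_of_real (exp (2 * x)) / cnj b" ?f, unfolded o_def]) auto
    qed
    have kint: "set_integrable lborel {..<?c} ?k"
    proof (rule set_integrable_bound)
      show "set_integrable lborel {..<?c} (\<lambda>x. (2 * pi * B / cmod b) * exp (2 * x))"
        using set_integrable_exp_at_bot[of 2 ?c] by simp
      have "continuous_on {..<?c} ?k"
        using cont by (intro continuous_at_imp_continuous_on) auto
      then show "set_borel_measurable lborel {..<?c} ?k"
        unfolding set_borel_measurable_def by (simp add: borel_measurable_continuous_on_indicator)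
      have "norm (?k x) \<le> 2 * pi * B / cmod b * exp (2 * x)" if "x < ?c" for x
      proof -
        have "norm (?k x) = (2 * pi * exp (2 * x) / cmod b) * cmod (?f (z + complex_of_real (exp (2 * x)) / cnj b))"
          by (simp add: norm_mult norm_divide)
        also have "\<dots> \<le> (2 * pi * exp (2 * x) / cmod b) * B"
          using inb[of x] that by (intro mult_left_mono B(2)) auto
        finally show ?thesis by (simp add: mult_ac)
      qed
      then show "AE x in lborel. x \<in> {..<?c} \<longrightarrow> norm (?k x) \<le> norm ((2 * pi * B / cmod b) * exp (2 * x))"
        using B(1) by (intro AE_I2) auto
    qed
    \<comment> \<open>The mirror point has velocity \<open>2 * exp (2 * x) / cnj b\<close>;
      conjugated and multiplied by \<open>pi\<close> this is exactly the weight in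
      \<open>?k\<close>.\<close>
    have P: "(?P has_vector_derivative ?k x) (at x)" if "x \<le> ?c" for x
    proof -
      let ?e = "z + complex_of_real (exp (2 * x)) / cnj b"
      have "(\<Psi> has_field_derivative ?f ?e) (at ?e)"
        using inb[OF that] r by (intro holomorphic_derivI[OF \<Psi>]) auto
      moreover have "((\<lambda>x::real. z + complex_of_real (exp (2 * x)) / cnj b) has_vector_derivative (2 * complex_of_real (exp (2 * x)) / cnj b)) (at x)"
      proof -
        have "((\<lambda>x::real. exp (2 * x)) has_real_derivative 2 * exp (2 * x)) (at x)"
          by (auto intro!: derivative_eq_intros)
        from has_vector_derivative_add[OF has_vector_derivative_const[of z]
            has_vector_derivative_divide[OF has_vector_derivative_of_real[OF this], of "cnj b"]]
        show ?thesis by simp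
      qed
      ultimately have "((\<Psi> \<circ> (\<lambda>x::real. z + complex_of_real (exp (2 * x)) / cnj b)) has_vector_derivative (2 * complex_of_real (exp (2 * x)) / cnj b * ?f ?e)) (at x)"
        by (rule field_vector_diff_chain_at[rotated])
      then have "((\<lambda>x::real. \<Psi> (z + complex_of_real (exp (2 * x)) / cnj b)) has_vector_derivative (2 * complex_of_real (exp (2 * x)) / cnj b * ?f ?e)) (at x)"
        by (simp add: o_def)
      then have "((\<lambda>x::real. cnj (\<Psi> (z + complex_of_real (exp (2 * x)) / cnj b))) has_vector_derivative cnj (2 * complex_of_real (exp (2 * x)) / cnj b * ?f ?e)) (at x)"
        by (rule has_vector_derivative_cnj)
      then have "((\<lambda>x::real. pi * cnj (\<Psi> (z + complex_of_real (exp (2 * x)) / cnj b))) has_vector_derivative pi * cnj (2 * complex_of_real (exp (2 * x)) / cnj b * ?f ?e)) (at x)"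
        by (rule has_vector_derivative_mult_right)
      then show ?thesis by (simp add: algebra_simps)
    qed
    have "(LINT x:?I|lborel. K x) = (LINT x:?I|lborel. indicator {..<?c} x *\<^sub>R ?k x)"
      unfolding set_lebesgue_integral_def
    proof (rule integral_cong_AE)
      have mk: "(\<lambda>x. indicator {..<?c} x *\<^sub>R ?k x) \<in> borel_measurable borel"
        using kint unfolding set_integrable_def by (auto dest: borel_measurable_integrable)
      show mk': "(\<lambda>x. indicator ?I x *\<^sub>R indicator {..<?c} x *\<^sub>R ?k x) \<in> borel_measurable lborel"
        by (rule borel_measurable_scaleR) (use mk in simp_all)
      \<comment> \<open>The formula for \<open>K\<close> is available off \<open>?c\<close> only.
        Altering a measurable function at one point keeps it measurable, so \<open>K\<close> is
        measurable on \<open>?I\<close> whatever its value at \<open>?c\<close>.\<close>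
      have "(\<lambda>x. if x = ?c then K ?c else indicator ?I x *\<^sub>R indicator {..<?c} x *\<^sub>R ?k x) \<in> borel_measurable lborel"
        using mk' by (intro measurable_If) auto
      also have "(\<lambda>x. if x = ?c then K ?c else indicator ?I x *\<^sub>R indicator {..<?c} x *\<^sub>R ?k x) = (\<lambda>x. indicator ?I x *\<^sub>R K x)"
      proof (rule ext)
        fix x
        show "(if x = ?c then K ?c else indicator ?I x *\<^sub>R indicator {..<?c} x *\<^sub>R ?k x) = indicator ?I x *\<^sub>R K x"
          using cr Keq[of x] by (cases "x \<in> ?I"; cases "x = ?c") simp_all
      qed
      finally show "(\<lambda>x. indicator ?I x *\<^sub>R K x) \<in> borel_measurable lborel" .
      show "AE x in lborel. indicator ?I x *\<^sub>R K x = indicator ?I x *\<^sub>R indicator {..<?c} x *\<^sub>R ?k x"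
        using AE_lborel_singleton[of ?c] by eventually_elim (use Keq in \<open>auto simp: indicator_def\<close>)
    qed
    also have "\<dots> = (LINT x:{..<?c}|lborel. ?k x)"
      unfolding set_lebesgue_integral_def using cr
      by (intro Bochner_Integration.integral_cong) (auto simp: indicator_def)
    also have "\<dots> = (LBINT x=-\<infinity>..ereal ?c. ?k x)"
      by (simp add: interval_lebesgue_integral_def e)
    also have "\<dots> = ?P ?c - pi * cnj (\<Psi> z)"
    proof (rule interval_integral_FTC_integrable)
      show "set_integrable lborel (einterval (-\<infinity>) (ereal ?c)) ?k" using kint by (simp add: e)
      have "isCont ?P ?c" using has_vector_derivative_continuous[OF P[of ?c]] by simp
      then have "(?P \<longlongrightarrow> ?P ?c) (at_left ?c)"
        by (meson continuous_at_imp_continuous_at_within continuous_within)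
      then show "((?P \<circ> real_of_ereal) \<longlongrightarrow> ?P ?c) (at_left (ereal ?c))"
        by (simp add: ereal_tendsto_simps)
      have c\<Psi>: "isCont \<Psi> z" 
        using r by (intro continuous_on_interior[OF holomorphic_on_imp_continuous_on[OF \<Psi>]]) auto
      have "((\<lambda>x::real. z + of_real (exp (2 * x)) / cnj b) \<longlongrightarrow> z + of_real 0 / cnj b) at_bot"
        using False by (intro tendsto_intros) (real_asymp, simp)
      then have "((\<lambda>x::real. z + of_real (exp (2 * x)) / cnj b) \<longlongrightarrow> z) at_bot" by simp
      from isCont_tendsto_compose[OF c\<Psi> this]
      have "(?P \<longlongrightarrow> pi * cnj (\<Psi> z)) at_bot"
        by (intro tendsto_intros) simp
      then show "((?P \<circ> real_of_ereal) \<longlongrightarrow> pi * cnj (\<Psi> z)) (at_right (-\<infinity>))"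
        by (simp add: ereal_tendsto_simps)
    qed (use P cont in auto)
    also have "?P ?c = pi * cnj (\<Psi> \<zeta>)"
    proof -
      have "complex_of_real (exp (2 * ?c)) = b * cnj b"
        using False complex_norm_square[of b] by (simp add: exp_double)
      then have "complex_of_real (exp (2 * ?c)) / cnj b = b"
        using False by simp
      then show ?thesis by (simp add: b_def)
    qed
    finally show ?thesis by (simp add: algebra_simps)
  qed
  finally show "(LINT w:ball z r|lborel. ?F w) = pi * cnj (\<Psi> \<zeta> - \<Psi> z)" .
qed

section \<open>Reflection of harmonic functions\<close>

text \<open>Cauchy's estimate for \<open>exp (\<i> F)\<close>, whose modulus is controlled by \<open>Im F\<close> from both sides.\<close>
lemma deriv_bound_of_Im_bound:
  assumes F: "F holomorphic_on ball s r" and r: "r > 0" and V: "\<And>z. z \<in> ball s r \<Longrightarrow> \<bar>Im (F z)\<bar> \<le> V"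
  shows "cmod (deriv F s) \<le> 2 * exp (2 * V + 1) / r"
proof -
  let ?g = "\<lambda>z. exp (\<i> * F z)"
  have hol: "?g holomorphic_on ball s r" using F by (intro holomorphic_intros)
  have ng: "cmod (?g z) = exp (- Im (F z))" for z by simp
  \<comment> \<open>The summand 1 in the exponent makes the bound strict, as membership in an open
    ball demands. Half the radius keeps the closed disc inside the domain.\<close>
  have "cmod ((deriv ^^ 1) ?g s) \<le> fact 1 * exp (V + 1) / (r / 2) ^ 1"
  proof (rule Cauchy_higher_deriv_bound)
    show "?g holomorphic_on ball s (r / 2)" using hol r by (rule_tac holomorphic_on_subset) auto
    show "continuous_on (cball s (r / 2)) ?g"
      using r by (intro holomorphic_on_imp_continuous_on holomorphic_on_subset[OF hol]) auto
    show "?g z \<in> ball 0 (exp (V + 1))" if "z \<in> ball s (r / 2)" for z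
      using V[of z] that r ng[of z] by simp
  qed (use r in auto)
  then have 1: "cmod (deriv ?g s) \<le> 2 * exp (V + 1) / r" by (simp add: field_simps)
  have "deriv ?g s = \<i> * deriv F s * ?g s"
    using F r by (intro DERIV_imp_deriv)
      (auto intro!: derivative_eq_intros holomorphic_derivI[of F "ball s r"] simp: mult_ac)
  then have "cmod (deriv ?g s) = cmod (deriv F s) * exp (- Im (F s))"
    using ng[of s] by (simp add: norm_mult)
  moreover have "exp (- Im (F s)) \<ge> exp (- V)" using V[of s] r by simp
  ultimately have "cmod (deriv F s) * exp (- V) \<le> 2 * exp (V + 1) / r"
    using 1 by (smt (verit) mult_left_mono norm_ge_zero)
  then have "cmod (deriv F s) * exp (- V) * exp V \<le> 2 * exp (V + 1) / r * exp V"
    by (intro mult_right_mono) auto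
  moreover have "exp (- V) * exp V = 1" by (simp add: mult_exp_exp)
  moreover have "exp (V + 1) * exp V = exp (2 * V + 1)" by (simp add: mult_exp_exp)
  ultimately show ?thesis by (simp add: mult.assoc)
qed

lemma vertical_derivative:
  assumes "(f has_field_derivative f') (at (Complex x y))"
  shows "((\<lambda>y. f (Complex x y)) has_vector_derivative (\<i> * f')) (at y within T)"
proof -
  have "((\<lambda>y. Complex x y) has_vector_derivative \<i>) (at y)"
    unfolding Complex_eq by (auto intro!: derivative_eq_intros)
  from field_vector_diff_chain_at[OF this assms] show ?thesis
    by (simp add: o_def has_vector_derivative_at_within)
qed

lemma horizontal_derivative_Im:
  assumes "(f has_field_derivative f') (at (Complex x y))"
  shows "((\<lambda>x. Im (f (Complex x y))) has_real_derivative Im f') (at x within T)"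
proof -
  have "((\<lambda>x. Complex x y) has_vector_derivative 1) (at x)"
    unfolding Complex_eq by (auto intro!: derivative_eq_intros)
  from field_vector_diff_chain_at[OF this assms]
  have "((\<lambda>x. f (Complex x y)) has_vector_derivative f') (at x)" by (simp add: o_def)
  then show ?thesis
    by (metis DERIV_subset has_vector_derivative_complex_iff top_greatest)
qed

text \<open>\<open>F\<close> itself need not be known to extend continuously to the real axis. But \<open>F' = O(1 / Im s)\<close>, so
  the second antiderivative \<open>K\<close> of \<open>F\<close> is Lipschitz, and \<open>Im K\<close> is affine on the real axis because its
  second derivative along horizontal lines tends to 0. Schwarz reflection applies to \<open>K\<close> minus an
  affine function.\<close>
lemma harmonic_reflection_at_0:
  assumes e: "e > 0" and F: "F holomorphic_on ball 0 e \<inter> {s. Im s > 0}"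
    and lim: "\<And>x::real. \<bar>x\<bar> < e \<Longrightarrow>
      ((\<lambda>s. Im (F s)) \<longlongrightarrow> 0) (at (of_real x) within (ball 0 e \<inter> {s. Im s > 0}))"
  obtains M e' where "0 < e'" "e' \<le> e" "M holomorphic_on ball 0 e'"
    "\<And>s. s \<in> ball 0 e' \<Longrightarrow> Im s > 0 \<Longrightarrow> M s = F s"
    "\<And>s. s \<in> ball 0 e' \<Longrightarrow> Im s < 0 \<Longrightarrow> M s = cnj (F (cnj s))"
proof -
  let ?B = "ball 0 e \<inter> {s. Im s > 0}"
  let ?Q = "cball 0 (e / 2) \<inter> {s. Im s \<ge> 0}"
  \<comment> \<open>With an eighth of the radius, every disc of radius \<open>y\<close> about a
    point with \<open>\<bar>x\<bar> \<le> h\<close> and \<open>0 < y \<le> h\<close> stays in the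
    half disc of radius \<open>e / 2\<close>.\<close>
  define h where "h = e / 8"
  have h: "h > 0" using e by (simp add: h_def)
  have openB: "open ?B" by (intro open_Int open_ball open_halfspace_Im_gt)
  have convB: "convex ?B" by (intro convex_Int convex_ball convex_halfspace_Im_gt)
  have compQ: "compact ?Q" by (intro compact_Int_closed compact_cball closed_halfspace_Im_ge)
  have Bmem: "Complex x y \<in> ?B" if "\<bar>x\<bar> \<le> 2 * h" "0 < y" "y \<le> 2 * h" for x y
    using that cmod_le[of "Complex x y"] e by (auto simp: h_def)
  \<comment> \<open>By hypothesis \<open>Im F\<close> extended by 0 is continuous up to the real
    axis. On the compact half disc it is therefore bounded and uniformly continuous; the bound gives
    the growth of \<open>F'\<close>, the uniformity the affine boundary values of
    \<open>Im K\<close>.\<close>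
  define v where "v s = (if Im s > 0 then Im (F s) else 0)" for s
  have vcont: "continuous_on ?Q v"
  proof (subst continuous_on_eq_continuous_within, rule ballI)
    fix s assume s: "s \<in> ?Q"
    show "continuous (at s within ?Q) v"
    proof (cases "Im s > 0")
      case True
      then have sB: "s \<in> ?B" using s e by auto
      have "continuous_on ?B (\<lambda>s. Im (F s))"
        using F by (intro continuous_intros holomorphic_on_imp_continuous_on)
      then have "isCont (\<lambda>s. Im (F s)) s" using sB openB by (simp add: continuous_on_eq_continuous_at)
      moreover have "eventually (\<lambda>s. v s = Im (F s)) (nhds s)"
        using eventually_nhds_in_open[OF openB sB] by eventually_elim (auto simp: v_def)
      ultimately have "isCont v s" by (simp add: isCont_cong)
      then show ?thesis by (rule continuous_at_imp_continuous_at_within)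
    next
      case False
      then have s0: "Im s = 0" "s = of_real (Re s)" "\<bar>Re s\<bar> < e"
        using s e abs_Re_le_cmod[of s] by (auto simp: complex_eq_iff)
      have 1: "(v \<longlongrightarrow> 0) (at s within ?B)"
      proof (rule Lim_transform_eventually)
        show "((\<lambda>s. Im (F s)) \<longlongrightarrow> 0) (at s within ?B)" using lim[OF s0(3)] s0(2)[symmetric] by simp
      qed (auto simp: eventually_at_filter v_def)
      have 2: "(v \<longlongrightarrow> 0) (at s within {s. Im s \<le> 0})"
        by (rule Lim_transform_eventually[OF tendsto_const]) (auto simp: eventually_at_filter v_def)
      have "(v \<longlongrightarrow> 0) (at s within (?B \<union> {s. Im s \<le> 0}))" using 1 2 by (rule Lim_Un)
      then have "(v \<longlongrightarrow> 0) (at s within ?Q)"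
        by (rule tendsto_within_subset) (use e in auto)
      then show ?thesis using s0 by (simp add: continuous_within v_def)
    qed
  qed
  have "bounded (v ` ?Q)" by (intro compact_imp_bounded compact_continuous_image vcont compQ)
  then obtain V where V: "\<And>s. s \<in> ?Q \<Longrightarrow> \<bar>v s\<bar> \<le> V"
    unfolding bounded_iff by (metis imageI real_norm_def)
  define C where "C = 2 * exp (2 * V + 1)"
  have C: "C > 0" by (simp add: C_def)
  \<comment> \<open>The largest disc about the point inside the upper half plane has radius
    \<open>y\<close>.\<close>
  have F': "cmod (deriv F (Complex x y)) \<le> C / y" if "\<bar>x\<bar> \<le> h" "0 < y" "y \<le> h" for x y
  proof -
    have sub: "ball (Complex x y) y \<subseteq> ?B \<inter> ?Q"
    proof
      fix s assume "s \<in> ball (Complex x y) y"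
      then have d: "cmod (s - Complex x y) < y" by (simp add: dist_norm norm_minus_commute)
      have "\<bar>Im s - y\<bar> < y" using abs_Im_le_cmod[of "s - Complex x y"] d by simp
      then have "Im s > 0" by auto
      moreover have "cmod s < e / 2"
        using d norm_triangle_ineq[of "s - Complex x y" "Complex x y"] cmod_le[of "Complex x y"] that
        by (simp add: h_def)
      ultimately show "s \<in> ?B \<inter> ?Q" using e by auto
    qed
    show ?thesis unfolding C_def
    proof (rule deriv_bound_of_Im_bound)
      show "F holomorphic_on ball (Complex x y) y" using F sub by (meson holomorphic_on_subset le_inf_iff)
      show "\<bar>Im (F z)\<bar> \<le> V" if "z \<in> ball (Complex x y) y" for z
        using V[of z] sub that by (auto simp: v_def subset_iff)
    qed (use that in auto)
  qed
  have Fd: "(F has_field_derivative deriv F s) (at s)" if "s \<in> ?B" for s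
    using that by (intro holomorphic_derivI[OF F openB])
  have seg: "compact ((\<lambda>x. Complex x h) ` {-h..h})" "(\<lambda>x. Complex x h) ` {-h..h} \<subseteq> ?B"
  proof -
    show "compact ((\<lambda>x. Complex x h) ` {-h..h})"
      by (intro compact_continuous_image) (auto simp: Complex_eq intro!: continuous_intros)
    show "(\<lambda>x. Complex x h) ` {-h..h} \<subseteq> ?B"
      using Bmem h by (intro image_subsetI) auto
  qed
  have segbound: "\<exists>A. \<forall>x. \<bar>x\<bar> \<le> h \<longrightarrow> cmod (f (Complex x h)) \<le> A" if "f holomorphic_on ?B" for f
  proof -
    have "bounded (f ` (\<lambda>x. Complex x h) ` {-h..h})"
      by (rule compact_imp_bounded, rule compact_continuous_image[OF _ seg(1)])
         (rule continuous_on_subset[OF holomorphic_on_imp_continuous_on[OF that] seg(2)])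
    then obtain A where "\<forall>x\<in>{-h..h}. cmod (f (Complex x h)) \<le> A"
      unfolding bounded_iff by auto
    then show ?thesis by (intro exI[of _ A]) (simp add: abs_le_iff)
  qed
  obtain A where A: "\<And>x. \<bar>x\<bar> \<le> h \<Longrightarrow> cmod (F (Complex x h)) \<le> A" using segbound[OF F] by blast
  \<comment> \<open>Integrating \<open>C / \<tau>\<close> downwards from height \<open>h\<close>
    costs a logarithm.\<close>
  have Fb: "cmod (F (Complex x y)) \<le> A + C * (ln h - ln y)" if xy: "\<bar>x\<bar> \<le> h" "0 < y" "y \<le> h" for x y
  proof (cases "y = h")
    case True then show ?thesis using A[of x] xy by simp
  next
    case False
    have "cmod (F (Complex x h) - F (Complex x y)) \<le> C * ln h - C * ln y"
    proof (rule differentiable_bound_general[where f' = "\<lambda>\<tau>. \<i> * deriv F (Complex x \<tau>)" and \<phi>' = "\<lambda>\<tau>. C / \<tau>"])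
      show "y < h" using False xy by simp
      show "continuous_on {y..h} (\<lambda>\<tau>. F (Complex x \<tau>))"
        using xy h Bmem
        by (intro continuous_on_vector_derivative[where f' = "\<lambda>\<tau>. \<i> * deriv F (Complex x \<tau>)"] vertical_derivative Fd) auto
      show "continuous_on {y..h} (\<lambda>\<tau>. C * ln \<tau>)" using xy by (auto intro!: continuous_intros)
      show "((\<lambda>\<tau>. F (Complex x \<tau>)) has_vector_derivative \<i> * deriv F (Complex x \<tau>)) (at \<tau>)" if "y < \<tau>" "\<tau> < h" for \<tau>
        using xy h Bmem that by (intro vertical_derivative Fd) auto
      show "((\<lambda>\<tau>. C * ln \<tau>) has_vector_derivative C / \<tau>) (at \<tau>)" if "y < \<tau>" "\<tau> < h" for \<tau>
        unfolding has_real_derivative_iff_has_vector_derivative[symmetric]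
        using that xy by (auto intro!: derivative_eq_intros)
      show "norm (\<i> * deriv F (Complex x \<tau>)) \<le> C / \<tau>" if "y < \<tau>" "\<tau> < h" for \<tau>
        using F'[of x \<tau>] xy that by (simp add: norm_mult)
    qed
    then show ?thesis using A[of x] xy norm_triangle_ineq2[of "F (Complex x y)" "F (Complex x h)"]
      by (simp add: norm_minus_commute algebra_simps)
  qed
  obtain P where "\<And>s. s \<in> ?B \<Longrightarrow> (P has_field_derivative F s) (at s within ?B)"
    using holomorphic_convex_primitive'[OF convB openB F] by blast
  then have P: "(P has_field_derivative F s) (at s)" if "s \<in> ?B" for s
    using that openB by (metis at_within_open)
  have Ph: "P holomorphic_on ?B" unfolding holomorphic_on_open[OF openB] using P by blast
  obtain K where "\<And>s. s \<in> ?B \<Longrightarrow> (K has_field_derivative P s) (at s within ?B)"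
    using holomorphic_convex_primitive'[OF convB openB Ph] by blast
  then have K: "(K has_field_derivative P s) (at s)" if "s \<in> ?B" for s
    using that openB by (metis at_within_open)
  obtain A2 where A2: "\<And>x. \<bar>x\<bar> \<le> h \<Longrightarrow> cmod (P (Complex x h)) \<le> A2" using segbound[OF Ph] by blast
  have A0: "A \<ge> 0" using A[of 0] h by (smt (verit) norm_ge_zero abs_zero)
  \<comment> \<open>The logarithm is integrable: \<open>A + C * (ln h - ln \<tau>)\<close> has
    integral \<open>(A + C) * h\<close> over \<open>0 < \<tau> < h\<close>, so \<open>P\<close> is
    bounded.\<close>
  define A3 where "A3 = A2 + (A + C) * h"
  have Pb: "cmod (P (Complex x y)) \<le> A3" if xy: "\<bar>x\<bar> \<le> h" "0 < y" "y \<le> h" for x y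
  proof (cases "y = h")
    case True then show ?thesis using A2[of x] xy A0 C h by (simp add: A3_def add_increasing2)
  next
    case False
    let ?\<phi> = "\<lambda>\<tau>. (A + C * ln h) * \<tau> - C * (\<tau> * ln \<tau> - \<tau>)"
    have "cmod (P (Complex x h) - P (Complex x y)) \<le> ?\<phi> h - ?\<phi> y"
    proof (rule differentiable_bound_general[where f' = "\<lambda>\<tau>. \<i> * F (Complex x \<tau>)" and \<phi>' = "\<lambda>\<tau>. A + C * (ln h - ln \<tau>)"])
      show "y < h" using False xy by simp
      show "continuous_on {y..h} (\<lambda>\<tau>. P (Complex x \<tau>))"
        using xy h Bmem
        by (intro continuous_on_vector_derivative[where f' = "\<lambda>\<tau>. \<i> * F (Complex x \<tau>)"] vertical_derivative P) auto
      show "continuous_on {y..h} ?\<phi>" using xy by (auto intro!: continuous_intros)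
      show "((\<lambda>\<tau>. P (Complex x \<tau>)) has_vector_derivative \<i> * F (Complex x \<tau>)) (at \<tau>)" if "y < \<tau>" "\<tau> < h" for \<tau>
        using xy h Bmem that by (intro vertical_derivative P) auto
      show "(?\<phi> has_vector_derivative A + C * (ln h - ln \<tau>)) (at \<tau>)" if "y < \<tau>" "\<tau> < h" for \<tau>
        unfolding has_real_derivative_iff_has_vector_derivative[symmetric]
        using that xy by (auto intro!: derivative_eq_intros simp: algebra_simps)
      show "norm (\<i> * F (Complex x \<tau>)) \<le> A + C * (ln h - ln \<tau>)" if "y < \<tau>" "\<tau> < h" for \<tau>
        using Fb[of x \<tau>] xy that by (simp add: norm_mult)
    qed
    also have "\<dots> = A * (h - y) + C * (h - y) + C * (y * (ln y - ln h))" by (simp add: algebra_simps)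
    also have "\<dots> \<le> A * h + C * h + 0"
    proof (intro add_mono mult_left_mono)
      show "C * (y * (ln y - ln h)) \<le> 0"
        using xy C by (intro mult_nonneg_nonpos mult_nonneg_nonpos) auto
    qed (use A0 C xy in auto)
    finally show ?thesis using A2[of x] xy norm_triangle_ineq2[of "P (Complex x y)" "P (Complex x h)"]
      by (simp add: norm_minus_commute A3_def algebra_simps)
  qed
  define R where "R = {s. \<bar>Re s\<bar> < h \<and> 0 < Im s \<and> Im s < h}"
  have R_B: "s \<in> ?B" if "s \<in> R" for s
    using Bmem[of "Re s" "Im s"] that h by (simp add: R_def)
  have Rbox: "R = box (Complex (-h) 0) (Complex h h)" by (auto simp: R_def in_box_complex_iff)
  then have convR: "convex R" by simp
  have lip: "cmod (K s - K s') \<le> A3 * cmod (s - s')" if "s \<in> R" "s' \<in> R" for s s'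
  proof (rule field_differentiable_bound[OF convR _ _ that])
    show "(K has_field_derivative P z) (at z within R)" if "z \<in> R" for z
      using K[OF R_B[OF that]] by (rule has_field_derivative_at_within)
    show "norm (P z) \<le> A3" if "z \<in> R" for z
      using Pb[of "Re z" "Im z"] that by (simp add: R_def)
  qed
  have "uniformly_continuous_on R K"
  proof -
    have "A3 \<ge> 0" using Pb[of 0 h] h by (smt (verit) norm_ge_zero abs_zero)
    then have "A3-lipschitz_on R K" using lip by (intro lipschitz_onI) (auto simp: dist_norm)
    then show ?thesis by (rule lipschitz_on_uniformly_continuous)
  qed
  then obtain Kb where Kb: "uniformly_continuous_on (closure R) Kb" "\<And>s. s \<in> R \<Longrightarrow> K s = Kb s"
    by (rule uniformly_continuous_on_extension_on_closure) blast
  have Kbc: "continuous_on (closure R) Kb" using Kb(1) by (rule uniformly_continuous_imp_continuous)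
  have clR: "Complex x y \<in> closure R" if "\<bar>x\<bar> < h" "0 \<le> y" "y < h" for x y
    unfolding closure_approachable
  proof (intro allI impI)
    fix \<epsilon> :: real assume "\<epsilon> > 0"
    define d where "d = min (\<epsilon> / 2) ((h - y) / 2)"
    have d: "0 < d" "d < \<epsilon>" "d < h - y" using \<open>\<epsilon> > 0\<close> that by (auto simp: d_def min_less_iff_disj)
    have "Complex x (y + d) - Complex x y = \<i> * d" by (simp add: complex_eq_iff)
    then have "dist (Complex x (y + d)) (Complex x y) < \<epsilon>" using d by (simp add: dist_norm norm_mult)
    moreover have "Complex x (y + d) \<in> R" using that d by (simp add: R_def)
    ultimately show "\<exists>z\<in>R. dist z (Complex x y) < \<epsilon>" by blast
  qed
  have uv: "uniformly_continuous_on ?Q v" using vcont compQ by (rule compact_uniformly_continuous)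
  define a c where "a = Im (Kb 0)" and "c = (Im (Kb (Complex (h/2) 0)) - a) / (h / 2)"
  have affine: "Im (Kb (Complex x 0)) = a + c * x" if x: "\<bar>x\<bar> < h" for x
  proof -
    \<comment> \<open>The deviation, at height \<open>y\<close>, of \<open>Im K\<close> from the
      line through its values at the abscissas 0 and \<open>h / 2\<close>. It is continuous down to
      \<open>y = 0\<close>, and its limit 0 there is the claim.\<close>
    define D where "D y = Im (Kb (Complex x y)) - Im (Kb (Complex 0 y)) -
       (2 * x / h) * (Im (Kb (Complex (h/2) y)) - Im (Kb (Complex 0 y)))" for y
    have sub: "continuous (at 0 within {0..<h}) (\<lambda>y. Im (Kb (Complex x' y)))" if "\<bar>x'\<bar> < h" for x'
    proof -
      have "continuous_on {0..<h} (\<lambda>y. Im (Kb (Complex x' y)))"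
        using that clR by (intro continuous_on_Im continuous_on_compose2[OF Kbc]) (auto simp: Complex_eq intro!: continuous_intros)
      then show ?thesis using h by (auto simp: continuous_on_eq_continuous_within)
    qed
    have "continuous (at 0 within {0..<h}) D"
      unfolding D_def using h x by (intro continuous_diff continuous_mult continuous_const sub) auto
    then have "(D \<longlongrightarrow> D 0) (at 0 within {0<..<h})"
      unfolding continuous_within by (rule tendsto_within_subset) auto
    then have "(D \<longlongrightarrow> D 0) (at_right 0)"
      using at_within_nhd[of 0 "{..<h}" "{0<..<h}" "{0<..}"] h by (auto simp: Int_def conj_commute)
    moreover have "(D \<longlongrightarrow> 0) (at_right 0)"
    proof (rule tendstoI)
      fix \<epsilon> :: real assume \<epsilon>: "\<epsilon> > 0"
      \<comment> \<open>\<open>D y\<close> will be at most three times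
        \<open>\<eta> * h * h\<close>, which is \<open>3 / 4\<close> of
        \<open>\<epsilon>\<close>.\<close>
      define \<eta> where "\<eta> = \<epsilon> / (4 * h\<^sup>2)"
      have \<eta>: "\<eta> > 0" using \<epsilon> h by (simp add: \<eta>_def)
      obtain \<delta> where \<delta>: "\<delta> > 0" "\<And>s s'. s \<in> ?Q \<Longrightarrow> s' \<in> ?Q \<Longrightarrow> dist s' s < \<delta> \<Longrightarrow> dist (v s') (v s) < \<eta>"
        using uv \<eta> unfolding uniformly_continuous_on_def by blast
      have "\<bar>D y\<bar> < \<epsilon>" if y: "0 < y" "y < min \<delta> h" for y
      proof -
        have ImF: "\<bar>Im (F (Complex x y))\<bar> \<le> \<eta>" if "\<bar>x\<bar> < h" for x
        proof -
          have "Complex x y - Complex x 0 = \<i> * y" by (simp add: complex_eq_iff)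
          then have "dist (Complex x y) (Complex x 0) < \<delta>" using y by (simp add: dist_norm norm_mult)
          moreover have "Complex x y \<in> ?Q" "Complex x 0 \<in> ?Q"
            using that y cmod_le[of "Complex x y"] cmod_le[of "Complex x 0"] by (auto simp: h_def)
          ultimately show ?thesis using \<delta>(2)[of "Complex x 0" "Complex x y"] y by (simp add: v_def dist_real_def)
        qed
        have inB: "Complex x y \<in> ?B" if "\<bar>x\<bar> < h" for x using Bmem[of x y] that y by simp
        \<comment> \<open>The slope of \<open>Im K\<close> at height \<open>y\<close>. It changes
          with \<open>y\<close>, but \<open>D\<close> annihilates linear terms, so only its being
          constant in \<open>x\<close> counts.\<close>
        define cy where "cy = Im (P (Complex 0 y))"
        have P1: "\<bar>Im (P (Complex x y)) - cy\<bar> \<le> \<eta> * h" if "\<bar>x\<bar> < h" for x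
        proof -
          have "norm (Im (P (Complex x y)) - Im (P (Complex 0 y))) \<le> \<eta> * norm (x - 0)"
            by (rule field_differentiable_bound[of "{-h<..<h}" _ "\<lambda>x. Im (F (Complex x y))"])
               (use that ImF inB h in \<open>auto intro!: horizontal_derivative_Im P\<close>)
          also have "\<dots> \<le> \<eta> * h" using that \<eta> by (intro mult_left_mono) auto
          finally show ?thesis by (simp add: cy_def)
        qed
        have dK: "((\<lambda>x. Im (K (Complex x y)) - x * cy) has_real_derivative (Im (P (Complex z y)) - cy)) (at z within T)"
          if "\<bar>z\<bar> < h" for z T
        proof (rule DERIV_diff)
          show "((\<lambda>x. Im (K (Complex x y))) has_real_derivative Im (P (Complex z y))) (at z within T)"
            using that by (intro horizontal_derivative_Im K inB)
        qed (auto intro!: derivative_eq_intros)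
        have K1: "\<bar>Im (K (Complex x y)) - Im (K (Complex 0 y)) - x * cy\<bar> \<le> \<eta> * h * h" if "\<bar>x\<bar> < h" for x
        proof -
          have "norm ((Im (K (Complex x y)) - x * cy) - (Im (K (Complex 0 y)) - 0 * cy)) \<le> \<eta> * h * norm (x - 0)"
            by (rule field_differentiable_bound[of "{-h<..<h}" _ "\<lambda>x. Im (P (Complex x y)) - cy"])
               (use that P1 h in \<open>auto intro!: dK\<close>)
          also have "\<dots> \<le> \<eta> * h * h" using that \<eta> h by (intro mult_left_mono) auto
          finally show ?thesis by (simp add: algebra_simps)
        qed
        have KKb: "K (Complex x y) = Kb (Complex x y)" if "\<bar>x\<bar> < h" for x
          using that y by (intro Kb) (simp add: R_def)
        let ?a = "Im (K (Complex x y)) - Im (K (Complex 0 y)) - x * cy"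
        let ?b = "Im (K (Complex (h/2) y)) - Im (K (Complex 0 y)) - (h/2) * cy"
        have "D y = ?a - (2 * x / h) * ?b"
          using x h by (simp add: D_def KKb field_simps)
        also have "\<bar>\<dots>\<bar> \<le> \<bar>?a\<bar> + \<bar>2 * x / h\<bar> * \<bar>?b\<bar>"
          by (rule order_trans[OF abs_triangle_ineq4]) (simp add: abs_mult)
        also have "\<dots> \<le> \<eta> * h * h + 2 * (\<eta> * h * h)"
          using x h \<eta> by (intro add_mono mult_mono K1) (auto simp: field_simps)
        also have "\<dots> < \<epsilon>" using h \<epsilon> by (simp add: \<eta>_def power2_eq_square)
        finally show ?thesis .
      qed
      then show "\<forall>\<^sub>F y in at_right 0. dist (D y) 0 < \<epsilon>"
        unfolding eventually_at_right_field using h \<delta> by (intro exI[of _ "min \<delta> h"]) auto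
    qed
    ultimately have "D 0 = 0" by (intro tendsto_unique[of "at_right (0::real)"]) auto
    then show ?thesis using h by (simp add: D_def a_def c_def field_simps zero_complex.code[symmetric])
  qed
  \<comment> \<open>On the real axis the subtracted term has imaginary part
    \<open>a + c * Re s\<close>, which makes \<open>K2\<close> real there.\<close>
  define K2 where "K2 s = Kb s - \<i> * (of_real a + of_real c * s)" for s
  let ?S = "ball 0 h"
  have S_R: "s \<in> R" if "s \<in> ?S" "Im s > 0" for s
    using that abs_Re_le_cmod[of s] abs_Im_le_cmod[of s] by (auto simp: R_def)
  have openR: "open R" unfolding Rbox by (rule open_box)
  have K2d: "(K2 has_field_derivative (P s - \<i> * c)) (at s)" if "s \<in> R" for s
  proof -
    have "(K has_field_derivative P s) (at s)" by (rule K[OF R_B[OF that]])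
    then have "(Kb has_field_derivative P s) (at s)"
      using has_field_derivative_transform_within_open[OF _ openR that, of K "P s" Kb] Kb(2) by blast
    then show ?thesis unfolding K2_def by (auto intro!: derivative_eq_intros)
  qed
  define W where "W s = (if 0 \<le> Im s then K2 s else cnj (K2 (cnj s)))" for s
  have W: "W holomorphic_on ?S"
    unfolding W_def
  proof (rule Schwarz_reflection)
    show "K2 holomorphic_on ?S \<inter> {s. 0 < Im s}"
      unfolding holomorphic_on_def field_differentiable_def
      using K2d[OF S_R] has_field_derivative_at_within by blast
    have "?S \<inter> {s. 0 \<le> Im s} \<subseteq> closure R"
    proof
      fix s assume "s \<in> ?S \<inter> {s. 0 \<le> Im s}"
      then show "s \<in> closure R"
        using clR[of "Re s" "Im s"] abs_Re_le_cmod[of s] abs_Im_le_cmod[of s] by auto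
    qed
    then show "continuous_on (?S \<inter> {s. 0 \<le> Im s}) K2"
      unfolding K2_def by (intro continuous_intros continuous_on_subset[OF Kbc])
    show "K2 s \<in> \<real>" if "s \<in> ?S" "s \<in> \<real>" for s
    proof -
      have s: "s = Complex (Re s) 0" using that by (simp add: complex_is_Real_iff complex_eq_iff)
      have "\<bar>Re s\<bar> < h" using that abs_Re_le_cmod[of s] by simp
      from affine[OF this] s have "Im (Kb s) = a + c * Re s" by metis
      then show ?thesis using that by (simp add: K2_def complex_is_Real_iff)
    qed
  qed auto
  \<comment> \<open>Two derivatives undo the two antiderivatives and kill the affine
    correction.\<close>
  define M where "M = deriv (deriv W)"
  have up: "open (?S \<inter> {s. Im s > 0})" and lo: "open (?S \<inter> {s. Im s < 0})"
    by (intro open_Int open_ball open_halfspace_Im_gt open_halfspace_Im_lt)+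
  show thesis
  proof (rule that[of h M])
    show "0 < h" "h \<le> e" using h by (auto simp: h_def)
    show "M holomorphic_on ?S" unfolding M_def using W by (intro holomorphic_deriv) auto
    have dW: "deriv W s = P s - \<i> * c" if "s \<in> ?S" "Im s > 0" for s
    proof (rule DERIV_imp_deriv, rule has_field_derivative_transform_within_open[OF K2d[OF S_R[OF that]] up])
      show "s \<in> ?S \<inter> {s. Im s > 0}" using that by auto
    qed (auto simp: W_def)
    show "M s = F s" if "s \<in> ?S" "Im s > 0" for s
      unfolding M_def
    proof (rule DERIV_imp_deriv, rule has_field_derivative_transform_within_open[OF _ up])
      show "((\<lambda>s. P s - \<i> * c) has_field_derivative F s) (at s)"
        using P[OF R_B[OF S_R[OF that]]] by (auto intro!: derivative_eq_intros)
    qed (use that dW in auto)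
    have cc: "((\<lambda>s. cnj (f (cnj s))) has_field_derivative cnj f') (at s)"
      if "(f has_field_derivative f') (at (cnj s))" for f f' s
      using has_field_derivative_cnj_cnj[OF that] by (simp add: o_def)
    have dW': "deriv W s = cnj (P (cnj s) - \<i> * c)" if "s \<in> ?S" "Im s < 0" for s
    proof (rule DERIV_imp_deriv, rule has_field_derivative_transform_within_open[OF _ lo])
      show "((\<lambda>s. cnj (K2 (cnj s))) has_field_derivative cnj (P (cnj s) - \<i> * c)) (at s)"
        using that by (intro cc K2d S_R) auto
    qed (use that in \<open>auto simp: W_def\<close>)
    show "M s = cnj (F (cnj s))" if "s \<in> ?S" "Im s < 0" for s
      unfolding M_def
    proof (rule DERIV_imp_deriv, rule has_field_derivative_transform_within_open[OF _ lo])
      have "((\<lambda>s. P s - \<i> * c) has_field_derivative F (cnj s)) (at (cnj s))"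
        using P[OF R_B[OF S_R[of "cnj s"]]] that by (auto intro!: derivative_eq_intros)
      then show "((\<lambda>s. cnj (P (cnj s) - \<i> * c)) has_field_derivative cnj (F (cnj s))) (at s)"
        by (rule cc)
    qed (use that dW' in auto)
  qed
qed

text \<open>For \<open>\<sigma> = -1\<close> the substitution \<open>t + \<sigma> * s\<close> is a
  half turn about \<open>t\<close>; unlike a reflection it exchanges the half planes without
  destroying holomorphy.\<close>

lemma harmonic_reflection:
  fixes t \<sigma> :: real
  assumes e: "e > 0" and \<sigma>: "\<sigma> = 1 \<or> \<sigma> = -1"
    and F: "F holomorphic_on ball (of_real t) e \<inter> {s. \<sigma> * Im s > 0}"
    and lim: "\<And>x::real. \<bar>x - t\<bar> < e \<Longrightarrow>
      ((\<lambda>s. Im (F s)) \<longlongrightarrow> 0) (at (of_real x) within (ball (of_real t) e \<inter> {s. \<sigma> * Im s > 0}))"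
  obtains M e' where "0 < e'" "e' \<le> e" "M holomorphic_on ball (of_real t) e'"
    "\<And>s. s \<in> ball (of_real t) e' \<Longrightarrow> \<sigma> * Im s > 0 \<Longrightarrow> M s = F s"
    "\<And>s. s \<in> ball (of_real t) e' \<Longrightarrow> \<sigma> * Im s < 0 \<Longrightarrow> M s = cnj (F (cnj s))"
proof -
  let ?T = "\<lambda>s. of_real t + of_real \<sigma> * s"
  let ?A = "ball 0 e \<inter> {s. Im s > 0}" and ?A' = "ball (of_real t) e \<inter> {s. \<sigma> * Im s > 0}"
  have \<sigma>2: "\<sigma> * \<sigma> = 1" and \<sigma>1: "\<bar>\<sigma>\<bar> = 1" using \<sigma> by auto
  have T: "?T s \<in> ?A' \<longleftrightarrow> s \<in> ?A" for s
  proof -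
    have "dist (of_real t) (?T s) = cmod s" using \<sigma>1 by (simp add: dist_norm norm_mult)
    moreover have "\<sigma> * Im (?T s) = Im s" using \<sigma> by auto
    ultimately show ?thesis by (simp only: Int_iff mem_ball mem_Collect_eq) simp
  qed
  define F0 where "F0 s = F (?T s)" for s
  obtain M0 e' where M0: "0 < e'" "e' \<le> e" "M0 holomorphic_on ball 0 e'"
    "\<And>s. s \<in> ball 0 e' \<Longrightarrow> Im s > 0 \<Longrightarrow> M0 s = F0 s"
    "\<And>s. s \<in> ball 0 e' \<Longrightarrow> Im s < 0 \<Longrightarrow> M0 s = cnj (F0 (cnj s))"
  proof (rule harmonic_reflection_at_0[of e F0])
    have "(F \<circ> ?T) holomorphic_on ?A"
    proof (rule holomorphic_on_compose_gen[OF _ F])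
      show "?T ` ?A \<subseteq> ?A'" using T by blast
    qed (intro holomorphic_intros)
    then show "F0 holomorphic_on ?A" by (simp add: F0_def[abs_def] o_def)
    fix x :: real assume x: "\<bar>x\<bar> < e"
    have "filterlim ?T (at (of_real (t + \<sigma> * x)) within ?A') (at (of_real x) within ?A)"
      unfolding filterlim_at
    proof
      show "\<forall>\<^sub>F s in at (of_real x) within ?A. ?T s \<in> ?A' \<and> ?T s \<noteq> of_real (t + \<sigma> * x)"
        unfolding eventually_at_filter
      proof (intro always_eventually allI impI conjI)
        fix s assume s: "s \<noteq> complex_of_real x" "s \<in> ?A"
        show "?T s \<in> ?A'" using T s by blast
        show "?T s \<noteq> of_real (t + \<sigma> * x)" using s \<sigma> by auto
      qed
      show "(?T \<longlongrightarrow> of_real (t + \<sigma> * x)) (at (of_real x) within ?A)"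
        by (auto intro!: tendsto_eq_intros)
    qed
    moreover have "\<bar>t + \<sigma> * x - t\<bar> < e" using x \<sigma>1 by (simp add: abs_mult)
    ultimately show "((\<lambda>s. Im (F0 s)) \<longlongrightarrow> 0) (at (of_real x) within ?A)"
      unfolding F0_def by (rule filterlim_compose[OF lim, rotated])
  qed (use e in auto)
  define T' where "T' s = of_real \<sigma> * (s - of_real t)" for s :: complex
  have TT: "?T (T' s) = s" for s
  proof -
    have "complex_of_real \<sigma> * complex_of_real \<sigma> = 1" unfolding of_real_mult[symmetric] \<sigma>2 by simp
    then show ?thesis by (simp add: T'_def mult.assoc[symmetric])
  qed
  have T': "T' s \<in> ball 0 e' \<longleftrightarrow> s \<in> ball (of_real t) e'" "Im (T' s) = \<sigma> * Im s" for s
    using \<sigma>1 by (auto simp: T'_def norm_mult dist_norm norm_minus_commute)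
  have cT: "?T (cnj (T' s)) = cnj s" for s
    using arg_cong[OF TT[of s], of cnj] by simp
  show thesis
  proof (rule that[of e' "M0 \<circ> T'"])
    show "(M0 \<circ> T') holomorphic_on ball (of_real t) e'"
    proof (rule holomorphic_on_compose_gen[OF _ M0(3)])
      show "T' holomorphic_on ball (of_real t) e'"
        unfolding T'_def by (intro holomorphic_intros)
      show "T' ` ball (of_real t) e' \<subseteq> ball 0 e'" using T' by blast
    qed
    show "(M0 \<circ> T') s = F s" if "s \<in> ball (of_real t) e'" "\<sigma> * Im s > 0" for s
      using M0(4)[of "T' s"] that T'[of s] TT[of s] by (simp add: F0_def)
    show "(M0 \<circ> T') s = cnj (F (cnj s))" if "s \<in> ball (of_real t) e'" "\<sigma> * Im s < 0" for s
      using M0(5)[of "T' s"] that T'[of s] cT[of s] by (simp add: F0_def)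
  qed (use M0 in auto)
qed

text \<open>The real and imaginary parts of \<open>p - cnj q\<close> are \<open>Re (p - q)\<close>
  and \<open>Im (p + q)\<close>. Hence \<open>p + q\<close> and \<open>\<i> * (p - q)\<close> both
  have imaginary part tending to 0 and can be reflected separately, with no bound on
  \<open>p\<close> or \<open>q\<close> themselves; a linear combination of the two reflections
  recovers \<open>p\<close> on one side and \<open>cnj q\<close> on the other.\<close>

lemma conjugate_gluing:
  fixes t \<sigma> :: real
  assumes e: "e > 0" and \<sigma>: "\<sigma> = 1 \<or> \<sigma> = -1"
    and p: "p holomorphic_on ball (of_real t) e \<inter> {s. \<sigma> * Im s > 0}"
    and q: "q holomorphic_on ball (of_real t) e \<inter> {s. \<sigma> * Im s > 0}"
    and lim: "\<And>x::real. \<bar>x - t\<bar> < e \<Longrightarrow>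
      ((\<lambda>s. p s - cnj (q s)) \<longlongrightarrow> 0) (at (of_real x) within (ball (of_real t) e \<inter> {s. \<sigma> * Im s > 0}))"
  obtains M e' where "0 < e'" "e' \<le> e" "M holomorphic_on ball (of_real t) e'"
    "\<And>s. s \<in> ball (of_real t) e' \<Longrightarrow> \<sigma> * Im s > 0 \<Longrightarrow> M s = p s"
    "\<And>s. s \<in> ball (of_real t) e' \<Longrightarrow> \<sigma> * Im s < 0 \<Longrightarrow> M s = cnj (q (cnj s))"
proof -
  let ?F1 = "\<lambda>s. p s + q s" and ?F2 = "\<lambda>s. \<i> * (p s - q s)"
  obtain M1 e1 where M1: "0 < e1" "e1 \<le> e" "M1 holomorphic_on ball (of_real t) e1"
    "\<And>s. s \<in> ball (of_real t) e1 \<Longrightarrow> \<sigma> * Im s > 0 \<Longrightarrow> M1 s = ?F1 s"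
    "\<And>s. s \<in> ball (of_real t) e1 \<Longrightarrow> \<sigma> * Im s < 0 \<Longrightarrow> M1 s = cnj (?F1 (cnj s))"
  proof (rule harmonic_reflection[OF e \<sigma>, of ?F1 t])
    show "?F1 holomorphic_on ball (of_real t) e \<inter> {s. \<sigma> * Im s > 0}" by (intro holomorphic_intros p q)
    show "((\<lambda>s. Im (?F1 s)) \<longlongrightarrow> 0) (at (of_real x) within (ball (of_real t) e \<inter> {s. \<sigma> * Im s > 0}))"
      if "\<bar>x - t\<bar> < e" for x :: real
      using tendsto_Im[OF lim[OF that]] by simp
  qed blast
  obtain M2 e2 where M2: "0 < e2" "e2 \<le> e" "M2 holomorphic_on ball (of_real t) e2"
    "\<And>s. s \<in> ball (of_real t) e2 \<Longrightarrow> \<sigma> * Im s > 0 \<Longrightarrow> M2 s = ?F2 s"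
    "\<And>s. s \<in> ball (of_real t) e2 \<Longrightarrow> \<sigma> * Im s < 0 \<Longrightarrow> M2 s = cnj (?F2 (cnj s))"
  proof (rule harmonic_reflection[OF e \<sigma>, of ?F2 t])
    show "?F2 holomorphic_on ball (of_real t) e \<inter> {s. \<sigma> * Im s > 0}" by (intro holomorphic_intros p q)
    show "((\<lambda>s. Im (?F2 s)) \<longlongrightarrow> 0) (at (of_real x) within (ball (of_real t) e \<inter> {s. \<sigma> * Im s > 0}))"
      if "\<bar>x - t\<bar> < e" for x :: real
      using tendsto_Re[OF lim[OF that]] by simp
  qed blast
  define M where "M s = (M1 s - \<i> * M2 s) / 2" for s
  show thesis
  proof (rule that[of "min e1 e2" M])
    show "M holomorphic_on ball (of_real t) (min e1 e2)"
      unfolding M_def using M1(3) M2(3) by (intro holomorphic_intros) (auto intro: holomorphic_on_subset)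
    show "M s = p s" if "s \<in> ball (of_real t) (min e1 e2)" "\<sigma> * Im s > 0" for s
      using that by (simp add: M_def M1(4) M2(4) mult.assoc[symmetric])
    show "M s = cnj (q (cnj s))" if "s \<in> ball (of_real t) (min e1 e2)" "\<sigma> * Im s < 0" for s
      using that by (simp add: M_def M1(5) M2(5) mult.assoc[symmetric])
  qed (use M1 M2 in auto)
qed

section \<open>Boundary charts\<close>

text \<open>The disc around \<open>t\<close> is mapped by \<open>\<gamma>\<close> so that \<open>D\<close> corresponds to exactly one half of it: the upper
  half if \<open>\<sigma> = 1\<close>, the lower half if \<open>\<sigma> = -1\<close>. The inequality says that \<open>\<gamma>\<close> is close to multiplication
  by \<open>a = \<gamma>' t\<close>, so it is injective and bilipschitz.\<close>
definition side_chart :: "complex set \<Rightarrow> (complex \<Rightarrow> complex) \<Rightarrow> real \<Rightarrow> real \<Rightarrow> real \<Rightarrow> complex \<Rightarrow> bool" where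
  "side_chart D \<gamma> t e \<sigma> a \<longleftrightarrow> e > 0 \<and> (\<sigma> = 1 \<or> \<sigma> = -1) \<and> a \<noteq> 0 \<and> \<gamma> holomorphic_on ball (of_real t) e \<and>
     (\<forall>x\<in>ball (of_real t) e. \<forall>y\<in>ball (of_real t) e.
        cmod (\<gamma> x - \<gamma> y - a * (x - y)) \<le> cmod a / 2 * cmod (x - y)) \<and>
     (\<forall>x\<in>ball (of_real t) e. (\<gamma> x \<in> D \<longleftrightarrow> \<sigma> * Im x > 0) \<and>
        (\<gamma> x \<in> closure D \<longleftrightarrow> \<sigma> * Im x \<ge> 0) \<and> (\<gamma> x \<in> frontier D \<longleftrightarrow> Im x = 0))"

lemma side_chart_subset:
  "side_chart D \<gamma> t e \<sigma> a \<Longrightarrow> 0 < e' \<Longrightarrow> e' \<le> e \<Longrightarrow> side_chart D \<gamma> t e' \<sigma> a"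
  unfolding side_chart_def by (auto intro: holomorphic_on_subset)

lemma side_chart_bilipschitz:
  assumes "side_chart D \<gamma> t e \<sigma> a" "x \<in> ball (of_real t) e" "y \<in> ball (of_real t) e"
  shows "cmod a / 2 * cmod (x - y) \<le> cmod (\<gamma> x - \<gamma> y)"
    and "cmod (\<gamma> x - \<gamma> y) \<le> 3 * cmod a / 2 * cmod (x - y)"
proof -
  have 1: "cmod (\<gamma> x - \<gamma> y - a * (x - y)) \<le> cmod a / 2 * cmod (x - y)"
    using assms unfolding side_chart_def by blast
  have 2: "cmod (a * (x - y)) = cmod a * cmod (x - y)" by (rule norm_mult)
  show "cmod a / 2 * cmod (x - y) \<le> cmod (\<gamma> x - \<gamma> y)"
    using 1 2 norm_triangle_ineq2[of "a * (x - y)" "\<gamma> x - \<gamma> y"] by (simp add: norm_minus_commute)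
  show "cmod (\<gamma> x - \<gamma> y) \<le> 3 * cmod a / 2 * cmod (x - y)"
    using 1 2 norm_triangle_ineq2[of "\<gamma> x - \<gamma> y" "a * (x - y)"] by simp
qed

lemma side_chart_inj: "side_chart D \<gamma> t e \<sigma> a \<Longrightarrow> inj_on \<gamma> (ball (of_real t) e)"
proof (rule inj_onI)
  fix x y assume c: "side_chart D \<gamma> t e \<sigma> a" and xy: "x \<in> ball (of_real t) e" "y \<in> ball (of_real t) e" "\<gamma> x = \<gamma> y"
  have "cmod a / 2 * cmod (x - y) \<le> 0" using side_chart_bilipschitz(1)[OF c xy(1,2)] xy(3) by simp
  moreover have "a \<noteq> 0" using c by (simp add: side_chart_def)
  ultimately show "x = y" by (simp add: mult_le_0_iff)
qed

lemma side_chart_deriv: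
  assumes "side_chart D \<gamma> t e \<sigma> a" "x \<in> ball (of_real t) e" shows "deriv \<gamma> x \<noteq> 0"
  using holomorphic_injective_imp_regular[OF _ open_ball side_chart_inj[OF assms(1)] assms(2)] assms(1)
  by (simp add: side_chart_def)

lemma side_chart_open:
  assumes "side_chart D \<gamma> t e \<sigma> a" "open A" "A \<subseteq> ball (of_real t) e" shows "open (\<gamma> ` A)"
proof (rule open_mapping_thm3)
  show "\<gamma> holomorphic_on A" using assms holomorphic_on_subset by (auto simp: side_chart_def)
  show "inj_on \<gamma> A" using side_chart_inj[OF assms(1)] assms(3) by (rule inj_on_subset)
qed fact

section \<open>Periodic parametrisations of the boundary curves\<close>

lemma periodic_add_int:
  fixes g :: "real \<Rightarrow> 'a"
  assumes "\<And>t. g (t + 1) = g t" shows "g (t + of_int k) = g t"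
proof -
  have n: "g (t + real n) = g t" for t and n :: nat
    by (induction n) (use assms[of "t + real _"] in \<open>auto simp: add_ac\<close>)
  show ?thesis
  proof (cases "k \<ge> 0")
    case True then show ?thesis using n[of t "nat k"] by simp
  next
    case False then show ?thesis using n[of "t + of_int k" "nat (-k)"] by simp
  qed
qed

lemma analytic_jordan_curve_simple_path:
  assumes "analytic_jordan_curve \<gamma>"
  shows "simple_path (\<lambda>t::real. \<gamma> (of_real t))" "pathfinish (\<lambda>t::real. \<gamma> (of_real t)) = pathstart (\<lambda>t::real. \<gamma> (of_real t))"
    "path_image (\<lambda>t::real. \<gamma> (of_real t)) = curve_image \<gamma>"
proof -
  obtain S where S: "open S" "\<real> \<subseteq> S" "\<gamma> holomorphic_on S" using assms by (auto simp: analytic_jordan_curve_def)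
  have per: "\<gamma> (of_real (t + 1)) = \<gamma> (of_real t)" for t :: real using assms by (auto simp: analytic_jordan_curve_def)
  have inj: "inj_on (\<lambda>t::real. \<gamma> (of_real t)) {0..<1}" using assms by (simp add: analytic_jordan_curve_def)
  show "pathfinish (\<lambda>t::real. \<gamma> (of_real t)) = pathstart (\<lambda>t::real. \<gamma> (of_real t))"
    using per[of 0] by (simp add: pathfinish_def pathstart_def)
  show "path_image (\<lambda>t::real. \<gamma> (of_real t)) = curve_image \<gamma>"
    by (simp add: path_image_def curve_image_def)
  have "path (\<lambda>t::real. \<gamma> (of_real t))"
    unfolding path_def using S
    by (intro continuous_on_compose2[OF holomorphic_on_imp_continuous_on[OF S(3)]] continuous_intros) auto
  moreover have "loop_free (\<lambda>t::real. \<gamma> (of_real t))"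
    unfolding loop_free_def
  proof (intro ballI impI)
    fix x y :: real assume xy: "x \<in> {0..1}" "y \<in> {0..1}" "\<gamma> (of_real x) = \<gamma> (of_real y)"
    define r where "r x = (if x = 1 then 0 else x)" for x :: real
    have "\<gamma> (of_real (r x)) = \<gamma> (of_real x)" for x using per[of 0] by (simp add: r_def)
    then have "\<gamma> (of_real (r x)) = \<gamma> (of_real (r y))" using xy by simp
    then have "r x = r y" using xy inj by (auto simp: inj_on_def r_def)
    then show "x = y \<or> x = 0 \<and> y = 1 \<or> x = 1 \<and> y = 0" by (auto simp: r_def split: if_splits)
  qed
  ultimately show "simple_path (\<lambda>t::real. \<gamma> (of_real t))" by (simp add: simple_path_def)
qed

lemma analytic_jordan_curve_eqD:
  assumes \<gamma>: "analytic_jordan_curve \<gamma>" and eq: "\<gamma> (of_real x) = \<gamma> (of_real y)" and xy: "\<bar>x - y\<bar> < 1"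
  shows "x = (y::real)"
proof -
  have per: "\<gamma> (of_real (t + 1)) = \<gamma> (of_real t)" for t :: real using \<gamma> by (auto simp: analytic_jordan_curve_def)
  have fr: "\<gamma> (of_real (frac x)) = \<gamma> (of_real x)" for x :: real
    using periodic_add_int[of "\<lambda>t. \<gamma> (of_real t)" "frac x" "\<lfloor>x\<rfloor>"] per by (simp add: frac_def)
  have "frac x = frac y"
    using \<gamma> fr[of x] fr[of y] eq unfolding analytic_jordan_curve_def inj_on_def
    by (metis atLeastLessThan_iff frac_ge_0 frac_lt_1)
  then have "x - y = of_int (\<lfloor>x\<rfloor> - \<lfloor>y\<rfloor>)" by (simp add: frac_def)
  moreover from this have "\<bar>real_of_int (\<lfloor>x\<rfloor> - \<lfloor>y\<rfloor>)\<bar> < 1" using xy by simp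
  then have "\<lfloor>x\<rfloor> - \<lfloor>y\<rfloor> = 0" by linarith
  ultimately show ?thesis by simp
qed

lemma curve_image_centered:
  assumes \<gamma>: "analytic_jordan_curve \<gamma>" and w: "w \<in> curve_image \<gamma>"
  obtains \<tau> :: real where "\<bar>\<tau> - t\<bar> \<le> 1 / 2" "w = \<gamma> (of_real \<tau>)"
proof -
  have per: "\<gamma> (of_real (t + 1)) = \<gamma> (of_real t)" for t :: real using \<gamma> by (auto simp: analytic_jordan_curve_def)
  obtain s :: real where s: "w = \<gamma> (of_real s)" using w by (auto simp: curve_image_def)
  define k where "k = round (t - s)"
  have "w = \<gamma> (of_real (s + of_int k))"
    using periodic_add_int[of "\<lambda>t. \<gamma> (of_real t)" s k] per s by simp
  moreover have "\<bar>s + of_int k - t\<bar> \<le> 1 / 2"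
    using of_int_round_abs_le[of "t - s"] by (simp add: k_def abs_minus_commute algebra_simps)
  ultimately show ?thesis using that by blast
qed

text \<open>By the Jordan curve theorem the connected set \<open>D\<close> lies on one side of each boundary curve.\<close>
lemma side_chart_exists:
  assumes D: "analytic_boundary_domain D m G" and i: "i < m"
  obtains e \<sigma> a where "side_chart D (G i) t e \<sigma> a"
proof -
  let ?\<gamma> = "G i" and ?t = "complex_of_real t"
  have D': "open D" "connected D" "D \<noteq> {}" "bounded D" "\<And>j. j < m \<Longrightarrow> analytic_jordan_curve (G j)"
    "\<And>j. j < m \<Longrightarrow> j \<noteq> i \<Longrightarrow> curve_image (G j) \<inter> curve_image (G i) = {}"
    "frontier D = (\<Union>i<m. curve_image (G i))"
    using D i by (auto simp: analytic_boundary_domain_def)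
  note \<gamma> = D'(5)[OF i]
  obtain S where S: "open S" "\<real> \<subseteq> S" "?\<gamma> holomorphic_on S" using \<gamma> by (auto simp: analytic_jordan_curve_def)
  define a where "a = deriv ?\<gamma> ?t"
  have a: "a \<noteq> 0" using \<gamma> by (simp add: a_def analytic_jordan_curve_def)
  have tS: "?t \<in> S" using S by auto
  have "continuous_on S (deriv ?\<gamma>)" using S by (intro holomorphic_on_imp_continuous_on holomorphic_deriv)
  then have "isCont (deriv ?\<gamma>) ?t" using S tS by (simp add: continuous_on_eq_continuous_at)
  then have "\<forall>\<^sub>F x in nhds ?t. dist (deriv ?\<gamma> x) a < cmod a / 2"
    using a by (intro tendstoD) (simp_all add: a_def isCont_def tendsto_nhds_iff)
  then have "\<forall>\<^sub>F x in nhds ?t. dist (deriv ?\<gamma> x) a < cmod a / 2 \<and> x \<in> S"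
    using eventually_nhds_in_open[OF S(1) tS] by eventually_elim auto
  then obtain e1 where e1: "e1 > 0" "\<And>x. x \<in> ball ?t e1 \<Longrightarrow> dist (deriv ?\<gamma> x) a < cmod a / 2 \<and> x \<in> S"
    unfolding eventually_nhds_metric by (auto simp: dist_commute)
  \<comment> \<open>The mean value inequality for \<open>?\<gamma> x - a * x\<close>, whose
    derivative has modulus below \<open>cmod a / 2\<close> on the disc.\<close>
  have quasi: "cmod (?\<gamma> x - ?\<gamma> y - a * (x - y)) \<le> cmod a / 2 * cmod (x - y)"
    if "x \<in> ball ?t e1" "y \<in> ball ?t e1" for x y
  proof -
    have "norm ((?\<gamma> x - a * x) - (?\<gamma> y - a * y)) \<le> cmod a / 2 * norm (x - y)"
    proof (rule field_differentiable_bound[OF _ _ _ that])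
      show "((\<lambda>x. ?\<gamma> x - a * x) has_field_derivative deriv ?\<gamma> z - a) (at z within ball ?t e1)" if "z \<in> ball ?t e1" for z
        using holomorphic_derivI[OF S(3,1), of z UNIV] e1(2)[OF that]
        by (auto intro!: derivative_eq_intros intro: has_field_derivative_at_within)
      show "norm (deriv ?\<gamma> z - a) \<le> cmod a / 2" if "z \<in> ball ?t e1" for z
        using e1(2)[OF that] by (simp add: dist_norm)
    qed simp
    then show ?thesis by (simp add: algebra_simps)
  qed
  have inj: "inj_on ?\<gamma> (ball ?t e1)"
  proof (rule inj_onI)
    fix x y assume "x \<in> ball ?t e1" "y \<in> ball ?t e1" "?\<gamma> x = ?\<gamma> y"
    then have "cmod a * cmod (x - y) \<le> cmod a / 2 * cmod (x - y)"
      using quasi[of x y] by (simp add: norm_mult norm_minus_commute flip: norm_minus_cancel[of "a * (x - y)"])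
    then show "x = y" using a by (simp add: field_simps mult_le_0_iff)
  qed
  \<comment> \<open>One full period is centred at \<open>t\<close> and the parameters close to
    \<open>t\<close> are cut out. \<open>Rest\<close> then contains every frontier point except
    those on the short arc, is closed, and misses \<open>?\<gamma> ?t\<close>, so a small disc is
    mapped away from it.\<close>
  define far where "far = (\<lambda>\<tau>::real. ?\<gamma> (of_real \<tau>)) ` ({t - 1/2..t + 1/2} - {t - e1<..<t + e1})"
  define Rest where "Rest = (\<Union>j\<in>{..<m} - {i}. curve_image (G j)) \<union> far"
  have contR: "continuous_on A (\<lambda>\<tau>::real. G j (of_real \<tau>))" if j: "j < m" for j A
  proof -
    obtain S where S: "open S" "\<real> \<subseteq> S" "G j holomorphic_on S"
      using D'(5)[OF j] by (auto simp: analytic_jordan_curve_def)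
    show ?thesis
      by (intro continuous_on_compose2[OF holomorphic_on_imp_continuous_on[OF S(3)]] continuous_intros) (use S in auto)
  qed
  have "compact far" unfolding far_def
    by (intro compact_continuous_image contR i compact_diff) auto
  moreover have "compact (curve_image (G j))" if "j < m" for j
    unfolding curve_image_def using that by (intro compact_continuous_image contR) auto
  ultimately have "closed Rest" unfolding Rest_def by (intro closed_Un closed_UN compact_imp_closed) auto
  have "?\<gamma> ?t \<notin> far"
    using analytic_jordan_curve_eqD[OF \<gamma>, of t] e1(1) by (force simp: far_def)
  moreover have tC: "?\<gamma> ?t \<in> curve_image ?\<gamma>"
  proof -
    have "\<gamma> (of_real (frac t)) = \<gamma> (of_real t)" if "analytic_jordan_curve \<gamma>" for \<gamma> :: "complex \<Rightarrow> complex"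
      using periodic_add_int[of "\<lambda>t. \<gamma> (of_real t)" "frac t" "\<lfloor>t\<rfloor>"] that
      by (simp add: frac_def analytic_jordan_curve_def)
    from this[OF \<gamma>] show ?thesis unfolding curve_image_def
      by (intro image_eqI[of _ _ "frac t"]) (auto simp: less_imp_le[OF frac_lt_1])
  qed
  ultimately have "?\<gamma> ?t \<notin> Rest" using D'(6) by (auto simp: Rest_def)
  moreover have "isCont ?\<gamma> ?t" using S tS by (meson continuous_on_eq_continuous_at holomorphic_on_imp_continuous_on)
  ultimately have "\<forall>\<^sub>F x in nhds ?t. ?\<gamma> x \<in> - Rest"
    using \<open>closed Rest\<close> by (intro topological_tendstoD) (auto simp: isCont_def tendsto_nhds_iff open_Compl)
  then obtain e2 where e2: "e2 > 0" "\<And>x. x \<in> ball ?t e2 \<Longrightarrow> ?\<gamma> x \<notin> Rest"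
    unfolding eventually_nhds_metric by (auto simp: dist_commute)
  define e where "e = min e1 e2"
  have e: "e > 0" "e \<le> e1" "e \<le> e2" using e1 e2 by (auto simp: e_def)
  let ?B = "ball ?t e"
  have real_fr: "?\<gamma> x \<in> curve_image ?\<gamma>" if "x \<in> ?B" "Im x = 0" for x
  proof -
    have x: "x = of_real (Re x)" using that by (simp add: complex_eq_iff)
    have "\<gamma> (of_real (frac r)) = \<gamma> (of_real r)" if "analytic_jordan_curve \<gamma>" for \<gamma> :: "complex \<Rightarrow> complex" and r
      using periodic_add_int[of "\<lambda>t. \<gamma> (of_real t)" "frac r" "\<lfloor>r\<rfloor>"] that
      by (simp add: frac_def analytic_jordan_curve_def)
    from this[OF \<gamma>, of "Re x"] show ?thesis unfolding curve_image_def
      by (subst x, intro image_eqI[of _ _ "frac (Re x)"]) (auto simp: less_imp_le[OF frac_lt_1])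
  qed
  have fr: "?\<gamma> x \<in> frontier D \<longleftrightarrow> Im x = 0" if x: "x \<in> ?B" for x
  proof
    assume "?\<gamma> x \<in> frontier D"
    then obtain j where j: "j < m" "?\<gamma> x \<in> curve_image (G j)" using D'(7) by auto
    have nR: "?\<gamma> x \<notin> Rest" using e2(2) x e by auto
    then have "j = i" using j by (auto simp: Rest_def)
    then obtain \<tau> where \<tau>: "\<bar>\<tau> - t\<bar> \<le> 1/2" "?\<gamma> x = ?\<gamma> (of_real \<tau>)"
      using curve_image_centered[OF \<gamma>] j by metis
    have "\<bar>\<tau> - t\<bar> < e1"
    proof (rule ccontr)
      assume "\<not> \<bar>\<tau> - t\<bar> < e1"
      moreover have "t - 1/2 \<le> \<tau>" "\<tau> \<le> t + 1/2" using \<tau>(1) by linarith+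
      ultimately have "?\<gamma> (of_real \<tau>) \<in> far" unfolding far_def by (intro imageI) auto
      then show False using nR \<tau> by (simp add: Rest_def)
    qed
    then have "complex_of_real \<tau> \<in> ball ?t e1" by (simp add: dist_real_def abs_minus_commute)
    then have "x = of_real \<tau>" using inj \<tau>(2) x e by (auto simp: inj_on_def)
    then show "Im x = 0" by simp
  next
    assume "Im x = 0" then show "?\<gamma> x \<in> frontier D" using real_fr[OF x] i D'(7) by auto
  qed
  have hol: "?\<gamma> holomorphic_on ?B" using S(3) by (rule holomorphic_on_subset) (use e1 e in auto)
  have openim: "open (?\<gamma> ` A)" if "open A" "A \<subseteq> ?B" for A
    using that e by (intro open_mapping_thm3 holomorphic_on_subset[OF hol] inj_on_subset[OF inj]) auto
  have frD: "frontier D \<inter> D = {}" using D'(1) by (auto simp: frontier_def interior_open)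
  define P where "P s = ?B \<inter> {x. s * Im x > 0}" for s :: real
  have Popen: "open (P s)" for s 
    unfolding P_def by (intro open_Int open_ball open_Collect_less continuous_intros)
  have Psub: "P s \<subseteq> ?B" for s by (auto simp: P_def)
  \<comment> \<open>The image of a half disc is connected and avoids the frontier, so it cannot meet
    both \<open>D\<close> and its complement.\<close>
  have side: "?\<gamma> ` P s \<subseteq> D \<or> ?\<gamma> ` P s \<inter> D = {}" if "s = 1 \<or> s = -1" for s
  proof -
    have "convex (P s)"
      using that unfolding P_def
      by (auto intro!: convex_Int simp: convex_halfspace_Im_gt convex_halfspace_Im_lt)
    then have "connected (?\<gamma> ` P s)"
      using Psub[of s] by (intro connected_continuous_image convex_connected
        continuous_on_subset[OF holomorphic_on_imp_continuous_on[OF hol]])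
    moreover have "?\<gamma> ` P s \<inter> frontier D = {}" using fr by (auto simp: P_def)
    ultimately show ?thesis using connected_Int_frontier[of "?\<gamma> ` P s" D] by blast
  qed
  have tB: "?t \<in> ?B" using e by simp
  have split: "s \<in> P 1 \<or> s \<in> P (-1) \<or> Im s = 0" if "s \<in> ?B" for s
    using that by (auto simp: P_def)
  have real_nD: "?\<gamma> x \<notin> D" if "x \<in> ?B" "Im x = 0" for x using fr[OF that(1)] that frD by blast
  obtain x0 where x0: "x0 \<in> ?B" "?\<gamma> x0 \<in> D"
  proof -
    have "?\<gamma> ?t \<in> closure D" using fr[OF tB] by (simp add: frontier_def)
    then have "?\<gamma> ` ?B \<inter> D \<noteq> {}"
      using openim[of ?B] tB by (metis Int_commute open_ball order_refl closure_iff_nhds_not_empty[of _ D] imageI)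
    then show ?thesis using that by auto
  qed
  define C where "C = curve_image ?\<gamma>"
  have J: "inside C \<noteq> {}" "open (inside C)" "outside C \<noteq> {}" "open (outside C)"
    "inside C \<inter> outside C = {}" "inside C \<union> outside C = - C" "frontier (inside C) = C" "frontier (outside C) = C"
    using Jordan_inside_outside[OF analytic_jordan_curve_simple_path(1,2)[OF \<gamma>]]
    unfolding analytic_jordan_curve_simple_path(3)[OF \<gamma>] C_def[symmetric] by auto
  have "D \<inter> C = {}" using frD D'(7) i by (auto simp: C_def)
  then have "D \<subseteq> inside C \<or> D \<subseteq> outside C"
    using D'(2) J unfolding connected_def by (smt (verit) Compl_disjoint Int_absorb Int_assoc Int_commute
      Un_commute compl_sup disjoint_eq_subset_Compl inf.absorb_iff2 inf_bot_left inf_sup_distrib1 sup_bot.right_neutral)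
  \<comment> \<open>It must be excluded that both half discs go into \<open>D\<close>. The point
    \<open>?\<gamma> ?t\<close> is on the frontier of the inside and of the outside of the curve, so
    the component that does not contain \<open>D\<close> meets the image of the disc.\<close>
  then obtain x1 where x1: "x1 \<in> ?B" "?\<gamma> x1 \<notin> D" "Im x1 \<noteq> 0"
  proof
    assume sub: "D \<subseteq> inside C"
    have "?\<gamma> ?t \<in> closure (outside C)" using J(8) tC by (auto simp: C_def frontier_def)
    then have "?\<gamma> ` ?B \<inter> outside C \<noteq> {}"
      using openim[of ?B] tB by (metis Int_commute open_ball order_refl closure_iff_nhds_not_empty imageI)
    then obtain x where x: "x \<in> ?B" "?\<gamma> x \<in> outside C" by blast
    moreover have "?\<gamma> x \<notin> C" "?\<gamma> x \<notin> D" using x sub J(5,6) by blast+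
    moreover from this have "Im x \<noteq> 0" using real_fr[OF x(1)] unfolding C_def by blast
    ultimately show ?thesis using that by blast
  next
    assume sub: "D \<subseteq> outside C"
    have "?\<gamma> ?t \<in> closure (inside C)" using J(7) tC by (auto simp: C_def frontier_def)
    then have "?\<gamma> ` ?B \<inter> inside C \<noteq> {}"
      using openim[of ?B] tB by (metis Int_commute open_ball order_refl closure_iff_nhds_not_empty imageI)
    then obtain x where x: "x \<in> ?B" "?\<gamma> x \<in> inside C" by blast
    moreover have "?\<gamma> x \<notin> C" "?\<gamma> x \<notin> D" using x sub J(5,6) by blast+
    moreover from this have "Im x \<noteq> 0" using real_fr[OF x(1)] unfolding C_def by blast
    ultimately show ?thesis using that by blast
  qed
  have "\<exists>\<sigma>. (\<sigma> = 1 \<or> \<sigma> = -1) \<and> ?\<gamma> ` P \<sigma> \<subseteq> D \<and> ?\<gamma> ` P (-\<sigma>) \<inter> D = {}"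
  proof (cases "x0 \<in> P 1")
    case True
    then have 1: "?\<gamma> ` P 1 \<subseteq> D" using side[of 1] x0 by auto
    then have "x1 \<in> P (-1)" using x1 split[of x1] by auto
    then show ?thesis using 1 side[of "-1"] x1 by (intro exI[of _ 1]) auto
  next
    case False
    then have "x0 \<in> P (-1)" using split[OF x0(1)] real_nD x0 by auto
    then have 1: "?\<gamma> ` P (-1) \<subseteq> D" using side[of "-1"] x0 by auto
    then have "x1 \<in> P 1" using x1 split[of x1] by auto
    then show ?thesis using 1 side[of 1] x1 by (intro exI[of _ "-1"]) auto
  qed
  then obtain \<sigma> where \<sigma>: "\<sigma> = 1 \<or> \<sigma> = -1" "?\<gamma> ` P \<sigma> \<subseteq> D" "?\<gamma> ` P (-\<sigma>) \<inter> D = {}" by blast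
  have ncl: "?\<gamma> ` P (-\<sigma>) \<inter> closure D = {}"
    using \<sigma>(3) openim[OF Popen Psub] by (simp add: open_Int_closure_eq_empty)
  show thesis
  proof (rule that[of e \<sigma> a], unfold side_chart_def, intro conjI ballI)
    fix x assume x: "x \<in> ?B"
    have tri: "x \<in> P \<sigma> \<and> \<sigma> * Im x > 0 \<or> x \<in> P (-\<sigma>) \<and> \<sigma> * Im x < 0 \<or> Im x = 0"
      using x \<sigma>(1) by (auto simp: P_def)
    show "?\<gamma> x \<in> D \<longleftrightarrow> \<sigma> * Im x > 0" using tri \<sigma> real_nD[OF x] by fastforce
    show "?\<gamma> x \<in> frontier D \<longleftrightarrow> Im x = 0" by (rule fr[OF x])
    have "Im x = 0 \<Longrightarrow> ?\<gamma> x \<in> closure D" using fr[OF x] by (simp add: frontier_def)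
    then show "?\<gamma> x \<in> closure D \<longleftrightarrow> \<sigma> * Im x \<ge> 0"
      using tri \<sigma> ncl closure_subset[of D] by fastforce
  next
    fix x y assume "x \<in> ?B" "y \<in> ?B"
    then show "cmod (?\<gamma> x - ?\<gamma> y - a * (x - y)) \<le> cmod a / 2 * cmod (x - y)"
      using e by (intro quasi) auto
  qed (use e \<sigma> a hol in auto)
qed

section \<open>Mirror points in a boundary chart\<close>

lemma cnj_in_ball_of_real: "s \<in> ball (complex_of_real t) e \<Longrightarrow> cnj s \<in> ball (of_real t) e"
  by (metis complex_cnj_complex_of_real complex_cnj_diff complex_mod_cnj dist_norm mem_ball)

text \<open>The squares of the two distances differ by \<open>4 * Im s * Im u\<close>.\<close>

lemma norm_diff_le_norm_cnj_diff:
  assumes "Im s * Im u \<ge> 0" shows "cmod (s - u) \<le> cmod (cnj s - u)"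
  unfolding cmod_def using assms by (intro real_sqrt_le_mono) (simp add: power2_eq_square algebra_simps)

text \<open>The geometric input for comparing the Cauchy transform at \<open>\<gamma> s\<close> and
  at its exterior mirror point \<open>\<gamma> (cnj s)\<close>. Frontier points have real
  parameters, so the lower Lipschitz constant \<open>cmod a / 2\<close> gives
  \<open>cmod a * \<bar>Im s\<bar> \<le> 2 * \<delta>\<close>, and the upper one gives the factor 6.
  The factor 3 is the ratio of the two Lipschitz constants.\<close>

lemma side_chart_reflection:
  fixes x :: real
  assumes c: "side_chart D \<gamma> t e \<sigma> a" and x: "\<bar>x - t\<bar> < e"
  obtains \<rho> where "\<rho> > 0"
    "\<And>s \<delta>. s \<in> ball (of_real t) e \<Longrightarrow> \<sigma> * Im s > 0 \<Longrightarrow> cmod (\<gamma> s - \<gamma> (of_real x)) < \<rho> \<Longrightarrow>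
      \<delta> = infdist (\<gamma> s) (frontier D) \<Longrightarrow>
      0 < \<delta> \<and> \<delta> \<le> cmod (\<gamma> s - \<gamma> (of_real x)) \<and> ball (\<gamma> s) \<delta> \<subseteq> D \<and>
      cmod (\<gamma> s - \<gamma> (cnj s)) \<le> 6 * \<delta> \<and> (\<forall>w\<in>D. cmod (\<gamma> s - w) \<le> 3 * cmod (\<gamma> (cnj s) - w))"
proof -
  let ?B = "ball (complex_of_real t) e" and ?z = "\<gamma> (of_real x)"
  have xB: "complex_of_real x \<in> ?B" using x by (simp add: dist_real_def abs_minus_commute)
  have a: "a \<noteq> 0" and \<sigma>: "\<sigma> = 1 \<or> \<sigma> = -1" using c by (auto simp: side_chart_def)
  have inD: "\<gamma> s \<in> D \<longleftrightarrow> \<sigma> * Im s > 0" and fr: "\<gamma> s \<in> frontier D \<longleftrightarrow> Im s = 0" if "s \<in> ?B" for s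
    using c that by (auto simp: side_chart_def)
  have zf: "?z \<in> frontier D" using fr[OF xB] by simp
  have "open (\<gamma> ` ?B)" using side_chart_open[OF c, of ?B] by simp
  then obtain r0 where r0: "r0 > 0" "ball ?z r0 \<subseteq> \<gamma> ` ?B"
    using xB by (meson imageI open_contains_ball)
  show thesis
  \<comment> \<open>Mirror points are then less than \<open>r0 / 4\<close> apart, while a point
    \<open>w\<close> outside the chart is more than \<open>23 * r0 / 24\<close> away from
    \<open>\<gamma> s\<close>, so the comparison of distances holds for such \<open>w\<close> too.
    The frontier point nearest to \<open>\<gamma> s\<close> also falls into the chart.\<close>
  proof (rule that[of "r0 / 24"])
    show "r0 / 24 > 0" using r0 by simp
    fix s \<delta> assume s: "s \<in> ?B" "\<sigma> * Im s > 0" "cmod (\<gamma> s - ?z) < r0 / 24" and \<delta>: "\<delta> = infdist (\<gamma> s) (frontier D)"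
    have ne: "frontier D \<noteq> {}" using zf by blast
    obtain b where b: "b \<in> frontier D" "infdist (\<gamma> s) (frontier D) = dist (\<gamma> s) b"
      using infdist_attains_inf[OF frontier_closed ne] by metis
    have sD: "\<gamma> s \<in> D" "\<gamma> s \<notin> frontier D" using inD[OF s(1)] fr[OF s(1)] s(2) by auto
    have d0: "\<delta> > 0" using \<delta> b sD by (metis dist_pos_lt)
    have d1: "\<delta> \<le> cmod (\<gamma> s - ?z)" unfolding \<delta> using infdist_le[OF zf] by (simp add: dist_norm)
    have d2: "ball (\<gamma> s) \<delta> \<subseteq> D"
    proof -
      have "ball (\<gamma> s) \<delta> \<inter> frontier D = {}" using infdist_le[of _ "frontier D" "\<gamma> s"] \<delta> by fastforce
      then show ?thesis
        using connected_Int_frontier[of "ball (\<gamma> s) \<delta>" D] sD d0 by (metis Diff_eq_empty_iff Int_iff centre_in_ball connected_ball empty_iff)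
    qed
    have "dist ?z b \<le> dist ?z (\<gamma> s) + dist (\<gamma> s) b" by (rule dist_triangle)
    also have "\<dots> < r0" using s(3) d1 \<delta> b(2) r0(1) by (simp add: dist_norm norm_minus_commute)
    finally obtain \<tau> where \<tau>: "\<tau> \<in> ?B" "b = \<gamma> \<tau>" using r0(2) by auto
    have "Im \<tau> = 0" using fr[OF \<tau>(1)] \<tau>(2) b(1) by simp
    then have "\<bar>Im s\<bar> \<le> cmod (s - \<tau>)" using abs_Im_le_cmod[of "s - \<tau>"] by simp
    then have "cmod a / 2 * \<bar>Im s\<bar> \<le> cmod a / 2 * cmod (s - \<tau>)" by (intro mult_left_mono) auto
    also have "\<dots> \<le> \<delta>" using side_chart_bilipschitz(1)[OF c s(1) \<tau>(1)] \<tau>(2) \<delta> b(2) by (simp add: dist_norm)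
    finally have im: "cmod a * \<bar>Im s\<bar> \<le> 2 * \<delta>" by simp
    have cB: "cnj s \<in> ?B" using s(1) by (rule cnj_in_ball_of_real)
    have "cmod (\<gamma> s - \<gamma> (cnj s)) \<le> 3 * cmod a / 2 * cmod (s - cnj s)"
      by (rule side_chart_bilipschitz(2)[OF c s(1) cB])
    also have "cmod (s - cnj s) = 2 * \<bar>Im s\<bar>" by (simp add: complex_diff_cnj norm_mult)
    finally have d3: "cmod (\<gamma> s - \<gamma> (cnj s)) \<le> 6 * \<delta>" using im by simp
    have d4: "cmod (\<gamma> s - w) \<le> 3 * cmod (\<gamma> (cnj s) - w)" if w: "w \<in> D" for w
    proof (cases "w \<in> \<gamma> ` ?B")
      case True
      then obtain u where u: "u \<in> ?B" "w = \<gamma> u" by auto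
      have "\<sigma> * Im u > 0" using inD[OF u(1)] w u(2) by simp
      then have "Im s * Im u \<ge> 0" using s(2) \<sigma> by (auto simp: mult_nonneg_nonneg mult_nonpos_nonpos)
      then have "cmod (s - u) \<le> cmod (cnj s - u)" by (rule norm_diff_le_norm_cnj_diff)
      then have "cmod a / 2 * cmod (s - u) \<le> cmod a / 2 * cmod (cnj s - u)" by (intro mult_left_mono) auto
      then show ?thesis
        using side_chart_bilipschitz(1)[OF c cB u(1)] side_chart_bilipschitz(2)[OF c s(1) u(1)] u(2) by simp
    next
      case False
      then have "r0 \<le> cmod (w - ?z)" using r0(2) by (force simp: dist_norm norm_minus_commute)
      then have "r0 \<le> cmod (\<gamma> s - w) + cmod (\<gamma> s - ?z)"
        using norm_triangle_ineq4[of "\<gamma> s - ?z" "\<gamma> s - w"] by simp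
      moreover have "cmod (\<gamma> s - \<gamma> (cnj s)) \<le> r0 / 4" using d3 d1 s(3) by linarith
      moreover have "cmod (\<gamma> s - w) \<le> cmod (\<gamma> s - \<gamma> (cnj s)) + cmod (\<gamma> (cnj s) - w)"
        using norm_triangle_ineq[of "\<gamma> s - \<gamma> (cnj s)" "\<gamma> (cnj s) - w"] by simp
      ultimately show ?thesis using s(3) r0(1) by linarith
    qed
    show "0 < \<delta> \<and> \<delta> \<le> cmod (\<gamma> s - ?z) \<and> ball (\<gamma> s) \<delta> \<subseteq> D \<and>
      cmod (\<gamma> s - \<gamma> (cnj s)) \<le> 6 * \<delta> \<and> (\<forall>w\<in>D. cmod (\<gamma> s - w) \<le> 3 * cmod (\<gamma> (cnj s) - w))"
      using d0 d1 d2 d3 d4 by blast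
  qed
qed

section \<open>The Cauchy transform of the conjugate derivative\<close>

lemma set_borel_measurable_times_borel:
  fixes f g :: "complex \<Rightarrow> complex"
  assumes "set_borel_measurable borel A f" "g \<in> borel_measurable borel"
  shows "set_borel_measurable borel A (\<lambda>w. f w * g w)"
proof -
  have "(\<lambda>w. (indicator A w *\<^sub>R f w) * g w) \<in> borel_measurable borel"
    using assms by (intro borel_measurable_times) (auto simp: set_borel_measurable_def)
  then show ?thesis by (simp add: set_borel_measurable_def)
qed

lemma set_integrable_times_bounded:
  fixes f g :: "complex \<Rightarrow> complex"
  assumes f: "set_integrable lborel A f" and g: "g \<in> borel_measurable borel"
    and B: "\<And>w. w \<in> A \<Longrightarrow> cmod (g w) \<le> B"
  shows "set_integrable lborel A (\<lambda>w. f w * g w)"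
proof (rule set_integrable_bound)
  show "set_integrable lborel A (\<lambda>w. f w * of_real B)" using f by simp
  have "set_borel_measurable borel A f"
    using f by (auto simp: set_integrable_def set_borel_measurable_def dest: borel_measurable_integrable)
  then show "set_borel_measurable lborel A (\<lambda>w. f w * g w)"
    using set_borel_measurable_times_borel[OF _ g] by (simp add: set_borel_measurable_def)
  have "cmod (g w) \<le> \<bar>B\<bar>" if "w \<in> A" for w using B[OF that] by linarith
  then show "AE x in lborel. x \<in> A \<longrightarrow> cmod (f x * g x) \<le> cmod (f x * of_real B)"
    by (intro AE_I2) (auto simp: norm_mult intro!: mult_left_mono)
qed

text \<open>The error of the difference quotient is \<open>\<zeta>' - \<zeta>\<close> times the
  integral of \<open>f\<close> against \<open>1 / ((\<zeta> - w)^2 * (\<zeta>' - w))\<close>, hence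
  at most \<open>|\<zeta>' - \<zeta>| * N / r^3\<close>.\<close>

lemma holomorphic_cauchy_transform_away:
  fixes f :: "complex \<Rightarrow> complex"
  assumes U: "open U" and f: "set_integrable lborel A f" and r: "r > 0"
    and far: "\<And>w \<zeta>. w \<in> A \<Longrightarrow> \<zeta> \<in> U \<Longrightarrow> r \<le> cmod (\<zeta> - w)"
  shows "(\<lambda>\<zeta>. LINT w:A|lborel. f w / (\<zeta> - w)) holomorphic_on U"
proof -
  let ?F = "\<lambda>\<zeta>. LINT w:A|lborel. f w / (\<zeta> - w)"
  let ?k = "\<lambda>\<zeta> w. 1 / (\<zeta> - w :: complex)"
  define N where "N = (LINT w:A|lborel. cmod (f w))"
  have kb: "cmod (?k \<zeta> w) \<le> 1 / r" if "w \<in> A" "\<zeta> \<in> U" for w \<zeta>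
    using far[OF that] r by (simp add: norm_divide frac_le)
  have i1: "set_integrable lborel A (\<lambda>w. f w / (\<zeta> - w))" if "\<zeta> \<in> U" for \<zeta>
    using set_integrable_times_bounded[OF f borel_measurable_cauchy_kernel kb[OF _ that]] by simp
  have i2: "set_integrable lborel A (\<lambda>w. f w / (\<zeta> - w) / (\<zeta>' - w))" if "\<zeta> \<in> U" "\<zeta>' \<in> U" for \<zeta> \<zeta>'
    using set_integrable_times_bounded[OF i1[OF that(1)] borel_measurable_cauchy_kernel kb[OF _ that(2)]] by simp
  have i3: "set_integrable lborel A (\<lambda>w. f w / (\<zeta> - w) / (\<zeta> - w) / (\<zeta>' - w))" if "\<zeta> \<in> U" "\<zeta>' \<in> U" for \<zeta> \<zeta>'
    using set_integrable_times_bounded[OF i2[OF that(1) that(1)] borel_measurable_cauchy_kernel kb[OF _ that(2)]] by simp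
  have "\<exists>l. (?F has_field_derivative l) (at \<zeta>)" if \<zeta>: "\<zeta> \<in> U" for \<zeta>
  proof
    let ?L = "- (LINT w:A|lborel. f w / (\<zeta> - w) / (\<zeta> - w))"
    have quot: "(?F \<zeta>' - ?F \<zeta>) / (\<zeta>' - \<zeta>) - ?L =
       (\<zeta>' - \<zeta>) * (LINT w:A|lborel. f w / (\<zeta> - w) / (\<zeta> - w) / (\<zeta>' - w))" if z': "\<zeta>' \<in> U" "\<zeta>' \<noteq> \<zeta>" for \<zeta>'
    proof -
      have ne: "\<zeta> \<noteq> w" "\<zeta>' \<noteq> w" if "w \<in> A" for w using far[OF that \<zeta>] far[OF that z'(1)] r by auto
      \<comment> \<open>With \<open>p = \<zeta> - w\<close> and \<open>q = \<zeta>' - w\<close> this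
        is the integrated form of
        \<open>(q - p)^2 / (p^2 * q) = 1 / q - 1 / p + (q - p) / p^2\<close>.\<close>
      have "(\<zeta>' - \<zeta>) * ((\<zeta>' - \<zeta>) * (LINT w:A|lborel. f w / (\<zeta> - w) / (\<zeta> - w) / (\<zeta>' - w))) =
         (LINT w:A|lborel. (\<zeta>' - \<zeta>) * ((\<zeta>' - \<zeta>) * (f w / (\<zeta> - w) / (\<zeta> - w) / (\<zeta>' - w))))"
        by (simp only: set_integral_mult_right)
      also have "\<dots> = (LINT w:A|lborel. f w / (\<zeta>' - w) - f w / (\<zeta> - w) + (\<zeta>' - \<zeta>) * (f w / (\<zeta> - w) / (\<zeta> - w)))"
      proof (unfold set_lebesgue_integral_def, intro Bochner_Integration.integral_cong refl)
        fix w
        show "indicat_real A w *\<^sub>R ((\<zeta>' - \<zeta>) * ((\<zeta>' - \<zeta>) * (f w / (\<zeta> - w) / (\<zeta> - w) / (\<zeta>' - w)))) =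
          indicat_real A w *\<^sub>R (f w / (\<zeta>' - w) - f w / (\<zeta> - w) + (\<zeta>' - \<zeta>) * (f w / (\<zeta> - w) / (\<zeta> - w)))"
        proof (cases "w \<in> A")
          case True
          define p q where "p = \<zeta> - w" and "q = \<zeta>' - w"
          have pq: "p \<noteq> 0" "q \<noteq> 0" "\<zeta>' - \<zeta> = q - p" using ne[OF True] by (auto simp: p_def q_def)
          have "(q - p) * ((q - p) * (f w / p / p / q)) = f w / q - f w / p + (q - p) * (f w / p / p)"
            using pq by (simp add: field_simps)
          then show ?thesis unfolding pq(3) p_def[symmetric] q_def[symmetric] by simp
        qed simp
      qed
      also have "\<dots> = ?F \<zeta>' - ?F \<zeta> - (\<zeta>' - \<zeta>) * ?L"
        unfolding set_integral_add(2)[OF set_integral_diff(1)[OF i1[OF z'(1)] i1[OF \<zeta>]]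
            set_integrable_mult_right[OF i2[OF \<zeta> \<zeta>]]]
          set_integral_diff(2)[OF i1[OF z'(1)] i1[OF \<zeta>]] set_integral_mult_right by simp
      finally have "?F \<zeta>' - ?F \<zeta> - (\<zeta>' - \<zeta>) * ?L = (\<zeta>' - \<zeta>) * ((\<zeta>' - \<zeta>) * (LINT w:A|lborel. f w / (\<zeta> - w) / (\<zeta> - w) / (\<zeta>' - w)))"
        by simp
      then show ?thesis using z'(2) by (simp add: field_simps)
    qed
    have bound: "cmod ((?F \<zeta>' - ?F \<zeta>) / (\<zeta>' - \<zeta>) - ?L) \<le> cmod (\<zeta>' - \<zeta>) * (N / r^3)" if z': "\<zeta>' \<in> U" "\<zeta>' \<noteq> \<zeta>" for \<zeta>'
    proof -
      have "cmod (LINT w:A|lborel. f w / (\<zeta> - w) / (\<zeta> - w) / (\<zeta>' - w)) \<le>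
         (LINT w:A|lborel. cmod (f w / (\<zeta> - w) / (\<zeta> - w) / (\<zeta>' - w)))"
        by (rule set_integral_norm_bound[OF i3[OF \<zeta> z'(1)]])
      also have "\<dots> \<le> (LINT w:A|lborel. cmod (f w) / r^3)"
      proof (rule set_integral_mono)
        show "set_integrable lborel A (\<lambda>w. cmod (f w / (\<zeta> - w) / (\<zeta> - w) / (\<zeta>' - w)))"
          by (rule set_integrable_norm[OF i3[OF \<zeta> z'(1)]])
        show "set_integrable lborel A (\<lambda>w. cmod (f w) / r^3)"
          using set_integrable_norm[OF f] by simp
        fix w assume w: "w \<in> A"
        have "r * r * r \<le> cmod (\<zeta> - w) * cmod (\<zeta> - w) * cmod (\<zeta>' - w)"
          using far[OF w \<zeta>] far[OF w z'(1)] r by (intro mult_mono) auto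
        then have "cmod (f w) / (cmod (\<zeta> - w) * cmod (\<zeta> - w) * cmod (\<zeta>' - w)) \<le> cmod (f w) / (r * r * r)"
          using r by (intro frac_le) auto
        then show "cmod (f w / (\<zeta> - w) / (\<zeta> - w) / (\<zeta>' - w)) \<le> cmod (f w) / r^3"
          by (simp add: norm_divide norm_mult power3_eq_cube)
      qed
      also have "\<dots> = N / r^3" using r by (simp add: N_def)
      finally show ?thesis unfolding quot[OF z'] norm_mult by (intro mult_left_mono) auto
    qed
    have "((\<lambda>\<zeta>'. (?F \<zeta>' - ?F \<zeta>) / (\<zeta>' - \<zeta>) - ?L) \<longlongrightarrow> 0) (at \<zeta>)"
    proof (rule Lim_null_comparison)
      show "((\<lambda>\<zeta>'. cmod (\<zeta>' - \<zeta>) * (N / r^3)) \<longlongrightarrow> 0) (at \<zeta>)"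
        using r by (auto intro!: tendsto_eq_intros)
      have "\<forall>\<^sub>F \<zeta>' in at \<zeta>. \<zeta>' \<in> U" by (rule eventually_at_in_open'[OF U \<zeta>])
      then show "\<forall>\<^sub>F \<zeta>' in at \<zeta>. cmod ((?F \<zeta>' - ?F \<zeta>) / (\<zeta>' - \<zeta>) - ?L) \<le> cmod (\<zeta>' - \<zeta>) * (N / r^3)"
        using eventually_neq_at_within[of \<zeta>] by eventually_elim (rule bound)
    qed
    then show "(?F has_field_derivative ?L) (at \<zeta>)"
      unfolding has_field_derivative_iff by (subst Lim_null) 
  qed
  then show ?thesis unfolding holomorphic_on_open[OF U] by blast
qed

text \<open>The conjugate is part of the definition because the density
  \<open>cnj (deriv \<Psi>)\<close> is the d-bar derivative of \<open>cnj \<Psi>\<close>. There is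
  no factor \<open>1 / pi\<close>, hence the factors \<open>pi\<close> further on.\<close>

definition cauchy_transform :: "complex set \<Rightarrow> (complex \<Rightarrow> complex) \<Rightarrow> complex \<Rightarrow> complex" where
  "cauchy_transform D f \<zeta> = (LINT w:D|lborel. cnj (f w) / (\<zeta> - w))"

text \<open>For injective \<open>\<Psi>\<close> the last assumption says that the image has finite
  area.\<close>

locale square_integrable_primitive =
  fixes D :: "complex set" and \<Psi> :: "complex \<Rightarrow> complex"
  assumes open_D: "open D" and bounded_D: "bounded D" and hol_\<Psi>: "\<Psi> holomorphic_on D"
    and sq_int: "set_integrable lborel D (\<lambda>w. (cmod (deriv \<Psi> w))\<^sup>2)"
begin

abbreviation "CT \<equiv> cauchy_transform D (deriv \<Psi>)"

lemma hol_deriv: "deriv \<Psi> holomorphic_on D"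
  using hol_\<Psi> open_D by (rule holomorphic_deriv)

lemma meas_cnj_deriv: "set_borel_measurable borel D (\<lambda>w. cnj (deriv \<Psi> w))"
  unfolding set_borel_measurable_def using open_D
  by (intro borel_measurable_continuous_on_indicator continuous_intros holomorphic_on_imp_continuous_on hol_deriv) auto

text \<open>On a set of finite measure a square integrable function is integrable, since
  \<open>x \<le> 1 + x^2\<close>.\<close>

lemma int_cnj_deriv: "set_integrable lborel D (\<lambda>w. cnj (deriv \<Psi> w))"
proof (rule set_integrable_bound)
  have "emeasure lborel D < \<infinity>" using bounded_D by (rule emeasure_bounded_finite)
  then have "set_integrable lborel D (\<lambda>_. 1 :: real)"
    using open_D by (simp add: set_integrable_def integrable_real_indicator)
  then show "set_integrable lborel D (\<lambda>w. 1 + (cmod (deriv \<Psi> w))\<^sup>2)"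
    by (intro set_integral_add sq_int)
  show "set_borel_measurable lborel D (\<lambda>w. cnj (deriv \<Psi> w))"
    using meas_cnj_deriv by (simp add: set_borel_measurable_def)
  have "x \<le> 1 + x\<^sup>2" for x :: real
    using sum_squares_ge_zero[of "x - 1/2" "0"] by (simp add: power2_eq_square algebra_simps)
  then show "AE w in lborel. w \<in> D \<longrightarrow> norm (cnj (deriv \<Psi> w)) \<le> norm (1 + (cmod (deriv \<Psi> w))\<^sup>2)"
    by (intro AE_I2) (simp add: abs_of_nonneg add_nonneg_nonneg)
qed

lemma borel_D [measurable]: "D \<in> sets borel" using open_D by simp

lemma CT_integrable_off_ball:
  assumes "r > 0"
  shows "set_integrable lborel (D - ball \<zeta> r) (\<lambda>w. cnj (deriv \<Psi> w) / (\<zeta> - w))"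
proof -
  have "set_integrable lborel (D - ball \<zeta> r) (\<lambda>w. cnj (deriv \<Psi> w) * (1 / (\<zeta> - w)))"
  proof (rule set_integrable_times_bounded)
    show "set_integrable lborel (D - ball \<zeta> r) (\<lambda>w. cnj (deriv \<Psi> w))"
      by (rule set_integrable_subset[OF int_cnj_deriv]) auto
    show "cmod (1 / (\<zeta> - w)) \<le> 1 / r" if "w \<in> D - ball \<zeta> r" for w
      using that assms by (auto simp: norm_divide dist_norm intro!: divide_left_mono mult_pos_pos)
  qed (rule borel_measurable_cauchy_kernel)
  then show ?thesis by simp
qed

lemma CT_integrable_inside:
  assumes "\<zeta> \<in> D" shows "set_integrable lborel D (\<lambda>w. cnj (deriv \<Psi> w) / (\<zeta> - w))"
proof -
  obtain R where R: "R > 0" "ball \<zeta> R \<subseteq> D" using open_D assms by (meson open_contains_ball)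
  have 1: "set_integrable lborel (ball \<zeta> (R/2)) (\<lambda>w. cnj (deriv \<Psi> w) / (\<zeta> - w))"
    using R by (intro area_integral_cnj_deriv_kernel(1)[of _ _ R] holomorphic_on_subset[OF hol_\<Psi>]) auto
  have D: "D = ball \<zeta> (R/2) \<union> (D - ball \<zeta> (R/2))" using R by auto
  show ?thesis
    by (subst D, rule set_integrable_Un[OF 1 CT_integrable_off_ball]) (use R in auto)
qed

lemma CT_integrable_outside:
  assumes "\<zeta> \<notin> closure D" shows "set_integrable lborel D (\<lambda>w. cnj (deriv \<Psi> w) / (\<zeta> - w))"
proof -
  obtain r where r: "r > 0" "ball \<zeta> r \<subseteq> - closure D"
    using assms by (meson ComplI closed_closure open_Compl open_contains_ball)
  then have "D - ball \<zeta> r = D" using closure_subset[of D] by auto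
  then show ?thesis using CT_integrable_off_ball[OF r(1), of \<zeta>] by simp
qed

text \<open>The disc carries the only part of the transform that is not holomorphic in
  \<open>\<zeta>\<close>, and this part is known explicitly. At the centre it vanishes.\<close>

lemma CT_split:
  assumes "ball \<zeta>0 R \<subseteq> D" "0 < r" "r < R" "\<zeta> \<in> ball \<zeta>0 r"
  shows "CT \<zeta> = pi * cnj (\<Psi> \<zeta> - \<Psi> \<zeta>0) + (LINT w:D - ball \<zeta>0 r|lborel. cnj (deriv \<Psi> w) / (\<zeta> - w))"
proof -
  have hol: "\<Psi> holomorphic_on ball \<zeta>0 R" using hol_\<Psi> assms(1) by (rule holomorphic_on_subset)
  note K = area_integral_cnj_deriv_kernel[OF hol assms(2-4)]
  have D: "D = ball \<zeta>0 r \<union> (D - ball \<zeta>0 r)" using assms by auto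
  have "\<zeta> \<in> D" using assms by auto
  then have "set_integrable lborel (D - ball \<zeta>0 r) (\<lambda>w. cnj (deriv \<Psi> w) / (\<zeta> - w))"
    by (intro set_integrable_subset[OF CT_integrable_inside]) auto
  then have "(LINT w:ball \<zeta>0 r \<union> (D - ball \<zeta>0 r)|lborel. cnj (deriv \<Psi> w) / (\<zeta> - w)) =
     (LINT w:ball \<zeta>0 r|lborel. cnj (deriv \<Psi> w) / (\<zeta> - w)) + (LINT w:D - ball \<zeta>0 r|lborel. cnj (deriv \<Psi> w) / (\<zeta> - w))"
    using K(1) by (intro set_integral_Un) auto
  then show ?thesis unfolding cauchy_transform_def using K(2) D by simp
qed

text \<open>Subtracting \<open>pi * cnj \<Psi>\<close> removes the non-holomorphic part of the
  split. What remains is a Cauchy integral over points at distance at least \<open>R / 4\<close>, if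
  the disc of radius \<open>R / 2\<close> is cut out and \<open>\<zeta>\<close> is kept within
  \<open>R / 4\<close> of the centre.\<close>

lemma CT_minus_cnj_holomorphic: "(\<lambda>\<zeta>. CT \<zeta> - pi * cnj (\<Psi> \<zeta>)) holomorphic_on D"
  unfolding holomorphic_on_open[OF open_D]
proof
  fix \<zeta>0 assume "\<zeta>0 \<in> D"
  then obtain R where R: "R > 0" "ball \<zeta>0 R \<subseteq> D" using open_D by (meson open_contains_ball)
  let ?F = "\<lambda>\<zeta>. LINT w:D - ball \<zeta>0 (R/2)|lborel. cnj (deriv \<Psi> w) / (\<zeta> - w)"
  have "?F holomorphic_on ball \<zeta>0 (R/4)"
  proof (rule holomorphic_cauchy_transform_away)
    show "set_integrable lborel (D - ball \<zeta>0 (R/2)) (\<lambda>w. cnj (deriv \<Psi> w))"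
      by (rule set_integrable_subset[OF int_cnj_deriv]) auto
    show "R/4 \<le> cmod (\<zeta> - w)" if "w \<in> D - ball \<zeta>0 (R/2)" "\<zeta> \<in> ball \<zeta>0 (R/4)" for w \<zeta>
      using that dist_triangle[of \<zeta>0 w \<zeta>] by (auto simp: dist_norm)
  qed (use R in auto)
  then have "(\<lambda>\<zeta>. ?F \<zeta> - pi * cnj (\<Psi> \<zeta>0)) holomorphic_on ball \<zeta>0 (R/4)" by (intro holomorphic_intros)
  moreover have "CT \<zeta> - pi * cnj (\<Psi> \<zeta>) = ?F \<zeta> - pi * cnj (\<Psi> \<zeta>0)" if "\<zeta> \<in> ball \<zeta>0 (R/4)" for \<zeta>
    using CT_split[OF R(2), of "R/2" \<zeta>] that R(1) by (simp add: algebra_simps)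
  ultimately have "(\<lambda>\<zeta>. CT \<zeta> - pi * cnj (\<Psi> \<zeta>)) holomorphic_on ball \<zeta>0 (R/4)"
    by (auto intro: holomorphic_transform)
  then show "\<exists>f'. ((\<lambda>\<zeta>. CT \<zeta> - pi * cnj (\<Psi> \<zeta>)) has_field_derivative f') (at \<zeta>0)"
    unfolding holomorphic_on_open[OF open_ball] using R(1) by simp
qed

text \<open>The part of \<open>CT \<zeta>\<close> near \<open>\<zeta>\<close> vanishes exactly, being made of circle averages
  equal to 0; on the rest the difference of the kernels is \<open>O(\<delta> / \<bar>\<zeta> - w\<bar>\<^sup>2)\<close>, and Young's inequality separates the square integrable \<open>\<Psi>'\<close> from
  \<open>\<bar>\<zeta> - w\<bar>^(-4)\<close>. In the limit first \<open>\<mu>\<close> is taken large, then \<open>A\<close> small, then \<open>\<delta>\<close> small.\<close>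
lemma CT_difference_bound:
  assumes \<delta>: "\<delta> > 0" "ball \<zeta> \<delta> \<subseteq> D" and \<zeta>': "\<zeta>' \<notin> closure D" "cmod (\<zeta> - \<zeta>') \<le> 6 * \<delta>"
    and cmp: "\<And>w. w \<in> D \<Longrightarrow> cmod (\<zeta> - w) \<le> 3 * cmod (\<zeta>' - w)"
    and A: "A \<in> sets borel" "A \<subseteq> D" "ball \<zeta> (\<delta>/2) \<subseteq> A" and \<eta>: "\<eta> > 0" "\<And>w. w \<in> D - A \<Longrightarrow> \<eta> \<le> cmod (\<zeta> - w)"
    and \<mu>: "\<mu> > 0"
  shows "cmod (CT \<zeta> - CT \<zeta>') \<le> 10 * \<mu> * (LINT w:A|lborel. (cmod (deriv \<Psi> w))\<^sup>2) + 82 * pi / \<mu>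
     + 18 * \<delta> / \<eta>\<^sup>2 * (LINT w:D|lborel. cmod (deriv \<Psi> w))"
proof -
  \<comment> \<open>\<open>?Q\<close> uses a third instead of a half of \<open>\<delta>\<close>: it
    is given by a strict inequality and has to contain the circle bounding
    \<open>?B\<close>.\<close>
  let ?f = "deriv \<Psi>" and ?B = "ball \<zeta> (\<delta>/2)" and ?Q = "{w. \<delta>/3 < cmod (w - \<zeta>)}"
  have BD: "?B \<subseteq> D" using A by auto
  have \<zeta>D: "\<zeta> \<in> D" using \<delta> by auto
  \<comment> \<open>The singular kernel is switched off on the small disc, whose contribution to
    \<open>CT \<zeta>\<close> is 0. The exterior kernel has no singularity there and is
    kept.\<close>
  define H where "H w = cnj (?f w) / (\<zeta> - w) * (1 - indicator ?B w) - cnj (?f w) / (\<zeta>' - w)" for w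
  \<comment> \<open>A majorant of \<open>H\<close> covering three regions. On \<open>?B\<close> the
    exterior kernel is at most \<open>2 / \<delta>\<close>, and Young's inequality gives coefficient
    1 of the square. On \<open>A\<close> off \<open>?B\<close> the difference of kernels is at most
    \<open>18 * \<delta> / |\<zeta> - w|^2\<close>, with \<open>18 = 6 * 3\<close>, and Young gives
    coefficient 9. Off \<open>A\<close> the bound is \<open>18 * \<delta> / \<eta>^2\<close>. The
    number 82 absorbs \<open>1 / 4\<close> from the area of \<open>?B\<close> and 81 from the fourth
    power.\<close>
  let ?g = "\<lambda>w. 10 * \<mu> * (indicator A w *\<^sub>R (cmod (?f w))\<^sup>2) + (1 / (\<mu> * \<delta>\<^sup>2)) * indicator ?B w +
     (9 * \<delta>\<^sup>2 / \<mu>) * (indicator ?Q w *\<^sub>R (1 / cmod (w - \<zeta>) ^ 4)) + (18 * \<delta> / \<eta>\<^sup>2) * (indicator D w *\<^sub>R cmod (?f w))"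
  have i0: "set_integrable lborel D (\<lambda>w. cnj (?f w) / (\<zeta>' - w))" by (rule CT_integrable_outside[OF \<zeta>'(1)])
  have iE: "set_integrable lborel (D - ?B) (\<lambda>w. cnj (?f w) / (\<zeta> - w))" by (rule CT_integrable_off_ball) (use \<delta> in auto)
  \<comment> \<open>The split with \<open>\<zeta>\<close> itself as centre, where the explicit term
    is 0.\<close>
  have CTE: "CT \<zeta> = (LINT w:D - ?B|lborel. cnj (?f w) / (\<zeta> - w))"
    using CT_split[OF \<delta>(2), of "\<delta>/2" \<zeta>] \<delta>(1) by simp
  have HE: "indicator D w *\<^sub>R H w = indicator (D - ?B) w *\<^sub>R (cnj (?f w) / (\<zeta> - w)) - indicator D w *\<^sub>R (cnj (?f w) / (\<zeta>' - w))" for w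
    using BD by (auto simp: H_def indicator_def)
  have Hint: "integrable lborel (\<lambda>w. indicator D w *\<^sub>R H w)"
    unfolding HE using iE i0 by (intro Bochner_Integration.integrable_diff) (auto simp: set_integrable_def)
  have "CT \<zeta> - CT \<zeta>' = integral\<^sup>L lborel (\<lambda>w. indicator D w *\<^sub>R H w)"
    unfolding HE CTE unfolding cauchy_transform_def set_lebesgue_integral_def
    using iE i0 by (intro Bochner_Integration.integral_diff[symmetric]) (auto simp: set_integrable_def)
  then have 1: "cmod (CT \<zeta> - CT \<zeta>') \<le> integral\<^sup>L lborel (\<lambda>w. cmod (indicator D w *\<^sub>R H w))"
    by (metis integral_norm_bound)
  have i1: "integrable lborel (\<lambda>w. indicator A w *\<^sub>R (cmod (?f w))\<^sup>2)"
    using set_integrable_subset[OF sq_int, of A] A by (simp add: set_integrable_def)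
  have i2: "integrable lborel (indicator ?B :: complex \<Rightarrow> real)"
    by (intro integrable_real_indicator emeasure_bounded_finite) auto
  have i3: "integrable lborel (\<lambda>w. indicator ?Q w *\<^sub>R (1 / cmod (w - \<zeta>) ^ 4))"
    using set_integral_norm_power4_outside(1)[of "\<delta>/3" \<zeta>] \<delta> by (simp add: set_integrable_def)
  have "set_integrable lborel D (\<lambda>w. cmod (?f w))" using set_integrable_norm[OF int_cnj_deriv] by simp
  then have i4: "integrable lborel (\<lambda>w. indicator D w *\<^sub>R cmod (?f w))" by (simp add: set_integrable_def)
  have gint: "integrable lborel ?g"
    by (intro Bochner_Integration.integrable_add integrable_mult_right i1 i2 i3 i4)
  have young: "p * q \<le> (\<mu> * p\<^sup>2 + q\<^sup>2 / \<mu>) / 2" for p q :: real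
  proof -
    have "0 \<le> (\<mu> * p - q)\<^sup>2 / \<mu>" using \<mu> by simp
    also have "\<dots> = \<mu> * p\<^sup>2 + q\<^sup>2 / \<mu> - 2 * (p * q)"
      using \<mu> by (simp add: power2_eq_square field_simps)
    finally show ?thesis by simp
  qed
  have Hb: "cmod (indicator D w *\<^sub>R H w) \<le> ?g w" for w
  proof (cases "w \<in> D")
    case False
    then show ?thesis using \<mu> \<delta> \<eta> by (simp add: add_nonneg_nonneg)
  next
    case wD: True
    let ?F = "cmod (?f w)"
    have pos: "0 \<le> \<mu> * ?F\<^sup>2" "0 \<le> \<delta> / \<eta>\<^sup>2 * ?F" "0 \<le> \<delta>\<^sup>2 / \<mu> * (indicator ?Q w *\<^sub>R (1 / cmod (w - \<zeta>) ^ 4))" "0 \<le> 1 / (\<mu> * \<delta>\<^sup>2)"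
      using \<mu> \<delta> \<eta> by auto
    show ?thesis
    proof (cases "w \<in> ?B")
      case True
      have "\<zeta>' \<notin> ball \<zeta> \<delta>" using \<delta>(2) \<zeta>'(1) closure_subset[of D] by blast
      then have "\<delta> \<le> cmod (\<zeta> - \<zeta>')" by (simp add: dist_norm)
      moreover have "cmod (\<zeta> - w) < \<delta> / 2" using True by (simp add: dist_norm)
      moreover have "cmod (\<zeta> - \<zeta>') \<le> cmod (\<zeta> - w) + cmod (\<zeta>' - w)"
        using norm_triangle_ineq4[of "\<zeta> - w" "\<zeta>' - w"] by simp
      ultimately have far: "\<delta> / 2 \<le> cmod (\<zeta>' - w)" by linarith
      have "cmod (H w) = ?F / cmod (\<zeta>' - w)" using True by (simp add: H_def norm_divide)
      also have "\<dots> \<le> ?F / (\<delta> / 2)" using far \<delta> by (intro divide_left_mono mult_pos_pos) auto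
      also have "\<dots> = 2 * (?F * (1 / \<delta>))" by simp
      also have "\<dots> \<le> \<mu> * ?F\<^sup>2 + 1 / (\<mu> * \<delta>\<^sup>2)" using young[of ?F "1 / \<delta>"] by (simp add: power_divide mult.commute)
      finally show ?thesis using wD True A pos by (auto simp: indicator_def)
    next
      case False
      define d where "d = cmod (\<zeta> - w)"
      have d: "\<delta> / 2 \<le> d" "d > 0" using False \<delta> by (auto simp: d_def dist_norm)
      have d': "d \<le> 3 * cmod (\<zeta>' - w)" using cmp[OF wD] by (simp add: d_def)
      then have ne: "\<zeta>' - w \<noteq> 0" "\<zeta> - w \<noteq> 0" using d by (auto simp: d_def)
      have "H w = cnj (?f w) * ((\<zeta>' - \<zeta>) / ((\<zeta> - w) * (\<zeta>' - w)))"
        using False ne by (simp add: H_def field_simps)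
      then have "cmod (H w) = ?F * (cmod (\<zeta> - \<zeta>') / (d * cmod (\<zeta>' - w)))"
        by (simp add: norm_mult norm_divide d_def norm_minus_commute)
      also have "\<dots> \<le> ?F * (6 * \<delta> / (d * (d / 3)))"
        using d d' \<zeta>'(2) \<delta> ne by (intro mult_left_mono frac_le mult_mono mult_pos_pos) auto
      also have "\<dots> = 18 * (?F * (\<delta> / d\<^sup>2))" using d by (simp add: power2_eq_square)
      finally have Hw: "cmod (H w) \<le> 18 * (?F * (\<delta> / d\<^sup>2))" .
      have Qw: "w \<in> ?Q" using d \<delta> by (simp add: d_def norm_minus_commute)
      show ?thesis
      proof (cases "w \<in> A")
        case True
        have "18 * (?F * (\<delta> / d\<^sup>2)) \<le> 9 * (\<mu> * ?F\<^sup>2) + 9 * \<delta>\<^sup>2 / \<mu> * (1 / d ^ 4)"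
        proof -
          have "(\<delta> / d\<^sup>2)\<^sup>2 / \<mu> = \<delta>\<^sup>2 / \<mu> * (1 / d ^ 4)"
            by (simp add: power_divide flip: power_mult)
          then have "?F * (\<delta> / d\<^sup>2) \<le> (\<mu> * ?F\<^sup>2 + \<delta>\<^sup>2 / \<mu> * (1 / d ^ 4)) / 2"
            using young[of ?F "\<delta> / d\<^sup>2"] by (simp only:)
          then have "18 * (?F * (\<delta> / d\<^sup>2)) \<le> 18 * ((\<mu> * ?F\<^sup>2 + \<delta>\<^sup>2 / \<mu> * (1 / d ^ 4)) / 2)"
            by (rule mult_left_mono) simp
          also have "18 * ((x + y) / 2) = 9 * x + 9 * y" for x y :: real by simp
          finally have "18 * (?F * (\<delta> / d\<^sup>2)) \<le> 9 * (\<mu> * ?F\<^sup>2) + 9 * (\<delta>\<^sup>2 / \<mu> * (1 / d ^ 4))" .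
          then show ?thesis by simp
        qed
        moreover have "d ^ 4 = cmod (w - \<zeta>) ^ 4" by (simp add: d_def norm_minus_commute)
        ultimately show ?thesis using wD True False Hw Qw pos by (simp add: indicator_def)
      next
        case nA: False
        have "\<eta> \<le> d" using \<eta>(2)[of w] wD nA by (simp add: d_def)
        then have "\<eta>\<^sup>2 \<le> d\<^sup>2" using \<eta> by (intro power_mono) auto
        then have "\<delta> / d\<^sup>2 \<le> \<delta> / \<eta>\<^sup>2" using \<delta> \<eta> d by (intro divide_left_mono mult_pos_pos) auto
        then have "?F * (\<delta> / d\<^sup>2) \<le> ?F * (\<delta> / \<eta>\<^sup>2)" by (intro mult_left_mono) auto
        then have "18 * (?F * (\<delta> / d\<^sup>2)) \<le> 18 * (?F * (\<delta> / \<eta>\<^sup>2))" by (rule mult_left_mono) simp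
        also have "\<dots> = 18 * \<delta> / \<eta>\<^sup>2 * ?F" by simp
        finally have "cmod (H w) \<le> 18 * \<delta> / \<eta>\<^sup>2 * ?F" using Hw by linarith
        then show ?thesis using wD nA False Qw pos by (simp add: indicator_def)
      qed
    qed
  qed
  have "integral\<^sup>L lborel (\<lambda>w. cmod (indicator D w *\<^sub>R H w)) \<le> integral\<^sup>L lborel ?g"
    using Hint gint Hb by (intro integral_mono integrable_norm) auto
  also have "\<dots> = 10 * \<mu> * (LINT w:A|lborel. (cmod (?f w))\<^sup>2) + (1 / (\<mu> * \<delta>\<^sup>2)) * measure lborel ?B +
     (9 * \<delta>\<^sup>2 / \<mu>) * (LINT w:?Q|lborel. 1 / cmod (w - \<zeta>) ^ 4) + (18 * \<delta> / \<eta>\<^sup>2) * (LINT w:D|lborel. cmod (?f w))"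
    unfolding set_lebesgue_integral_def using i1 i2 i3 i4
    by (subst Bochner_Integration.integral_add Bochner_Integration.integral_mult_right_zero | intro Bochner_Integration.integrable_add integrable_mult_right | simp)+
  also have "measure lborel ?B = pi * (\<delta>/2)\<^sup>2"
    using \<delta> content_ball[of "\<delta>/2" \<zeta>] by (simp add: eval_unit_ball_vol)
  also have "(LINT w:?Q|lborel. 1 / cmod (w - \<zeta>) ^ 4) = pi / (\<delta>/3)\<^sup>2"
    by (rule set_integral_norm_power4_outside(2)) (use \<delta> in auto)
  also have "(1 / (\<mu> * \<delta>\<^sup>2)) * (pi * (\<delta>/2)\<^sup>2) = pi / (4 * \<mu>)" using \<delta> \<mu> by (simp add: field_simps power2_eq_square)
  also have "(9 * \<delta>\<^sup>2 / \<mu>) * (pi / (\<delta>/3)\<^sup>2) = 81 * pi / \<mu>" using \<delta> \<mu> by (simp add: field_simps power2_eq_square)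
  finally have "cmod (CT \<zeta> - CT \<zeta>') \<le> 10 * \<mu> * (LINT w:A|lborel. (cmod (?f w))\<^sup>2) + pi / (4 * \<mu>) + 81 * pi / \<mu>
     + 18 * \<delta> / \<eta>\<^sup>2 * (LINT w:D|lborel. cmod (?f w))" using 1 by linarith
  moreover have "pi / (4 * \<mu>) \<le> pi / \<mu>" using \<mu> by (intro divide_left_mono mult_pos_pos) auto
  moreover have "82 * pi / \<mu> = pi / \<mu> + 81 * pi / \<mu>" by (simp add: field_simps)
  ultimately show ?thesis by linarith
qed

text \<open>Dominated convergence. Because \<open>z\<close> lies outside \<open>D\<close>, the
  indicators tend to 0 at \<open>z\<close> as well.\<close>

lemma sq_int_shrinking_ball:
  assumes "z \<notin> D"
  shows "(\<lambda>n. LINT w:D \<inter> ball z (1 / real (Suc n))|lborel. (cmod (deriv \<Psi> w))\<^sup>2) \<longlonglongrightarrow> 0"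
proof -
  have "(\<lambda>n. integral\<^sup>L lborel (\<lambda>w. indicator (D \<inter> ball z (1 / real (Suc n))) w *\<^sub>R (cmod (deriv \<Psi> w))\<^sup>2))
     \<longlonglongrightarrow> integral\<^sup>L (lborel :: complex measure) (\<lambda>w. 0 :: real)"
  proof (rule integral_dominated_convergence)
    show "integrable lborel (\<lambda>w. indicator D w *\<^sub>R (cmod (deriv \<Psi> w))\<^sup>2)"
      using sq_int by (simp add: set_integrable_def)
    show "(\<lambda>w. indicator (D \<inter> ball z (1 / real (Suc n))) w *\<^sub>R (cmod (deriv \<Psi> w))\<^sup>2) \<in> borel_measurable lborel" for n
      using set_integrable_subset[OF sq_int, of "D \<inter> ball z (1 / real (Suc n))"]
      by (auto simp: set_integrable_def dest: borel_measurable_integrable)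
    show "AE w in lborel. (\<lambda>n. indicator (D \<inter> ball z (1 / real (Suc n))) w *\<^sub>R (cmod (deriv \<Psi> w))\<^sup>2) \<longlonglongrightarrow> 0"
    proof (rule AE_I2)
      fix w :: complex
      show "(\<lambda>n. indicator (D \<inter> ball z (1 / real (Suc n))) w *\<^sub>R (cmod (deriv \<Psi> w))\<^sup>2) \<longlonglongrightarrow> 0"
      proof (cases "w = z")
        case True then show ?thesis using assms by simp
      next
        case False
        then obtain N where N: "1 / real (Suc N) < dist z w"
          by (metis dist_pos_lt nat_approx_posE)
        have "w \<notin> ball z (1 / real (Suc n))" if "n \<ge> N" for n
        proof -
          have "1 / real (Suc n) \<le> 1 / real (Suc N)" using that by (simp add: frac_le)
          then show ?thesis using N by simp
        qed
        then have "\<forall>\<^sub>F n in sequentially. indicator (D \<inter> ball z (1 / real (Suc n))) w *\<^sub>R (cmod (deriv \<Psi> w))\<^sup>2 = 0"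
          unfolding eventually_sequentially by (intro exI[of _ N]) (auto simp: indicator_def)
        then show ?thesis by (rule tendsto_eventually)
      qed
    qed
  qed (auto simp: indicator_def)
  then show ?thesis by (simp add: set_lebesgue_integral_def)
qed

text \<open>No one-sided limit of \<open>CT\<close> is claimed. Only mirror points are compared,
  whose mutual distance is comparable to their distance from the boundary.\<close>

lemma CT_jump_tendsto_0:
  fixes x :: real
  assumes c: "side_chart D \<gamma> t e \<sigma> a" and x: "\<bar>x - t\<bar> < e"
  shows "((\<lambda>s. CT (\<gamma> s) - CT (\<gamma> (cnj s))) \<longlongrightarrow> 0) (at (of_real x) within (ball (of_real t) e \<inter> {s. \<sigma> * Im s > 0}))"
proof (rule tendstoI)
  fix \<epsilon> :: real assume \<epsilon>: "\<epsilon> > 0"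
  let ?B = "ball (complex_of_real t) e" and ?z = "\<gamma> (of_real x)"
  have xB: "complex_of_real x \<in> ?B" using x by (simp add: dist_real_def abs_minus_commute)
  have ch: "\<gamma> s \<in> D \<longleftrightarrow> \<sigma> * Im s > 0" "\<gamma> s \<in> closure D \<longleftrightarrow> \<sigma> * Im s \<ge> 0" if "s \<in> ?B" for s
    using c that by (auto simp: side_chart_def)
  have zD: "?z \<notin> D" using ch(1)[OF xB] by simp
  obtain \<rho> where \<rho>: "\<rho> > 0" and R: "\<And>s \<delta>. s \<in> ?B \<Longrightarrow> \<sigma> * Im s > 0 \<Longrightarrow> cmod (\<gamma> s - ?z) < \<rho> \<Longrightarrow>
      \<delta> = infdist (\<gamma> s) (frontier D) \<Longrightarrow>
      0 < \<delta> \<and> \<delta> \<le> cmod (\<gamma> s - ?z) \<and> ball (\<gamma> s) \<delta> \<subseteq> D \<and>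
      cmod (\<gamma> s - \<gamma> (cnj s)) \<le> 6 * \<delta> \<and> (\<forall>w\<in>D. cmod (\<gamma> s - w) \<le> 3 * cmod (\<gamma> (cnj s) - w))"
    using side_chart_reflection[OF c x] by metis
  define N1 where "N1 = (LINT w:D|lborel. cmod (deriv \<Psi> w))"
  \<comment> \<open>Each of the three terms of the bound gets a third of \<open>\<epsilon>\<close>;
    here \<open>82 / 300 < 1 / 3\<close>.\<close>
  define \<mu> where "\<mu> = 300 * pi / \<epsilon>"
  have \<mu>: "\<mu> > 0" "82 * pi / \<mu> < \<epsilon> / 3" using \<epsilon> by (auto simp: \<mu>_def)
  have "\<forall>\<^sub>F n in sequentially. (LINT w:D \<inter> ball ?z (1 / real (Suc n))|lborel. (cmod (deriv \<Psi> w))\<^sup>2) < \<epsilon> / (30 * \<mu>)"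
    using sq_int_shrinking_ball[OF zD] \<epsilon> \<mu> by (intro order_tendstoD(2)) auto
  then obtain n where n: "(LINT w:D \<inter> ball ?z (1 / real (Suc n))|lborel. (cmod (deriv \<Psi> w))\<^sup>2) < \<epsilon> / (30 * \<mu>)"
    by (auto simp: eventually_sequentially)
  define \<eta> where "\<eta> = 1 / real (Suc n)"
  have \<eta>: "\<eta> > 0" by (simp add: \<eta>_def)
  define A where "A = D \<inter> ball ?z \<eta>"
  have IA: "10 * \<mu> * (LINT w:A|lborel. (cmod (deriv \<Psi> w))\<^sup>2) < \<epsilon> / 3"
    using n \<mu> by (simp add: A_def \<eta>_def field_simps)
  have N1: "N1 \<ge> 0" unfolding N1_def set_lebesgue_integral_def by (intro Bochner_Integration.integral_nonneg) auto
  \<comment> \<open>The bound \<open>\<eta> / 4\<close> keeps the small disc about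
    \<open>\<gamma> s\<close> inside \<open>A\<close> and the rest of \<open>D\<close> at distance
    \<open>\<eta> / 2\<close>. With \<open>\<eta> / 2\<close> in the denominator the last term is
    \<open>72 * N1 * \<delta> / \<eta>^2\<close>, whence \<open>216 = 3 * 72\<close>;
    \<open>N1 + 1\<close> avoids division by 0.\<close>
  define \<rho>' where "\<rho>' = min \<rho> (min (\<eta> / 4) (\<epsilon> * \<eta>\<^sup>2 / (216 * (N1 + 1))))"
  have \<rho>': "\<rho>' > 0" using \<rho> \<eta> \<epsilon> N1 by (simp add: \<rho>'_def)
  have "isCont \<gamma> (of_real x)"
    using c xB by (intro continuous_on_interior[OF holomorphic_on_imp_continuous_on]) (auto simp: side_chart_def)
  then have "(\<gamma> \<longlongrightarrow> ?z) (at (of_real x) within (?B \<inter> {s. \<sigma> * Im s > 0}))"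
    unfolding isCont_def by (rule tendsto_within_subset) simp
  then have "\<forall>\<^sub>F s in at (of_real x) within (?B \<inter> {s. \<sigma> * Im s > 0}). dist (\<gamma> s) ?z < \<rho>'"
    using \<rho>' by (rule tendstoD)
  moreover have "\<forall>\<^sub>F s in at (of_real x) within (?B \<inter> {s. \<sigma> * Im s > 0}). s \<in> ?B \<inter> {s. \<sigma> * Im s > 0}"
    by (auto simp: eventually_at_filter)
  ultimately show "\<forall>\<^sub>F s in at (of_real x) within (?B \<inter> {s. \<sigma> * Im s > 0}). dist (CT (\<gamma> s) - CT (\<gamma> (cnj s))) 0 < \<epsilon>"
  proof eventually_elim
    case (elim s)
    let ?\<delta> = "infdist (\<gamma> s) (frontier D)"
    have s: "s \<in> ?B" "\<sigma> * Im s > 0" using elim by auto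
    have dz: "cmod (\<gamma> s - ?z) < \<rho>'" using elim by (simp add: dist_norm)
    have small: "cmod (\<gamma> s - ?z) < \<rho>" "cmod (\<gamma> s - ?z) < \<eta> / 4" "cmod (\<gamma> s - ?z) < \<epsilon> * \<eta>\<^sup>2 / (216 * (N1 + 1))"
      using dz by (auto simp: \<rho>'_def)
    note R' = R[OF s small(1) refl]
    have cs: "\<gamma> (cnj s) \<notin> closure D"
      using ch(2)[OF cnj_in_ball_of_real[OF s(1)]] s(2) by simp
    have bA: "ball (\<gamma> s) (?\<delta> / 2) \<subseteq> A"
    proof
      fix w assume w: "w \<in> ball (\<gamma> s) (?\<delta> / 2)"
      have "w \<in> ball (\<gamma> s) ?\<delta>" using w R' by (auto simp: dist_norm)
      then have "w \<in> D" using R' by blast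
      moreover have "dist ?z w \<le> dist (\<gamma> s) ?z + dist (\<gamma> s) w" by (metis dist_commute dist_triangle)
      then have "dist ?z w < \<eta>" using w R' small(2) \<eta> by (simp add: dist_norm)
      ultimately show "w \<in> A" by (simp add: A_def)
    qed
    have far: "\<eta> / 2 \<le> cmod (\<gamma> s - w)" if "w \<in> D - A" for w
    proof -
      have "\<eta> \<le> dist ?z w" using that by (auto simp: A_def)
      moreover have "dist ?z w \<le> dist (\<gamma> s) ?z + dist (\<gamma> s) w" by (metis dist_commute dist_triangle)
      ultimately show ?thesis using small(2) \<eta> by (simp add: dist_norm)
    qed
    have "cmod (CT (\<gamma> s) - CT (\<gamma> (cnj s))) \<le> 10 * \<mu> * (LINT w:A|lborel. (cmod (deriv \<Psi> w))\<^sup>2) + 82 * pi / \<mu>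
       + 18 * ?\<delta> / (\<eta> / 2)\<^sup>2 * (LINT w:D|lborel. cmod (deriv \<Psi> w))"
      using R' cs bA far \<mu> \<eta> by (intro CT_difference_bound) (auto simp: A_def)
    moreover have "18 * ?\<delta> / (\<eta> / 2)\<^sup>2 * (LINT w:D|lborel. cmod (deriv \<Psi> w)) \<le> \<epsilon> / 3"
    proof -
      have "18 * ?\<delta> / (\<eta> / 2)\<^sup>2 * N1 = (72 * N1 / \<eta>\<^sup>2) * ?\<delta>" by (simp add: field_simps power2_eq_square)
      also have "\<dots> \<le> (72 * N1 / \<eta>\<^sup>2) * (\<epsilon> * \<eta>\<^sup>2 / (216 * (N1 + 1)))"
        using R' small(3) N1 by (intro mult_left_mono) auto
      also have "\<dots> = \<epsilon> / 3 * (N1 / (N1 + 1))" using \<eta> N1 by (simp add: field_simps power2_eq_square)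
      also have "\<dots> \<le> \<epsilon> / 3 * 1" using N1 \<epsilon> by (intro mult_left_mono) auto
      finally show ?thesis by (simp add: N1_def)
    qed
    ultimately show ?case using IA \<mu>(2) by simp
  qed
qed

end

section \<open>The Schwarz function of a quadrature domain\<close>

text \<open>The point is that the coefficients \<open>A j\<close> do not depend on
  \<open>\<zeta>\<close>: at a fixed node the derivatives are rational functions of
  \<open>\<zeta>\<close> with the single pole \<open>\<Phi> z\<close>.\<close>

lemma higher_deriv_kernel_pullback:
  assumes \<Omega>: "open \<Omega>" and \<Phi>: "\<Phi> holomorphic_on \<Omega>"
  shows "\<exists>A :: nat \<Rightarrow> complex \<Rightarrow> complex. (\<forall>j. A j holomorphic_on \<Omega>) \<and>
    (\<forall>\<zeta>. \<forall>z\<in>\<Omega>. \<Phi> z \<noteq> \<zeta> \<longrightarrow>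
      (deriv ^^ k) (\<lambda>z. deriv \<Phi> z / (\<zeta> - \<Phi> z)) z = (\<Sum>j\<le>k. A j z / (\<zeta> - \<Phi> z) ^ Suc j))"
proof (induction k)
  case 0
  have "deriv \<Phi> holomorphic_on \<Omega>" using \<Phi> \<Omega> by (rule holomorphic_deriv)
  then show ?case by (intro exI[of _ "\<lambda>_. deriv \<Phi>"]) simp
next
  case (Suc k)
  then obtain A where A: "\<And>j. A j holomorphic_on \<Omega>"
    "\<And>\<zeta> z. z \<in> \<Omega> \<Longrightarrow> \<Phi> z \<noteq> \<zeta> \<Longrightarrow>
      (deriv ^^ k) (\<lambda>z. deriv \<Phi> z / (\<zeta> - \<Phi> z)) z = (\<Sum>j\<le>k. A j z / (\<zeta> - \<Phi> z) ^ Suc j)"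
    by blast
  \<comment> \<open>Differentiating the term of index \<open>j\<close> leaves
    \<open>deriv (A j)\<close> in place and sends \<open>(j + 1) * A j * deriv \<Phi>\<close> to
    index \<open>j + 1\<close>.\<close>
  define A' where "A' j z = (if j \<le> k then deriv (A j) z else 0) + (if j = 0 then 0 else of_nat j * A (j - 1) z * deriv \<Phi> z)" for j z
  have hol': "A' j holomorphic_on \<Omega>" for j
    unfolding A'_def using A(1) \<Phi> \<Omega> by (cases "j \<le> k"; cases "j = 0") (auto intro!: holomorphic_intros)
  have eq: "(deriv ^^ Suc k) (\<lambda>z. deriv \<Phi> z / (\<zeta> - \<Phi> z)) z = (\<Sum>j\<le>Suc k. A' j z / (\<zeta> - \<Phi> z) ^ Suc j)"
    if z: "z \<in> \<Omega>" "\<Phi> z \<noteq> \<zeta>" for \<zeta> z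
  proof -
    define U where "U = {z \<in> \<Omega>. \<Phi> z \<noteq> \<zeta>}"
    have "U = \<Omega> \<inter> \<Phi> -` (- {\<zeta>})" by (auto simp: U_def)
    then have U: "open U" using \<Omega> holomorphic_on_imp_continuous_on[OF \<Phi>]
      by (metis continuous_openin_preimage_gen open_Compl closed_singleton openin_open_eq Int_lower1 continuous_on_open_vimage Int_commute)
    have zU: "z \<in> U" using z by (simp add: U_def)
    have ev: "\<forall>\<^sub>F u in nhds z. (deriv ^^ k) (\<lambda>z. deriv \<Phi> z / (\<zeta> - \<Phi> z)) u = (\<Sum>j\<le>k. A j u / (\<zeta> - \<Phi> u) ^ Suc j)"
      using eventually_nhds_in_open[OF U zU] by eventually_elim (use A(2) in \<open>auto simp: U_def\<close>)
    have ne: "\<zeta> - \<Phi> z \<noteq> 0" using z by simp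
    have d1: "((\<lambda>u. A j u / (\<zeta> - \<Phi> u) ^ Suc j) has_field_derivative
        (deriv (A j) z / (\<zeta> - \<Phi> z) ^ Suc j + of_nat (Suc j) * A j z * deriv \<Phi> z / (\<zeta> - \<Phi> z) ^ Suc (Suc j))) (at z)" for j
    proof -
      have 1: "(A j has_field_derivative deriv (A j) z) (at z)" using holomorphic_derivI[OF A(1) \<Omega> z(1)] .
      have 2: "(\<Phi> has_field_derivative deriv \<Phi> z) (at z)" using holomorphic_derivI[OF \<Phi> \<Omega> z(1)] .
      have 3: "((\<lambda>u. (\<zeta> - \<Phi> u) ^ Suc j) has_field_derivative - (of_nat (Suc j) * (\<zeta> - \<Phi> z) ^ j * deriv \<Phi> z)) (at z)"
        using DERIV_power[OF DERIV_diff[OF DERIV_const 2], of \<zeta> "Suc j"]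
        by (rule DERIV_cong) (simp add: mult_ac)
      have "(\<zeta> - \<Phi> z) ^ Suc j \<noteq> 0" using ne by simp
      from DERIV_divide[OF 1 3 this]
      show ?thesis
      proof (rule DERIV_cong)
        let ?d = "\<zeta> - \<Phi> z"
        show "(deriv (A j) z * ?d ^ Suc j - A j z * - (of_nat (Suc j) * ?d ^ j * deriv \<Phi> z)) / (?d ^ Suc j * ?d ^ Suc j) =
          deriv (A j) z / ?d ^ Suc j + of_nat (Suc j) * A j z * deriv \<Phi> z / ?d ^ Suc (Suc j)"
        proof -
          have "(x * (d * q) - \<alpha> * - (n * q * p)) / ((d * q) * (d * q)) = x / (d * q) + n * \<alpha> * p / (d * (d * q))"
            if "d \<noteq> 0" "q \<noteq> 0" for x d q \<alpha> n p :: complex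
            using that by (simp add: field_simps)
          from this[of ?d "?d ^ j"] show ?thesis using ne by simp
        qed
      qed
    qed
    have "(deriv ^^ Suc k) (\<lambda>z. deriv \<Phi> z / (\<zeta> - \<Phi> z)) z = deriv ((deriv ^^ k) (\<lambda>z. deriv \<Phi> z / (\<zeta> - \<Phi> z))) z" by simp
    also have "\<dots> = deriv (\<lambda>u. \<Sum>j\<le>k. A j u / (\<zeta> - \<Phi> u) ^ Suc j) z"
      by (rule deriv_cong_ev[OF ev refl])
    also have "\<dots> = (\<Sum>j\<le>k. deriv (A j) z / (\<zeta> - \<Phi> z) ^ Suc j + of_nat (Suc j) * A j z * deriv \<Phi> z / (\<zeta> - \<Phi> z) ^ Suc (Suc j))"
      by (intro DERIV_imp_deriv DERIV_sum d1)
    also have "\<dots> = (\<Sum>j\<le>k. deriv (A j) z / (\<zeta> - \<Phi> z) ^ Suc j) + (\<Sum>j\<le>k. of_nat (Suc j) * A j z * deriv \<Phi> z / (\<zeta> - \<Phi> z) ^ Suc (Suc j))"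
      by (rule sum.distrib)
    also have "(\<Sum>j\<le>k. deriv (A j) z / (\<zeta> - \<Phi> z) ^ Suc j) = (\<Sum>j\<le>Suc k. (if j \<le> k then deriv (A j) z else 0) / (\<zeta> - \<Phi> z) ^ Suc j)"
      by simp
    also have "(\<Sum>j\<le>k. of_nat (Suc j) * A j z * deriv \<Phi> z / (\<zeta> - \<Phi> z) ^ Suc (Suc j)) =
       (\<Sum>j\<le>Suc k. (if j = 0 then 0 else of_nat j * A (j - 1) z * deriv \<Phi> z) / (\<zeta> - \<Phi> z) ^ Suc j)"
      by (subst sum.atMost_Suc_shift) simp
    also have "(\<Sum>j\<le>Suc k. (if j \<le> k then deriv (A j) z else 0) / (\<zeta> - \<Phi> z) ^ Suc j) + \<dots> = (\<Sum>j\<le>Suc k. A' j z / (\<zeta> - \<Phi> z) ^ Suc j)"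
      unfolding sum.distrib[symmetric] A'_def add_divide_distrib ..
    finally show ?thesis .
  qed
  show ?case using hol' eq by (intro exI[of _ A']) blast
qed

locale quadrature_map =
  fixes \<Omega> D :: "complex set" and \<Phi> \<Psi> :: "complex \<Rightarrow> complex"
  assumes open_\<Omega>: "open \<Omega>" and openD: "open D" and boundedD: "bounded D"
    and hol_\<Phi>: "\<Phi> holomorphic_on \<Omega>" and hol\<Psi>: "\<Psi> holomorphic_on D" and img_\<Phi>: "\<Phi> ` \<Omega> = D"
    and \<Psi>_\<Phi>: "\<And>z. z \<in> \<Omega> \<Longrightarrow> \<Psi> (\<Phi> z) = z" and \<Phi>_\<Psi>: "\<And>w. w \<in> D \<Longrightarrow> \<Phi> (\<Psi> w) = w"
    and lmeasurable: "\<Omega> \<in> lmeasurable"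
begin

lemma img_\<Psi>: "\<Psi> ` D = \<Omega>"
  using \<Psi>_\<Phi> img_\<Phi> by force

lemma inj_\<Psi>: "inj_on \<Psi> D"
  using \<Phi>_\<Psi> by (metis inj_onI)

lemma deriv_inverse: "w \<in> D \<Longrightarrow> deriv \<Phi> (\<Psi> w) * deriv \<Psi> w = 1"
proof -
  assume w: "w \<in> D"
  have "(\<Psi> has_field_derivative deriv \<Psi> w) (at w)" using holomorphic_derivI[OF hol\<Psi> openD w] .
  moreover have "(\<Phi> has_field_derivative deriv \<Phi> (\<Psi> w)) (at (\<Psi> w))"
    using holomorphic_derivI[OF hol_\<Phi> open_\<Omega>] w img_\<Psi> by blast
  ultimately have "((\<Phi> \<circ> \<Psi>) has_field_derivative deriv \<Phi> (\<Psi> w) * deriv \<Psi> w) (at w)"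
    by (rule DERIV_chain[rotated])
  then have "((\<lambda>w. w) has_field_derivative deriv \<Phi> (\<Psi> w) * deriv \<Psi> w) (at w)"
    by (rule has_field_derivative_transform_within_open[OF _ openD w]) (simp add: \<Phi>_\<Psi>)
  then show ?thesis using DERIV_ident DERIV_unique by blast
qed

lemma meas_\<Omega>: "continuous_on \<Omega> F \<Longrightarrow> set_borel_measurable borel (\<Psi> ` D) (F :: complex \<Rightarrow> complex)"
  unfolding img_\<Psi> set_borel_measurable_def using open_\<Omega> by (intro borel_measurable_continuous_on_indicator) auto

lemmas cov = holomorphic_change_of_variables[OF openD hol\<Psi> inj_\<Psi> meas_\<Omega>, unfolded img_\<Psi>]

text \<open>By the change of variables the integral of \<open>|\<Psi>'|^2\<close> over
  \<open>D\<close> is the area of \<open>\<Omega>\<close>.\<close>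

sublocale square_integrable_primitive D \<Psi>
proof
  have "emeasure lborel \<Omega> < \<infinity>"
    using lmeasurable open_\<Omega> by (auto simp: fmeasurable_def)
  then have "set_integrable lborel \<Omega> (\<lambda>_. 1 :: real)"
    using open_\<Omega> by (simp add: set_integrable_def integrable_real_indicator)
  then have "set_integrable lborel \<Omega> (\<lambda>_. complex_of_real 1)" by (simp only: set_integrable_of_real_iff)
  then have "set_integrable lborel D (\<lambda>w. (cmod (deriv \<Psi> w))\<^sup>2 *\<^sub>R complex_of_real 1)"
    using cov(1)[of "\<lambda>_. complex_of_real 1"] by simp
  then have "set_integrable lborel D (\<lambda>w. complex_of_real ((cmod (deriv \<Psi> w))\<^sup>2))"
    by (simp add: scaleR_conv_of_real)
  then show "set_integrable lborel D (\<lambda>w. (cmod (deriv \<Psi> w))\<^sup>2)" by (simp only: set_integrable_of_real_iff)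
qed (use openD boundedD hol\<Psi> in auto)

text \<open>At \<open>\<Psi> w\<close> the test function equals
  \<open>1 / ((\<zeta> - w) * \<Psi>' w)\<close>. One factor \<open>\<Psi>'\<close> of the Jacobian
  is absorbed and its conjugate survives; for the squared modulus the whole Jacobian is absorbed,
  and \<open>1 / |\<zeta> - w|^2\<close> is bounded on \<open>D\<close>.\<close>

lemma exterior_kernel:
  assumes \<zeta>: "\<zeta> \<notin> closure D"
  defines "F \<equiv> \<lambda>z. deriv \<Phi> z / (\<zeta> - \<Phi> z)"
  shows "F holomorphic_on \<Omega>" "(\<lambda>z. (cmod (F z))\<^sup>2) integrable_on \<Omega>" "integral \<Omega> F = CT \<zeta>"
proof -
  have ne: "\<zeta> - \<Phi> z \<noteq> 0" if "z \<in> \<Omega>" for z using that \<zeta> img_\<Phi> closure_subset[of D] by auto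
  show hol: "F holomorphic_on \<Omega>"
    unfolding F_def using hol_\<Phi> open_\<Omega> ne by (intro holomorphic_intros) auto
  then have cont: "continuous_on \<Omega> F" by (rule holomorphic_on_imp_continuous_on)
  obtain r where r: "r > 0" "ball \<zeta> r \<subseteq> - closure D"
    using \<zeta> by (meson ComplI closed_closure open_Compl open_contains_ball)
  have rD: "r \<le> cmod (\<zeta> - w)" if "w \<in> D" for w
    using that r(2) closure_subset[of D] by (force simp: dist_norm)
  have pull: "(cmod (deriv \<Psi> w))\<^sup>2 *\<^sub>R F (\<Psi> w) = cnj (deriv \<Psi> w) / (\<zeta> - w)" if "w \<in> D" for w
  proof -
    have "F (\<Psi> w) * deriv \<Psi> w = 1 / (\<zeta> - w)"
      using deriv_inverse[OF that] \<Phi>_\<Psi>[OF that] by (simp add: F_def)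
    moreover have "complex_of_real ((cmod (deriv \<Psi> w))\<^sup>2) = deriv \<Psi> w * cnj (deriv \<Psi> w)"
      by (rule complex_norm_square)
    moreover have "deriv \<Psi> w * cnj (deriv \<Psi> w) * F (\<Psi> w) = (F (\<Psi> w) * deriv \<Psi> w) * cnj (deriv \<Psi> w)"
      by (simp add: mult_ac)
    ultimately show ?thesis by (simp add: scaleR_conv_of_real)
  qed
  have eq: "set_integrable lborel D (\<lambda>w. (cmod (deriv \<Psi> w))\<^sup>2 *\<^sub>R F (\<Psi> w)) \<longleftrightarrow>
      set_integrable lborel D (\<lambda>w. cnj (deriv \<Psi> w) / (\<zeta> - w))"
    by (intro set_integrable_cong refl pull)
  have Fint: "set_integrable lborel \<Omega> F"
    using cov(1)[OF cont] eq CT_integrable_outside[OF \<zeta>] by simp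
  have "integral \<Omega> F = (LINT z:\<Omega>|lborel. F z)" by (rule set_borel_integral_eq_integral(2)[OF Fint, symmetric])
  also have "\<dots> = (LINT w:D|lborel. (cmod (deriv \<Psi> w))\<^sup>2 *\<^sub>R F (\<Psi> w))" using cov(2)[OF cont Fint] by simp
  also have "\<dots> = CT \<zeta>" unfolding cauchy_transform_def by (intro set_lebesgue_integral_cong) (use pull in auto)
  finally show "integral \<Omega> F = CT \<zeta>" .
  have c2: "continuous_on \<Omega> (\<lambda>z. complex_of_real ((cmod (F z))\<^sup>2))" by (intro continuous_intros cont)
  have "set_integrable lborel D (\<lambda>w. (1 :: complex) * complex_of_real ((cmod (1 / (\<zeta> - w)))\<^sup>2))"
  proof (rule set_integrable_times_bounded)
    have "set_integrable lborel D (\<lambda>_. 1 :: real)"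
      using openD emeasure_bounded_finite[OF boundedD] by (simp add: set_integrable_def integrable_real_indicator)
    then have "set_integrable lborel D (\<lambda>_. complex_of_real 1)" by (simp only: set_integrable_of_real_iff)
    then show "set_integrable lborel D (\<lambda>_. 1 :: complex)" by simp
    show "(\<lambda>w. complex_of_real ((cmod (1 / (\<zeta> - w)))\<^sup>2)) \<in> borel_measurable borel"
      using borel_measurable_cauchy_kernel[of \<zeta>] by measurable
    show "cmod (complex_of_real ((cmod (1 / (\<zeta> - w)))\<^sup>2)) \<le> (1 / r)\<^sup>2" if "w \<in> D" for w
    proof -
      have "cmod (1 / (\<zeta> - w)) \<le> 1 / r" using rD[OF that] r(1) by (simp add: norm_divide frac_le)
      then show ?thesis by (simp only: norm_of_real abs_power2) (intro power_mono, auto)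
    qed
  qed
  moreover have "(cmod (deriv \<Psi> w))\<^sup>2 *\<^sub>R complex_of_real ((cmod (F (\<Psi> w)))\<^sup>2) = 1 * complex_of_real ((cmod (1 / (\<zeta> - w)))\<^sup>2)" if "w \<in> D" for w
  proof -
    have "F (\<Psi> w) * deriv \<Psi> w = 1 / (\<zeta> - w)"
      using deriv_inverse[OF that] \<Phi>_\<Psi>[OF that] by (simp add: F_def)
    then have "cmod (F (\<Psi> w)) * cmod (deriv \<Psi> w) = cmod (1 / (\<zeta> - w))" by (metis norm_mult)
    then have "(cmod (deriv \<Psi> w))\<^sup>2 * (cmod (F (\<Psi> w)))\<^sup>2 = (cmod (1 / (\<zeta> - w)))\<^sup>2"
      by (metis mult.commute power_mult_distrib)
    then show ?thesis by (simp only: scaleR_conv_of_real of_real_mult[symmetric]) simp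
  qed
  ultimately have "set_integrable lborel D (\<lambda>w. (cmod (deriv \<Psi> w))\<^sup>2 *\<^sub>R complex_of_real ((cmod (F (\<Psi> w)))\<^sup>2))"
    by (subst set_integrable_cong[OF refl refl]) auto
  then have "set_integrable lborel \<Omega> (\<lambda>z. complex_of_real ((cmod (F z))\<^sup>2))" using cov(1)[OF c2] by simp
  then have "set_integrable lborel \<Omega> (\<lambda>z. (cmod (F z))\<^sup>2)" by (simp only: set_integrable_of_real_iff)
  then show "(\<lambda>z. (cmod (F z))\<^sup>2) integrable_on \<Omega>" by (rule set_borel_integral_eq_integral(1))
qed

text \<open>The quadrature identity is used for test functions depending on the parameter
  \<open>\<zeta>\<close>. Its right-hand side is defined for all \<open>\<zeta>\<close> off the
  images of the nodes and so continues the exterior transform into \<open>D\<close>.\<close>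

lemma CT_exterior_rational:
  assumes quad: "quadrature_domain \<Omega>"
  obtains R P where "finite P" "P \<subseteq> D" "R meromorphic_on UNIV" "R holomorphic_on - P"
    "\<And>\<zeta>. \<zeta> \<notin> closure D \<Longrightarrow> CT \<zeta> = R \<zeta>"
proof -
  obtain W N c where W: "finite W" "W \<subseteq> \<Omega>"
    and q: "\<And>f. f holomorphic_on \<Omega> \<Longrightarrow> (\<lambda>z. (norm (f z))^2) integrable_on \<Omega> \<Longrightarrow>
             integral \<Omega> f = (\<Sum>w\<in>W. \<Sum>k\<le>N w. c w k * (deriv ^^ k) f w)"
    using quad unfolding quadrature_domain_def by blast
  obtain A where A: "\<And>k \<zeta> z. z \<in> \<Omega> \<Longrightarrow> \<Phi> z \<noteq> \<zeta> \<Longrightarrow>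
      (deriv ^^ k) (\<lambda>z. deriv \<Phi> z / (\<zeta> - \<Phi> z)) z = (\<Sum>j\<le>k. A k j z / (\<zeta> - \<Phi> z) ^ Suc j)"
    using higher_deriv_kernel_pullback[OF open_\<Omega> hol_\<Phi>] by metis
  define R where "R \<zeta> = (\<Sum>w\<in>W. \<Sum>k\<le>N w. c w k * (\<Sum>j\<le>k. A k j w / (\<zeta> - \<Phi> w) ^ Suc j))" for \<zeta>
  show thesis
  proof (rule that[of "\<Phi> ` W" R])
    show "\<Phi> ` W \<subseteq> D" using W img_\<Phi> by auto
    show "R meromorphic_on UNIV" unfolding R_def by (intro meromorphic_intros)
    show "R holomorphic_on - \<Phi> ` W" unfolding R_def by (intro holomorphic_intros) auto
    fix \<zeta> assume \<zeta>: "\<zeta> \<notin> closure D"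
    have ne: "\<Phi> w \<noteq> \<zeta>" if "w \<in> W" for w using that \<zeta> W img_\<Phi> closure_subset[of D] by auto
    have "CT \<zeta> = integral \<Omega> (\<lambda>z. deriv \<Phi> z / (\<zeta> - \<Phi> z))" using exterior_kernel(3)[OF \<zeta>] by simp
    also have "\<dots> = (\<Sum>w\<in>W. \<Sum>k\<le>N w. c w k * (deriv ^^ k) (\<lambda>z. deriv \<Phi> z / (\<zeta> - \<Phi> z)) w)"
      by (rule q[OF exterior_kernel(1,2)[OF \<zeta>]])
    also have "\<dots> = R \<zeta>" unfolding R_def
      using W ne by (intro sum.cong refl) (subst A, auto)
    finally show "CT \<zeta> = R \<zeta>" .
  qed (use W in auto)
qed

text \<open>\<open>S\<close> is the Schwarz function transported to \<open>D\<close>: it is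
  meromorphic and agrees with \<open>cnj \<Psi>\<close> asymptotically at the boundary. The glued
  function is holomorphic with exact equalities, since \<open>\<Psi>\<close> has no poles and those
  of \<open>S\<close> are avoided by shrinking the chart.\<close>

proposition schwarz_function:
  assumes quad: "quadrature_domain \<Omega>"
  obtains S where "S meromorphic_on D"
    "\<And>\<gamma> t e \<sigma> a. side_chart D \<gamma> t e \<sigma> a \<Longrightarrow>
       \<exists>e' M. 0 < e' \<and> e' \<le> e \<and> M holomorphic_on ball (of_real t) e' \<and>
         (\<forall>s\<in>ball (of_real t) e'. \<gamma> s \<in> D \<longrightarrow> M s = \<Psi> (\<gamma> s)) \<and>
         (\<forall>s\<in>ball (of_real t) e'. \<gamma> (cnj s) \<in> D \<longrightarrow> M s = cnj (S (\<gamma> (cnj s))))"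
proof -
  obtain R P where P: "finite P" "P \<subseteq> D" and R: "R meromorphic_on UNIV" "R holomorphic_on - P"
    "\<And>\<zeta>. \<zeta> \<notin> closure D \<Longrightarrow> CT \<zeta> = R \<zeta>"
    using CT_exterior_rational[OF quad] by metis
  \<comment> \<open>The bracket is the holomorphic part of the transform, so the only poles are
    those of \<open>R\<close>; the difference from \<open>cnj \<Psi>\<close> is a multiple of
    \<open>CT - R\<close>, which is 0 outside.\<close>
  define S where "S \<zeta> = (R \<zeta> - (CT \<zeta> - pi * cnj (\<Psi> \<zeta>))) / pi" for \<zeta>
  have jump: "cnj (\<Psi> \<zeta>) - S \<zeta> = (CT \<zeta> - R \<zeta>) / pi" for \<zeta>
    by (simp add: S_def field_simps)
  show thesis
  proof (rule that[of S])
    have "(\<lambda>\<zeta>. CT \<zeta> - pi * cnj (\<Psi> \<zeta>)) meromorphic_on D"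
      using CT_minus_cnj_holomorphic openD by (intro analytic_on_imp_meromorphic_on) (simp add: analytic_on_open)
    then show "S meromorphic_on D"
      unfolding S_def using meromorphic_on_subset[OF R(1)]
      by (intro meromorphic_on_divide meromorphic_on_diff[of R] meromorphic_on_const) auto
  next
    fix \<gamma> t e \<sigma> a assume c0: "side_chart D \<gamma> t e \<sigma> a"
    let ?B = "\<lambda>e. ball (complex_of_real t) e"
    have c0': "e > 0" "\<gamma> holomorphic_on ?B e" "\<gamma> (of_real t) \<notin> P"
      using c0 P(2) by (auto simp: side_chart_def)
    have "isCont \<gamma> (of_real t)"
      using c0' by (intro continuous_on_interior[OF holomorphic_on_imp_continuous_on]) auto
    then have "\<forall>\<^sub>F s in nhds (of_real t). \<gamma> s \<in> - P"
      using P(1) c0'(3) by (intro topological_tendstoD) (auto simp: isCont_def tendsto_nhds_iff open_Compl finite_imp_closed)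
    then obtain e0 where e0: "e0 > 0" "\<And>s. s \<in> ?B e0 \<Longrightarrow> \<gamma> s \<notin> P"
      unfolding eventually_nhds_metric by (auto simp: dist_commute)
    define e1 where "e1 = min e e0"
    have e1: "e1 > 0" "e1 \<le> e" "e1 \<le> e0" using e0 c0' by (auto simp: e1_def)
    have c: "side_chart D \<gamma> t e1 \<sigma> a" by (rule side_chart_subset[OF c0 e1(1,2)])
    have \<sigma>: "\<sigma> = 1 \<or> \<sigma> = -1" and \<gamma>: "\<gamma> holomorphic_on ?B e1" using c by (auto simp: side_chart_def)
    have inD: "\<gamma> s \<in> D \<longleftrightarrow> \<sigma> * Im s > 0" "\<gamma> s \<in> closure D \<longleftrightarrow> \<sigma> * Im s \<ge> 0" if "s \<in> ?B e1" for s
      using c that by (auto simp: side_chart_def)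
    let ?U = "?B e1 \<inter> {s. \<sigma> * Im s > 0}"
    have \<gamma>U: "\<gamma> holomorphic_on ?U" "\<gamma> ` ?U \<subseteq> D - P"
      using \<gamma> inD e0(2) e1 by (auto intro: holomorphic_on_subset)
    obtain M e' where M: "0 < e'" "e' \<le> e1" "M holomorphic_on ?B e'"
      "\<And>s. s \<in> ?B e' \<Longrightarrow> \<sigma> * Im s > 0 \<Longrightarrow> M s = \<Psi> (\<gamma> s)"
      "\<And>s. s \<in> ?B e' \<Longrightarrow> \<sigma> * Im s < 0 \<Longrightarrow> M s = cnj (S (\<gamma> (cnj s)))"
    proof (rule conjugate_gluing[OF e1(1) \<sigma>, of "\<lambda>s. \<Psi> (\<gamma> s)" t "\<lambda>s. S (\<gamma> s)"])
      show "(\<lambda>s. \<Psi> (\<gamma> s)) holomorphic_on ?U"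
        using holomorphic_on_compose_gen[OF \<gamma>U(1) hol\<Psi>] \<gamma>U(2) by (auto simp: o_def)
      have "S holomorphic_on D - P"
        unfolding S_def
        by (intro holomorphic_on_divide holomorphic_on_diff[of R] holomorphic_on_const
            holomorphic_on_subset[OF R(2)] holomorphic_on_subset[OF CT_minus_cnj_holomorphic]) auto
      from holomorphic_on_compose_gen[OF \<gamma>U(1) this \<gamma>U(2)]
      show "(\<lambda>s. S (\<gamma> s)) holomorphic_on ?U" by (simp add: o_def)
      fix x :: real assume x: "\<bar>x - t\<bar> < e1"
      let ?F = "at (complex_of_real x) within ?U" and ?z = "\<gamma> (of_real x)"
      have xB: "complex_of_real x \<in> ?B e1" using x by (simp add: dist_real_def abs_minus_commute)
      have "isCont \<gamma> (of_real x)" using xB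
        by (intro continuous_on_interior[OF holomorphic_on_imp_continuous_on[OF \<gamma>]]) auto
      then have t1: "(\<gamma> \<longlongrightarrow> ?z) ?F" unfolding isCont_def by (rule tendsto_within_subset) simp
      have "(cnj \<longlongrightarrow> cnj (of_real x)) ?F" by (intro tendsto_cnj tendsto_ident_at)
      then have "(cnj \<longlongrightarrow> of_real x) ?F" by simp
      from isCont_tendsto_compose[OF \<open>isCont \<gamma> (of_real x)\<close> this]
      have t2: "((\<lambda>s. \<gamma> (cnj s)) \<longlongrightarrow> ?z) ?F" .
      have "?z \<notin> P" using e0(2) xB e1 by auto
      then have "isCont R ?z"
        using R(2) P(1) by (intro continuous_on_interior[OF holomorphic_on_imp_continuous_on[OF R(2)]])
          (simp add: interior_open open_Compl finite_imp_closed)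
      then have "((\<lambda>s. R (\<gamma> (cnj s)) - R (\<gamma> s)) \<longlongrightarrow> R ?z - R ?z) ?F"
        using t1 t2 by (intro tendsto_diff isCont_tendsto_compose[of ?z R])
      from tendsto_add[OF CT_jump_tendsto_0[OF c x] this]
      have "((\<lambda>s. CT (\<gamma> s) - CT (\<gamma> (cnj s)) + (R (\<gamma> (cnj s)) - R (\<gamma> s))) \<longlongrightarrow> 0) ?F" by simp
      \<comment> \<open>At the exterior mirror point \<open>CT\<close> and \<open>R\<close>
        coincide, so the jump of \<open>CT\<close> plus the small change of the continuous function
        \<open>R\<close> is \<open>CT - R\<close> at the interior point.\<close>
      moreover have "\<forall>\<^sub>F s in ?F. CT (\<gamma> s) - CT (\<gamma> (cnj s)) + (R (\<gamma> (cnj s)) - R (\<gamma> s)) = CT (\<gamma> s) - R (\<gamma> s)"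
        unfolding eventually_at_filter
      proof (intro always_eventually allI impI)
        fix s assume s: "s \<in> ?U"
        have "\<gamma> (cnj s) \<notin> closure D" using inD(2)[OF cnj_in_ball_of_real[of s t e1]] s by auto
        then show "CT (\<gamma> s) - CT (\<gamma> (cnj s)) + (R (\<gamma> (cnj s)) - R (\<gamma> s)) = CT (\<gamma> s) - R (\<gamma> s)"
          using R(3) by simp
      qed
      ultimately have "((\<lambda>s. CT (\<gamma> s) - R (\<gamma> s)) \<longlongrightarrow> 0) ?F" by (rule Lim_transform_eventually)
      from tendsto_cnj[OF tendsto_divide[OF this tendsto_const[of "complex_of_real pi"]]]
      have "((\<lambda>s. cnj ((CT (\<gamma> s) - R (\<gamma> s)) / pi)) \<longlongrightarrow> 0) ?F"
        by (simp only: div_0 complex_cnj_zero of_real_eq_0_iff pi_neq_zero not_False_eq_True)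
      moreover have "cnj ((CT (\<gamma> s) - R (\<gamma> s)) / pi) = \<Psi> (\<gamma> s) - cnj (S (\<gamma> s))" for s
        unfolding jump[symmetric] by simp
      ultimately show "((\<lambda>s. \<Psi> (\<gamma> s) - cnj (S (\<gamma> s))) \<longlongrightarrow> 0) ?F" by simp
    qed blast
    show "\<exists>e' M. 0 < e' \<and> e' \<le> e \<and> M holomorphic_on ?B e' \<and>
         (\<forall>s\<in>?B e'. \<gamma> s \<in> D \<longrightarrow> M s = \<Psi> (\<gamma> s)) \<and> (\<forall>s\<in>?B e'. \<gamma> (cnj s) \<in> D \<longrightarrow> M s = cnj (S (\<gamma> (cnj s))))"
    proof (intro exI[of _ e'] exI[of _ M] conjI ballI impI)
      fix s assume s: "s \<in> ?B e'"
      have sB: "s \<in> ?B e1" "cnj s \<in> ?B e1" using s M(2) cnj_in_ball_of_real[of s t e1] by auto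
      show "M s = \<Psi> (\<gamma> s)" if "\<gamma> s \<in> D" using M(4)[OF s] inD(1)[OF sB(1)] that by simp
      show "M s = cnj (S (\<gamma> (cnj s)))" if "\<gamma> (cnj s) \<in> D" using M(5)[OF s] inD(1)[OF sB(2)] that by simp
    qed (use M e1 in auto)
  qed
qed

end

section \<open>Derivatives of functions on the double\<close>

lemma meromorphic_on_eventually_analytic:
  assumes "f meromorphic_on A" "z \<in> A" shows "\<forall>\<^sub>F x in at z. f analytic_on {x}"
proof -
  have "isolated_singularity_at f z" using assms by (meson meromorphic_on_altdef)
  then obtain r where r: "r > 0" "f analytic_on ball z r - {z}" by (auto simp: isolated_singularity_at_def)
  have "\<forall>\<^sub>F x in at z. x \<in> ball z r - {z}" using r by (intro eventually_at_in_open) auto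
  then show ?thesis by eventually_elim (use r(2) in \<open>auto intro: analytic_on_subset\<close>)
qed

text \<open>Punctured neighbourhoods are open, so an equality valid near \<open>s\<close> off
  \<open>s\<close> holds in a full neighbourhood of each point close to \<open>s\<close> and may be
  differentiated there.\<close>

lemma eventually_at_nhds:
  fixes s :: "'a::t1_space"
  assumes "\<forall>\<^sub>F x in at s. P x" shows "\<forall>\<^sub>F x in at s. \<forall>\<^sub>F y in nhds x. P y"
proof -
  obtain U where U: "open U" "s \<in> U" "\<And>x. x \<in> U \<Longrightarrow> x \<noteq> s \<Longrightarrow> P x"
    using assms unfolding eventually_at_topological by blast
  have "\<forall>\<^sub>F x in at s. x \<in> U - {s}" using U by (intro eventually_at_in_open)
  then show ?thesis
  proof eventually_elim
    case (elim x)
    have "open (U - {s})" using U(1) by (intro open_Diff) auto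
    from eventually_nhds_in_open[OF this elim] show ?case by eventually_elim (use U(3) in auto)
  qed
qed

text \<open>Injectivity keeps the values different from the limit, which is what is needed to
  transport statements about punctured neighbourhoods.\<close>

lemma filterlim_at_injective:
  assumes "f holomorphic_on A" "open A" "inj_on f A" "z \<in> A"
  shows "filterlim f (at (f z)) (at z)"
  unfolding filterlim_at
proof
  show "(f \<longlongrightarrow> f z) (at z)"
    using assms by (metis continuous_on_eq_continuous_at holomorphic_on_imp_continuous_on isContD)
  have "\<forall>\<^sub>F x in at z. x \<in> A - {z}" using assms by (intro eventually_at_in_open)
  then show "\<forall>\<^sub>F x in at z. f x \<in> UNIV \<and> f x \<noteq> f z"
    by eventually_elim (use assms in \<open>auto simp: inj_on_def\<close>)
qed

lemma analytic_at_imp_DERIV: "f analytic_on {z} \<Longrightarrow> (f has_field_derivative deriv f z) (at z)"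
  by (simp add: DERIV_deriv_iff_field_differentiable analytic_on_imp_differentiable_at)

lemma DERIV_cnj_cnj:
  "(f has_field_derivative f') (at (cnj x)) \<Longrightarrow> ((\<lambda>y. cnj (f (cnj y))) has_field_derivative cnj f') (at x)"
  using has_field_derivative_cnj_cnj[of f f' x] by (simp add: o_def)

context quadrature_map
begin

text \<open>In a chart the coordinate \<open>z\<close> and \<open>H\<close> become \<open>Z\<close>
  and \<open>M\<close>, and \<open>deriv M / deriv Z\<close> represents \<open>dH / dz\<close>, the
  derivative of the chart cancelling. The same quotient on the reflected sheet is
  \<open>deriv g / deriv S\<close>.\<close>

lemma extends_to_double_of_deriv:
  assumes quad: "quadrature_domain \<Omega>" and D: "analytic_boundary_domain D m G"
    and H: "H meromorphic_on \<Omega>" and ext: "extends_to_double_of D m G (H \<circ> \<Psi>)"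
  shows "extends_to_double_of D m G (deriv H \<circ> \<Psi>)"
proof -
  obtain S where S: "S meromorphic_on D"
    "\<And>\<gamma> t e \<sigma> a. side_chart D \<gamma> t e \<sigma> a \<Longrightarrow>
       \<exists>e' M. 0 < e' \<and> e' \<le> e \<and> M holomorphic_on ball (of_real t) e' \<and>
         (\<forall>s\<in>ball (of_real t) e'. \<gamma> s \<in> D \<longrightarrow> M s = \<Psi> (\<gamma> s)) \<and>
         (\<forall>s\<in>ball (of_real t) e'. \<gamma> (cnj s) \<in> D \<longrightarrow> M s = cnj (S (\<gamma> (cnj s))))"
    using schwarz_function[OF quad] by metis
  obtain g where g: "g meromorphic_on D"
    "\<And>i t0::real. i < m \<Longrightarrow> \<exists>e>0. \<exists>M. M meromorphic_on ball (of_real t0) e \<and>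
            (\<forall>s\<in>ball (of_real t0) e. G i s \<in> D \<longrightarrow> (\<forall>\<^sub>F x in at s. M x = (H \<circ> \<Psi>) (G i x))) \<and>
            (\<forall>s\<in>ball (of_real t0) e. G i (cnj s) \<in> D \<longrightarrow> (\<forall>\<^sub>F x in at s. M x = cnj (g (G i (cnj x)))))"
    using ext unfolding extends_to_double_of_def by blast
  \<comment> \<open>Where \<open>deriv S\<close> is 0, this and the corresponding chart quotient
    both take the default value 0 of division, so they still agree.\<close>
  define g' where "g' w = deriv g w / deriv S w" for w
  have \<Psi>D: "\<Psi> w \<in> \<Omega>" if "w \<in> D" for w using that img_\<Psi> by blast
  have "\<Psi> analytic_on D" using hol\<Psi> openD by (simp add: analytic_on_open)
  then have "(\<lambda>w. deriv H (\<Psi> w)) meromorphic_on D"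
    using \<Psi>D by (intro meromorphic_on_compose[OF meromorphic_on_deriv[OF H]]) auto
  then have mer: "(deriv H \<circ> \<Psi>) meromorphic_on D" by (simp add: o_def)
  have merg': "g' meromorphic_on D" unfolding g'_def using g(1) S(1) by (intro meromorphic_intros)
  have "\<exists>e>0. \<exists>M. M meromorphic_on ball (of_real t) e \<and>
            (\<forall>s\<in>ball (of_real t) e. G i s \<in> D \<longrightarrow> (\<forall>\<^sub>F x in at s. M x = (deriv H \<circ> \<Psi>) (G i x))) \<and>
            (\<forall>s\<in>ball (of_real t) e. G i (cnj s) \<in> D \<longrightarrow> (\<forall>\<^sub>F x in at s. M x = cnj (g' (G i (cnj x)))))"
    if i: "i < m" for i and t :: real
  proof -
    let ?\<gamma> = "G i"
    obtain e1 M where M: "e1 > 0" "M meromorphic_on ball (of_real t) e1"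
      "\<And>s. s \<in> ball (of_real t) e1 \<Longrightarrow> ?\<gamma> s \<in> D \<Longrightarrow> \<forall>\<^sub>F x in at s. M x = (H \<circ> \<Psi>) (?\<gamma> x)"
      "\<And>s. s \<in> ball (of_real t) e1 \<Longrightarrow> ?\<gamma> (cnj s) \<in> D \<Longrightarrow> \<forall>\<^sub>F x in at s. M x = cnj (g (?\<gamma> (cnj x)))"
      using g(2)[OF i, of t] by metis
    obtain e2 \<sigma> a where c: "side_chart D ?\<gamma> t e2 \<sigma> a" using side_chart_exists[OF D i] .
    obtain e3 Z where Z: "0 < e3" "e3 \<le> e2" "Z holomorphic_on ball (of_real t) e3"
       "\<And>s. s \<in> ball (of_real t) e3 \<Longrightarrow> ?\<gamma> s \<in> D \<Longrightarrow> Z s = \<Psi> (?\<gamma> s)"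
       "\<And>s. s \<in> ball (of_real t) e3 \<Longrightarrow> ?\<gamma> (cnj s) \<in> D \<Longrightarrow> Z s = cnj (S (?\<gamma> (cnj s)))"
      using S(2)[OF c] by metis
    define e where "e = min e1 e3"
    let ?B = "ball (complex_of_real t) e"
    have e: "e > 0" "?B \<subseteq> ball (of_real t) e1" "?B \<subseteq> ball (of_real t) e3" "?B \<subseteq> ball (of_real t) e2"
      using M(1) Z(1,2) by (auto simp: e_def)
    have c': "side_chart D ?\<gamma> t e \<sigma> a" using side_chart_subset[OF c] e(1) Z(2) by (simp add: e_def)
    then have \<gamma>: "?\<gamma> holomorphic_on ?B" by (simp add: side_chart_def)
    have lim: "filterlim ?\<gamma> (at (?\<gamma> s)) (at s)" if "s \<in> ?B" for s
      by (rule filterlim_at_injective[OF \<gamma> open_ball side_chart_inj[OF c'] that])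
    have dne: "deriv ?\<gamma> s \<noteq> 0" if "s \<in> ?B" for s by (rule side_chart_deriv[OF c' that])
    have d\<gamma>: "(?\<gamma> has_field_derivative deriv ?\<gamma> s) (at s)" if "s \<in> ?B" for s
      by (rule holomorphic_derivI[OF \<gamma> open_ball that])
    have inD: "\<forall>\<^sub>F x in nhds s. x \<in> ?B \<and> ?\<gamma> x \<in> D" if s: "s \<in> ?B" "?\<gamma> s \<in> D" for s
    proof -
      have "open (?B \<inter> ?\<gamma> -` D)"
        using continuous_open_preimage[OF holomorphic_on_imp_continuous_on[OF \<gamma>] open_ball openD] .
      from eventually_nhds_in_open[OF this] s show ?thesis by simp
    qed
    have cB: "cnj s \<in> ?B" if "s \<in> ?B" for s using that by (rule cnj_in_ball_of_real)
    have cnjlim: "filterlim cnj (at (cnj s)) (at s)" for s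
      unfolding filterlim_at by (auto intro!: tendsto_intros simp: eventually_at_filter)
    define M' where "M' x = deriv M x / deriv Z x" for x
    have "Z analytic_on ?B" using Z(3) e(3) by (meson analytic_on_open holomorphic_on_subset open_ball)
    then have "M' meromorphic_on ?B"
      unfolding M'_def using meromorphic_on_subset[OF M(2) e(2)]
      by (intro meromorphic_on_divide meromorphic_on_deriv) (auto intro: analytic_on_imp_meromorphic_on)
    moreover have "\<forall>\<^sub>F x in at s. M' x = (deriv H \<circ> \<Psi>) (?\<gamma> x)" if s: "s \<in> ?B" "?\<gamma> s \<in> D" for s
    proof -
      have 1: "\<forall>\<^sub>F x in at s. \<forall>\<^sub>F y in nhds x. M y = H (\<Psi> (?\<gamma> y))"
        using eventually_at_nhds[OF M(3)[of s]] s e by auto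
      have 2: "\<forall>\<^sub>F x in at s. \<forall>\<^sub>F y in nhds x. y \<in> ?B \<and> ?\<gamma> y \<in> D"
        using inD[OF s] by (intro eventually_at_nhds) (simp add: eventually_nhds_conv_at)
      have "filterlim \<Psi> (at (\<Psi> (?\<gamma> s))) (at (?\<gamma> s))"
        by (rule filterlim_at_injective[OF hol\<Psi> openD inj_\<Psi> s(2)])
      from filterlim_compose[OF this lim[OF s(1)]]
      have "filterlim (\<lambda>x. \<Psi> (?\<gamma> x)) (at (\<Psi> (?\<gamma> s))) (at s)" .
      from eventually_compose_filterlim[OF meromorphic_on_eventually_analytic[OF H \<Psi>D[OF s(2)]] this]
      have 3: "\<forall>\<^sub>F x in at s. H analytic_on {\<Psi> (?\<gamma> x)}" .
      show ?thesis using 1 2 3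
      proof eventually_elim
        case (elim x)
        have x: "x \<in> ?B" "?\<gamma> x \<in> D" using eventually_nhds_x_imp_x[OF elim(2)] by auto
        have d\<Psi>: "(\<Psi> has_field_derivative deriv \<Psi> (?\<gamma> x)) (at (?\<gamma> x))" by (rule holomorphic_derivI[OF hol\<Psi> openD x(2)])
        have dZ: "((\<lambda>y. \<Psi> (?\<gamma> y)) has_field_derivative deriv \<Psi> (?\<gamma> x) * deriv ?\<gamma> x) (at x)"
          by (rule DERIV_chain2[OF d\<Psi> d\<gamma>[OF x(1)]])
        have dM: "((\<lambda>y. H (\<Psi> (?\<gamma> y))) has_field_derivative deriv H (\<Psi> (?\<gamma> x)) * (deriv \<Psi> (?\<gamma> x) * deriv ?\<gamma> x)) (at x)"
          by (rule DERIV_chain2[OF analytic_at_imp_DERIV[OF elim(3)] dZ])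
        have "\<forall>\<^sub>F y in nhds x. Z y = \<Psi> (?\<gamma> y)"
          using elim(2) by eventually_elim (use Z(4) e(3) in auto)
        from deriv_cong_ev[OF this refl] have "deriv Z x = deriv \<Psi> (?\<gamma> x) * deriv ?\<gamma> x"
          using DERIV_imp_deriv[OF dZ] by simp
        moreover have "deriv M x = deriv H (\<Psi> (?\<gamma> x)) * (deriv \<Psi> (?\<gamma> x) * deriv ?\<gamma> x)"
          using deriv_cong_ev[OF elim(1) refl] DERIV_imp_deriv[OF dM] by simp
        moreover have "deriv \<Psi> (?\<gamma> x) \<noteq> 0" using deriv_inverse[OF x(2)] by auto
        ultimately show ?case using dne[OF x(1)] by (simp add: M'_def)
      qed
    qed
    moreover have "\<forall>\<^sub>F x in at s. M' x = cnj (g' (?\<gamma> (cnj x)))" if s: "s \<in> ?B" "?\<gamma> (cnj s) \<in> D" for s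
    proof -
      have 1: "\<forall>\<^sub>F x in at s. \<forall>\<^sub>F y in nhds x. M y = cnj (g (?\<gamma> (cnj y)))"
        using eventually_at_nhds[OF M(4)[of s]] s e by auto
      have "\<forall>\<^sub>F y in nhds s. cnj y \<in> ?B \<and> ?\<gamma> (cnj y) \<in> D"
        using inD[OF cB[OF s(1)] s(2)]
        by (rule eventually_compose_filterlim) (auto intro!: tendsto_cnj filterlim_ident)
      then have 2: "\<forall>\<^sub>F x in at s. \<forall>\<^sub>F y in nhds x. cnj y \<in> ?B \<and> ?\<gamma> (cnj y) \<in> D"
        by (intro eventually_at_nhds) (simp add: eventually_nhds_conv_at)
      have l: "filterlim (\<lambda>x. ?\<gamma> (cnj x)) (at (?\<gamma> (cnj s))) (at s)"
        by (rule filterlim_compose[OF lim[OF cB[OF s(1)]] cnjlim])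
      have 3: "\<forall>\<^sub>F x in at s. g analytic_on {?\<gamma> (cnj x)}" "\<forall>\<^sub>F x in at s. S analytic_on {?\<gamma> (cnj x)}"
        by (rule eventually_compose_filterlim[OF meromorphic_on_eventually_analytic l], rule g(1) S(1), rule s(2))+
      show ?thesis using 1 2 3
      proof eventually_elim
        case (elim x)
        let ?y = "cnj x"
        have x: "?y \<in> ?B" "?\<gamma> ?y \<in> D" using eventually_nhds_x_imp_x[OF elim(2)] by auto
        have dM: "((\<lambda>y. cnj (g (?\<gamma> (cnj y)))) has_field_derivative cnj (deriv g (?\<gamma> ?y) * deriv ?\<gamma> ?y)) (at x)"
          by (rule DERIV_cnj_cnj[of "\<lambda>y. g (?\<gamma> y)"], rule DERIV_chain2[OF analytic_at_imp_DERIV[OF elim(3)] d\<gamma>[OF x(1)]])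
        have dZ: "((\<lambda>y. cnj (S (?\<gamma> (cnj y)))) has_field_derivative cnj (deriv S (?\<gamma> ?y) * deriv ?\<gamma> ?y)) (at x)"
          by (rule DERIV_cnj_cnj[of "\<lambda>y. S (?\<gamma> y)"], rule DERIV_chain2[OF analytic_at_imp_DERIV[OF elim(4)] d\<gamma>[OF x(1)]])
        have "\<forall>\<^sub>F y in nhds x. Z y = cnj (S (?\<gamma> (cnj y)))"
          using elim(2)
        proof eventually_elim
          case (elim y)
          then have "y \<in> ?B" using cB[of "cnj y"] by simp
          then show ?case using Z(5) e(3) elim by auto
        qed
        from deriv_cong_ev[OF this refl] have "deriv Z x = cnj (deriv S (?\<gamma> ?y) * deriv ?\<gamma> ?y)"
          using DERIV_imp_deriv[OF dZ] by simp
        moreover have "deriv M x = cnj (deriv g (?\<gamma> ?y) * deriv ?\<gamma> ?y)"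
          using deriv_cong_ev[OF elim(1) refl] DERIV_imp_deriv[OF dM] by simp
        ultimately show ?case using dne[OF x(1)] by (simp add: M'_def g'_def)
      qed
    qed
    ultimately show ?thesis using e(1) by blast
  qed
  then show ?thesis unfolding extends_to_double_of_def using mer merg' by blast
qed

end

section \<open>Linear conditions for removing poles\<close>

text \<open>Gaussian elimination: an equation with a nonzero coefficient at \<open>i0\<close>
  determines that unknown and is removed together with it.\<close>

lemma homogeneous_system_solution:
  fixes a :: "'j \<Rightarrow> 'i \<Rightarrow> 'a::field"
  assumes "finite J" "finite I" "card J < card I"
  shows "\<exists>c. (\<exists>i\<in>I. c i \<noteq> 0) \<and> (\<forall>j\<in>J. (\<Sum>i\<in>I. c i * a j i) = 0)"
  using assms
proof (induction J arbitrary: I a rule: finite_induct)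
  case empty
  then have "I \<noteq> {}" by auto
  then show ?case by (intro exI[of _ "\<lambda>_. 1"]) auto
next
  case (insert j J)
  show ?case
  proof (cases "\<forall>i\<in>I. a j i = 0")
    case True
    have "card J < card I" using insert.hyps insert.prems by simp
    from insert.IH[OF insert.prems(1) this, of a]
    obtain c where "\<exists>i\<in>I. c i \<noteq> 0" "\<forall>j\<in>J. (\<Sum>i\<in>I. c i * a j i) = 0" by blast
    then show ?thesis using True by (intro exI[of _ c]) auto
  next
    case False
    then obtain i0 where i0: "i0 \<in> I" "a j i0 \<noteq> 0" by blast
    define I' where "I' = I - {i0}"
    \<comment> \<open>Row \<open>k\<close> after its entry in column \<open>i0\<close> has been
      cleared with row \<open>j\<close>.\<close>
    define a' where "a' k i = a k i - a k i0 * a j i / a j i0" for k i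
    have "card J < card I'" using insert.hyps insert.prems i0 by (simp add: I'_def)
    from insert.IH[OF _ this, of a'] insert.prems
    obtain c where c: "\<exists>i\<in>I'. c i \<noteq> 0" "\<forall>k\<in>J. (\<Sum>i\<in>I'. c i * a' k i) = 0" by (auto simp: I'_def)
    define c' where "c' = c(i0 := - (\<Sum>i\<in>I'. c i * a j i) / a j i0)"
    have sum': "(\<Sum>i\<in>I. c' i * a k i) = (\<Sum>i\<in>I'. c i * a k i) - (\<Sum>i\<in>I'. c i * a j i) / a j i0 * a k i0" for k
    proof -
      have "(\<Sum>i\<in>I. c' i * a k i) = c' i0 * a k i0 + (\<Sum>i\<in>I'. c' i * a k i)"
        unfolding I'_def using insert.prems i0 by (subst sum.remove[of I i0]) auto
      also have "(\<Sum>i\<in>I'. c' i * a k i) = (\<Sum>i\<in>I'. c i * a k i)"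
        by (intro sum.cong) (auto simp: c'_def I'_def)
      finally show ?thesis by (simp add: c'_def)
    qed
    have "(\<Sum>i\<in>I. c' i * a j i) = 0" using i0 by (simp add: sum')
    moreover have "(\<Sum>i\<in>I. c' i * a k i) = 0" if "k \<in> J" for k
    proof -
      have "(\<Sum>i\<in>I'. c i * a' k i) = (\<Sum>i\<in>I'. c i * a k i) - (\<Sum>i\<in>I'. c i * a j i) / a j i0 * a k i0"
        unfolding a'_def by (simp add: right_diff_distrib sum_subtractf sum_distrib_left sum_divide_distrib mult_ac)
      then show ?thesis using c(2) that by (simp add: sum')
    qed
    moreover have "\<exists>i\<in>I. c' i \<noteq> 0" using c(1) by (auto simp: c'_def I'_def)
    ultimately show ?thesis by (intro exI[of _ c']) auto
  qed
qed

text \<open>The constant term is left out so that a constant value of a nontrivial combination still gives a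
  nontrivial polynomial relation.\<close>
definition exponents :: "nat \<Rightarrow> (nat \<times> nat) set" where
  "exponents k = {..k} \<times> {..k} - {(0, 0)}"

definition eval2 :: "nat \<Rightarrow> (nat \<times> nat \<Rightarrow> complex) \<Rightarrow> (complex \<Rightarrow> complex) \<Rightarrow> (complex \<Rightarrow> complex) \<Rightarrow> complex \<Rightarrow> complex" where
  "eval2 k c f g x = (\<Sum>p\<in>exponents k. c p * (f x ^ fst p * g x ^ snd p))"

text \<open>Only sufficiency of the linear conditions is recorded. \<open>A\<close> must not depend
  on \<open>k\<close>, so that for large \<open>k\<close> the \<open>k * A\<close> conditions are
  outnumbered by the unknowns.\<close>

definition codim_le :: "(nat \<Rightarrow> (nat \<times> nat \<Rightarrow> complex) \<Rightarrow> bool) \<Rightarrow> nat \<Rightarrow> bool" where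
  "codim_le Q A \<longleftrightarrow> (\<forall>k. \<exists>a :: nat \<Rightarrow> nat \<times> nat \<Rightarrow> complex. \<forall>c.
     (\<forall>r<k * A. (\<Sum>p\<in>exponents k. c p * a r p) = 0) \<longrightarrow> Q k c)"

lemma finite_exponents [simp]: "finite (exponents k)" by (simp add: exponents_def)

lemma card_exponents: "card (exponents k) = k * (k + 2)"
  unfolding exponents_def by (subst card_Diff_subset) (auto simp: algebra_simps)

lemma codim_le_nontrivial:
  assumes "codim_le Q A" obtains k c where "Q k c" "\<exists>p\<in>exponents k. c p \<noteq> 0"
proof -
  \<comment> \<open>Positive even for \<open>A = 0\<close>, and
    \<open>k * A < k * (k + 2)\<close>.\<close>
  define k where "k = A + 1"
  obtain a where a: "\<And>c. (\<forall>r<k * A. (\<Sum>p\<in>exponents k. c p * a r p) = 0) \<Longrightarrow> Q k c"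
    using assms unfolding codim_le_def by metis
  have "card {..<k * A} < card (exponents k)" by (simp add: card_exponents k_def)
  from homogeneous_system_solution[OF _ _ this, of a]
  obtain c where c: "\<exists>p\<in>exponents k. c p \<noteq> 0" "\<forall>r\<in>{..<k * A}. (\<Sum>p\<in>exponents k. c p * a r p) = 0" by auto
  show ?thesis by (rule that[of k c]) (use a c in auto)
qed

lemma codim_le_conj:
  assumes "codim_le Q A" "codim_le Q' B" shows "codim_le (\<lambda>k c. Q k c \<and> Q' k c) (A + B)"
  unfolding codim_le_def
proof
  fix k
  obtain a where a: "\<And>c. (\<forall>r<k * A. (\<Sum>p\<in>exponents k. c p * a r p) = 0) \<Longrightarrow> Q k c"
    using assms(1) unfolding codim_le_def by metis
  obtain b where b: "\<And>c. (\<forall>r<k * B. (\<Sum>p\<in>exponents k. c p * b r p) = 0) \<Longrightarrow> Q' k c"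
    using assms(2) unfolding codim_le_def by metis
  define d where "d r = (if r < k * A then a r else b (r - k * A))" for r
  have "Q k c \<and> Q' k c" if c: "\<forall>r<k * (A + B). (\<Sum>p\<in>exponents k. c p * d r p) = 0" for c
  proof
    show "Q k c" using c by (intro a) (auto simp: d_def algebra_simps split: if_splits)
    show "Q' k c"
    proof (rule b, intro allI impI)
      fix r assume "r < k * B"
      then show "(\<Sum>p\<in>exponents k. c p * b r p) = 0"
        using c[rule_format, of "k * A + r"] by (simp add: d_def algebra_simps)
    qed
  qed
  then show "\<exists>a. \<forall>c. (\<forall>r<k * (A + B). (\<Sum>p\<in>exponents k. c p * a r p) = 0) \<longrightarrow> Q k c \<and> Q' k c" by blast
qed

lemma codim_le_finite_Ball:
  assumes "finite X" "\<And>x. x \<in> X \<Longrightarrow> \<exists>A. codim_le (Q x) A"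
  shows "\<exists>A. codim_le (\<lambda>k c. \<forall>x\<in>X. Q x k c) A"
  using assms
proof (induction X rule: finite_induct)
  case empty
  show ?case by (auto simp: codim_le_def)
next
  case (insert x X)
  then obtain A B where "codim_le (Q x) A" "codim_le (\<lambda>k c. \<forall>x\<in>X. Q x k c) B" by blast
  from codim_le_conj[OF this] show ?case by auto
qed

text \<open>On the reflected sheet the polynomial appears with conjugated coefficients. Conjugating
  the equations makes them linear in \<open>c\<close> again.\<close>

lemma codim_le_cnj:
  assumes "codim_le Q A" shows "codim_le (\<lambda>k c. Q k (\<lambda>p. cnj (c p))) A"
  unfolding codim_le_def
proof
  fix k
  obtain a where a: "\<And>c. (\<forall>r<k * A. (\<Sum>p\<in>exponents k. c p * a r p) = 0) \<Longrightarrow> Q k c"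
    using assms unfolding codim_le_def by metis
  have "Q k (\<lambda>p. cnj (c p))" if "\<forall>r<k * A. (\<Sum>p\<in>exponents k. c p * cnj (a r p)) = 0" for c
  proof (rule a, intro allI impI)
    fix r assume "r < k * A"
    then have "cnj (\<Sum>p\<in>exponents k. c p * cnj (a r p)) = 0" using that by simp
    then show "(\<Sum>p\<in>exponents k. cnj (c p) * a r p) = 0" by simp
  qed
  then show "\<exists>a. \<forall>c. (\<forall>r<k * A. (\<Sum>p\<in>exponents k. c p * a r p) = 0) \<longrightarrow> Q k (\<lambda>p. cnj (c p))"
    by (intro exI[of _ "\<lambda>r p. cnj (a r p)"]) blast
qed

text \<open>The value of \<open>f\<close> at \<open>z\<close> itself is disregarded, in keeping with
  equalities of meromorphic functions that hold only off a discrete set.\<close>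

definition removable_at :: "(complex \<Rightarrow> complex) \<Rightarrow> complex \<Rightarrow> bool" where
  "removable_at f z \<longleftrightarrow> (\<exists>v. v analytic_on {z} \<and> (\<forall>\<^sub>F x in at z. f x = v x))"

lemma analytic_imp_removable: "f analytic_on {z} \<Longrightarrow> removable_at f z"
  by (auto simp: removable_at_def)

lemma removable_at_eval2:
  assumes "f analytic_on {z}" "g analytic_on {z}" shows "removable_at (eval2 k c f g) z"
  unfolding eval2_def using assms by (intro analytic_imp_removable analytic_intros)

lemma meromorphic_at_quotient:
  assumes "f meromorphic_on {z}"
  obtains N u \<rho> where "\<rho> > 0" "u holomorphic_on ball z \<rho>" "\<And>x. x \<in> ball z \<rho> - {z} \<Longrightarrow> f x = u x / (x - z) ^ N"
proof -
  obtain F where F: "(\<lambda>w. f (z + w)) has_laurent_expansion F"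
    using assms by (auto simp: meromorphic_on_def)
  then have rad: "fls_conv_radius F > 0" and ev: "\<forall>\<^sub>F w in at 0. eval_fls F w = f (z + w)"
    by (auto simp: has_laurent_expansion_def)
  obtain \<rho>1 where \<rho>1: "\<rho>1 > 0" "\<And>w. w \<noteq> 0 \<Longrightarrow> cmod w < \<rho>1 \<Longrightarrow> eval_fls F w = f (z + w)"
    using ev unfolding eventually_at by auto
  obtain \<rho>2 :: real where \<rho>2: "\<rho>2 > 0" "ereal \<rho>2 < fls_conv_radius F"
    using ereal_dense2[of 0 "fls_conv_radius F"] rad by auto
  define \<rho> where "\<rho> = min \<rho>1 \<rho>2"
  define G where "G = fls_base_factor_to_fps F"
  \<comment> \<open>By truncation at least one of the two is 0: \<open>N\<close> is the order of a
    pole, \<open>K\<close> the order of a zero.\<close>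
  define N K where "N = nat (- fls_subdegree F)" and "K = nat (fls_subdegree F)"
  define u where "u x = eval_fps G (x - z) * (x - z) ^ K" for x
  show thesis
  proof (rule that[of \<rho> u N])
    show "\<rho> > 0" using \<rho>1 \<rho>2 by (simp add: \<rho>_def)
    have hG: "eval_fps G holomorphic_on ball 0 \<rho>"
    proof (rule holomorphic_on_eval_fps, rule subsetI)
      fix w assume "w \<in> ball (0::complex) \<rho>"
      then have "ereal (cmod w) < ereal \<rho>2" by (simp add: \<rho>_def)
      also have "\<dots> < fps_conv_radius G" using \<rho>2(2) by (simp add: G_def fps_conv_radius_fls_regpart)
      finally show "w \<in> eball 0 (fps_conv_radius G)" by (simp add: in_eball_iff)
    qed
    have "(eval_fps G \<circ> (\<lambda>x. x - z)) holomorphic_on ball z \<rho>"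
      by (rule holomorphic_on_compose_gen[OF _ hG])
         (auto intro!: holomorphic_intros simp: dist_norm norm_minus_commute)
    then have "(\<lambda>x. eval_fps G (x - z)) holomorphic_on ball z \<rho>" by (simp add: o_def)
    then show "u holomorphic_on ball z \<rho>" unfolding u_def by (intro holomorphic_intros)
    fix x assume x: "x \<in> ball z \<rho> - {z}"
    then have ne: "x - z \<noteq> 0" by simp
    have "f x = eval_fls F (x - z)"
      using \<rho>1(2)[of "x - z"] x by (auto simp: \<rho>_def dist_norm norm_minus_commute)
    also have "\<dots> = eval_fps G (x - z) * (x - z) powi fls_subdegree F"
      by (simp add: eval_fls_def G_def)
    also have "(x - z) powi fls_subdegree F = (x - z) ^ K / (x - z) ^ N"
      by (simp add: power_int_def K_def N_def divide_inverse power_inverse)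
    finally show "f x = u x / (x - z) ^ N" by (simp add: u_def)
  qed
qed

lemma power_series_factor:
  assumes \<rho>: "\<rho> > 0" and s: "\<And>x. x \<in> ball z \<rho> \<Longrightarrow> (\<lambda>n. b n * (x - z) ^ n) sums w x"
    and b: "\<And>r. r < n \<Longrightarrow> b r = 0"
  obtains v where "v holomorphic_on ball z \<rho>" "\<And>x. x \<in> ball z \<rho> - {z} \<Longrightarrow> w x = (x - z) ^ n * v x"
proof -
  define v where "v x = (if x = z then b n else w x / (x - z) ^ n)" for x
  have "(\<lambda>i. b (i + n) * (x - z) ^ i) sums v x" if x: "x \<in> ball z \<rho>" for x
  proof (cases "x = z")
    case True
    have "(\<lambda>i. b (i + n) * (0::complex) ^ i) sums b n"
      using powser_sums_zero[of "\<lambda>i. b (i + n)"] by simp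
    then show ?thesis using True by (simp add: v_def)
  next
    case False
    have "(\<lambda>i. b (i + n) * (x - z) ^ (i + n)) sums (w x - (\<Sum>i<n. b i * (x - z) ^ i))"
      using s[OF x] by (rule sums_split_initial_segment)
    then have "(\<lambda>i. b (i + n) * (x - z) ^ (i + n) / (x - z) ^ n) sums (w x / (x - z) ^ n)"
      using b by (intro sums_divide) simp
    then show ?thesis using False by (simp add: v_def power_add)
  qed
  then have "v holomorphic_on ball z \<rho>" by (rule power_series_holomorphic)
  then show thesis by (rule that) (auto simp: v_def)
qed

text \<open>If \<open>f\<close> and \<open>g\<close> have poles of order at most \<open>N1\<close>
  and \<open>N2\<close>, each monomial of bidegree at most \<open>k\<close> has a pole of order at
  most \<open>k * (N1 + N2)\<close>. Multiplied by that power of \<open>x - z\<close>, a combination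
  is holomorphic, and the pole disappears once as many Taylor coefficients vanish; these are linear
  in \<open>c\<close>.\<close>

lemma codim_le_removable:
  assumes f: "f meromorphic_on {z}" and g: "g meromorphic_on {z}"
  shows "\<exists>A. codim_le (\<lambda>k c. removable_at (eval2 k c f g) z) A"
proof -
  obtain N1 u1 \<rho>1 where 1: "\<rho>1 > 0" "u1 holomorphic_on ball z \<rho>1" "\<And>x. x \<in> ball z \<rho>1 - {z} \<Longrightarrow> f x = u1 x / (x - z) ^ N1"
    using meromorphic_at_quotient[OF f] by metis
  obtain N2 u2 \<rho>2 where 2: "\<rho>2 > 0" "u2 holomorphic_on ball z \<rho>2" "\<And>x. x \<in> ball z \<rho>2 - {z} \<Longrightarrow> g x = u2 x / (x - z) ^ N2"
    using meromorphic_at_quotient[OF g] by metis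
  define \<rho> where "\<rho> = min \<rho>1 \<rho>2"
  have \<rho>: "\<rho> > 0" using 1 2 by (simp add: \<rho>_def)
  have hol: "u1 holomorphic_on ball z \<rho>" "u2 holomorphic_on ball z \<rho>"
    using 1(2) 2(2) by (auto simp: \<rho>_def intro: holomorphic_on_subset)
  have "\<exists>a. \<forall>c. (\<forall>r<k * (N1 + N2). (\<Sum>p\<in>exponents k. c p * a r p) = 0) \<longrightarrow> removable_at (eval2 k c f g) z" for k
  proof -
    \<comment> \<open>The last factor raises the individual pole orders to the common order
      \<open>?n\<close>.\<close>
    define u where "u p x = u1 x ^ fst p * u2 x ^ snd p * (x - z) ^ (N1 * (k - fst p) + N2 * (k - snd p))" for p x
    define a where "a r p = (deriv ^^ r) (u p) z / fact r" for r p
    let ?n = "k * (N1 + N2)"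
    have "u p holomorphic_on ball z \<rho>" for p
      unfolding u_def[abs_def] by (intro holomorphic_intros hol)
    then have us: "(\<lambda>r. a r p * (x - z) ^ r) sums u p x" if "x \<in> ball z \<rho>" for p x
      unfolding a_def using that by (intro holomorphic_power_series)
    have fg: "f x ^ fst p * g x ^ snd p = u p x / (x - z) ^ ?n" if x: "x \<in> ball z \<rho> - {z}" and p: "p \<in> exponents k" for x p
    proof -
      define d where "d = x - z"
      have d: "d \<noteq> 0" using x by (simp add: d_def)
      have kp: "fst p \<le> k" "snd p \<le> k" using p by (auto simp: exponents_def)
      have "?n = (N1 * fst p + N2 * snd p) + (N1 * (k - fst p) + N2 * (k - snd p))"
      proof -
        have "N1 * k = N1 * fst p + N1 * (k - fst p)" "N2 * k = N2 * snd p + N2 * (k - snd p)"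
          using kp by (metis distrib_left le_add_diff_inverse)+
        then show ?thesis by (simp add: algebra_simps)
      qed
      then have "d ^ ?n = d ^ (N1 * fst p + N2 * snd p) * d ^ (N1 * (k - fst p) + N2 * (k - snd p))"
        by (simp only: power_add)
      then have "u p x / d ^ ?n = u1 x ^ fst p * u2 x ^ snd p / d ^ (N1 * fst p + N2 * snd p)"
        using d by (simp add: u_def d_def[symmetric])
      also have "\<dots> = (u1 x / d ^ N1) ^ fst p * (u2 x / d ^ N2) ^ snd p"
        by (simp add: power_divide power_add power_mult)
      also have "\<dots> = f x ^ fst p * g x ^ snd p" using 1(3)[of x] 2(3)[of x] x by (simp add: d_def \<rho>_def)
      finally show ?thesis by (simp add: d_def)
    qed
    have "removable_at (eval2 k c f g) z" if c: "\<forall>r<?n. (\<Sum>p\<in>exponents k. c p * a r p) = 0" for c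
    proof -
      have "(\<lambda>r. (\<Sum>p\<in>exponents k. c p * a r p) * (x - z) ^ r) sums (\<Sum>p\<in>exponents k. c p * u p x)" if "x \<in> ball z \<rho>" for x
      proof -
        have "(\<lambda>r. \<Sum>p\<in>exponents k. c p * (a r p * (x - z) ^ r)) sums (\<Sum>p\<in>exponents k. c p * u p x)"
          by (intro sums_sum sums_mult us that)
        then show ?thesis by (simp only: sum_distrib_right mult.assoc)
      qed
      from power_series_factor[OF \<rho> this, of ?n] c
      obtain v where v: "v holomorphic_on ball z \<rho>"
        "\<And>x. x \<in> ball z \<rho> - {z} \<Longrightarrow> (\<Sum>p\<in>exponents k. c p * u p x) = (x - z) ^ ?n * v x"
        by blast
      have "v analytic_on {z}" using v(1) \<rho> by (meson analytic_at centre_in_ball open_ball)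
      moreover have "\<forall>\<^sub>F x in at z. x \<in> ball z \<rho> - {z}" using \<rho> by (intro eventually_at_in_open) auto
      then have "\<forall>\<^sub>F x in at z. eval2 k c f g x = v x"
      proof eventually_elim
        case (elim x)
        have "eval2 k c f g x = (\<Sum>p\<in>exponents k. c p * (u p x / (x - z) ^ ?n))"
          unfolding eval2_def using fg[OF elim] by (intro sum.cong) auto
        also have "\<dots> = (\<Sum>p\<in>exponents k. c p * u p x) / (x - z) ^ ?n" by (simp add: sum_divide_distrib)
        also have "\<dots> = v x" using v(2)[OF elim] elim by simp
        finally show ?case .
      qed
      ultimately show ?thesis unfolding removable_at_def by blast
    qed
    then show ?thesis by blast
  qed
  then show ?thesis unfolding codim_le_def by blast
qed

section \<open>Holomorphic functions on the double\<close>

lemma holomorphic_constant_extend: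
  assumes "f holomorphic_on S" "open S" "connected S" "open U" "U \<subseteq> S" "U \<noteq> {}" "\<And>x. x \<in> U \<Longrightarrow> f x = c" "x \<in> S"
  shows "f x = c"
proof -
  obtain u where u: "u \<in> U" using assms by blast
  have "(\<lambda>x. f x - c) x = 0"
  proof (rule analytic_continuation[of "\<lambda>x. f x - c" S U u])
    show "u islimpt U" using assms(4) u by (rule open_imp_islimpt)
  qed (use assms u in \<open>auto intro!: holomorphic_intros\<close>)
  then show ?thesis by simp
qed

text \<open>\<open>a\<close> lives on \<open>D\<close> and \<open>cnj b\<close> on the reflected
  copy; \<open>M\<close> is the single holomorphic function they form near an arc of the
  boundary.\<close>

definition double_chart :: "complex set \<Rightarrow> (complex \<Rightarrow> complex) \<Rightarrow> (complex \<Rightarrow> complex) \<Rightarrow> (complex \<Rightarrow> complex) \<Rightarrow> real \<Rightarrow> real \<Rightarrow> real \<Rightarrow> complex \<Rightarrow> (complex \<Rightarrow> complex) \<Rightarrow> bool" where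
  "double_chart D a b \<gamma> t e \<sigma> \<alpha> M \<longleftrightarrow> side_chart D \<gamma> t e \<sigma> \<alpha> \<and> M holomorphic_on ball (of_real t) e \<and>
     (\<forall>s\<in>ball (of_real t) e. \<gamma> s \<in> D \<longrightarrow> M s = a (\<gamma> s)) \<and>
     (\<forall>s\<in>ball (of_real t) e. \<gamma> (cnj s) \<in> D \<longrightarrow> M s = cnj (b (\<gamma> (cnj s))))"

lemma side_chart_halves:
  assumes "side_chart D \<gamma> t e \<sigma> \<alpha>"
  shows "open (ball (of_real t) e \<inter> {s. \<sigma> * Im s > 0})" "ball (of_real t) e \<inter> {s. \<sigma> * Im s > 0} \<noteq> {}"
    "open (ball (of_real t) e \<inter> {s. \<sigma> * Im s < 0})" "ball (of_real t) e \<inter> {s. \<sigma> * Im s < 0} \<noteq> {}"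
    and "\<And>s. s \<in> ball (of_real t) e \<Longrightarrow> \<gamma> s \<in> D \<longleftrightarrow> \<sigma> * Im s > 0"
    and "\<And>s. s \<in> ball (of_real t) e \<Longrightarrow> \<gamma> (cnj s) \<in> D \<longleftrightarrow> \<sigma> * Im s < 0"
proof -
  have e: "e > 0" and \<sigma>: "\<sigma> = 1 \<or> \<sigma> = -1" using assms by (auto simp: side_chart_def)
  show "open (ball (complex_of_real t) e \<inter> {s. \<sigma> * Im s > 0})" "open (ball (complex_of_real t) e \<inter> {s. \<sigma> * Im s < 0})"
    by (intro open_Int open_ball open_Collect_less continuous_intros)+
  have in_ball: "complex_of_real t + \<i> * of_real (\<tau> * (e / 2)) \<in> ball (of_real t) e" if "\<bar>\<tau>\<bar> = 1" for \<tau> :: real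
    using e that by (simp add: dist_norm norm_mult abs_mult)
  have "complex_of_real t + \<i> * of_real (\<sigma> * (e / 2)) \<in> ball (of_real t) e \<inter> {s. \<sigma> * Im s > 0}"
    using in_ball[of \<sigma>] e \<sigma> by auto
  then show "ball (complex_of_real t) e \<inter> {s. \<sigma> * Im s > 0} \<noteq> {}" by blast
  have "complex_of_real t + \<i> * of_real ((-\<sigma>) * (e / 2)) \<in> ball (of_real t) e \<inter> {s. \<sigma> * Im s < 0}"
    using in_ball[of "-\<sigma>"] e \<sigma> by auto
  then show "ball (complex_of_real t) e \<inter> {s. \<sigma> * Im s < 0} \<noteq> {}" by blast
  show *: "\<gamma> s \<in> D \<longleftrightarrow> \<sigma> * Im s > 0" if "s \<in> ball (of_real t) e" for s
    using assms that by (simp add: side_chart_def)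
  show "\<gamma> (cnj s) \<in> D \<longleftrightarrow> \<sigma> * Im s < 0" if "s \<in> ball (of_real t) e" for s
    using *[OF cnj_in_ball_of_real[OF that]] by simp
qed

text \<open>The maximum principle on the compact double. The larger of \<open>|a|\<close> and
  \<open>|b|\<close> attains its supremum in \<open>D\<close> or, through some \<open>M\<close>, on
  the boundary, and the function attaining it is constant; charts carry constancy from
  \<open>b\<close> or \<open>M\<close> to \<open>a\<close>. Charts need not be centred at the
  boundary point, so finitely many of them may serve all of the frontier.\<close>

lemma holomorphic_on_double_constant:
  assumes D: "open D" "connected D" "D \<noteq> {}" "bounded D"
    and a: "a holomorphic_on D" and b: "b holomorphic_on D"
    and chart: "\<And>z. z \<in> frontier D \<Longrightarrow> \<exists>\<gamma> t e \<sigma> \<alpha> M x. double_chart D a b \<gamma> t e \<sigma> \<alpha> M \<and> x \<in> ball (of_real t) e \<and> z = \<gamma> x"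
  shows "\<exists>A. \<forall>w\<in>D. a w = A"
proof -
  have M_const: "\<exists>A. \<forall>w\<in>D. a w = A" if c: "double_chart D a b \<gamma> t e \<sigma> \<alpha> M" and M: "\<And>s. s \<in> ball (of_real t) e \<Longrightarrow> M s = A"
    for \<gamma> t e \<sigma> \<alpha> M A
  proof -
    have sc: "side_chart D \<gamma> t e \<sigma> \<alpha>" and Ma: "\<And>s. s \<in> ball (of_real t) e \<Longrightarrow> \<gamma> s \<in> D \<Longrightarrow> M s = a (\<gamma> s)"
      using c by (auto simp: double_chart_def)
    note h = side_chart_halves[OF sc]
    let ?U = "\<gamma> ` (ball (of_real t) e \<inter> {s. \<sigma> * Im s > 0})"
    have "a w = A" if "w \<in> D" for w
    proof (rule holomorphic_constant_extend[OF a D(1,2) _ _ _ _ that, of ?U])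
      show "open ?U" by (rule side_chart_open[OF sc h(1)]) auto
    qed (use h Ma M in auto)
    then show ?thesis by blast
  qed
  have frD: "frontier D \<noteq> {}" using D frontier_eq_empty[of D] by (metis not_bounded_UNIV)
  have b_const: "\<exists>A. \<forall>w\<in>D. a w = A" if b: "\<And>w. w \<in> D \<Longrightarrow> b w = B" for B
  proof -
    obtain \<gamma> t e \<sigma> \<alpha> M where c: "double_chart D a b \<gamma> t e \<sigma> \<alpha> M" using chart frD by blast
    have sc: "side_chart D \<gamma> t e \<sigma> \<alpha>" and hM: "M holomorphic_on ball (of_real t) e"
      and Mb: "\<And>s. s \<in> ball (of_real t) e \<Longrightarrow> \<gamma> (cnj s) \<in> D \<Longrightarrow> M s = cnj (b (\<gamma> (cnj s)))"
      using c by (auto simp: double_chart_def)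
    note h = side_chart_halves[OF sc]
    have "M s = cnj B" if "s \<in> ball (of_real t) e" for s
      by (rule holomorphic_constant_extend[OF hM open_ball connected_ball h(3) _ h(4) _ that]) (use h Mb b in auto)
    from M_const[OF c this] show ?thesis .
  qed
  \<comment> \<open>The parameter of a boundary point is real, so a disc about it is invariant under
    conjugation and continuity of \<open>M\<close> controls both sheets at once.\<close>
  have near: "\<exists>U. open U \<and> z \<in> U \<and> (\<forall>w\<in>U \<inter> D. max (cmod (a w)) (cmod (b w)) \<le> cmod (M x) + \<epsilon>)"
    if z: "z \<in> frontier D" and c: "double_chart D a b \<gamma> t e \<sigma> \<alpha> M" and x: "x \<in> ball (of_real t) e" "z = \<gamma> x" and \<epsilon>: "\<epsilon> > 0"
    for z \<gamma> t e \<sigma> \<alpha> M x \<epsilon>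
  proof -
    have sc: "side_chart D \<gamma> t e \<sigma> \<alpha>" and hM: "M holomorphic_on ball (of_real t) e"
      and Ma: "\<And>s. s \<in> ball (of_real t) e \<Longrightarrow> \<gamma> s \<in> D \<Longrightarrow> M s = a (\<gamma> s)"
      and Mb: "\<And>s. s \<in> ball (of_real t) e \<Longrightarrow> \<gamma> (cnj s) \<in> D \<Longrightarrow> M s = cnj (b (\<gamma> (cnj s)))"
      using c by (auto simp: double_chart_def)
    have "Im x = 0" using sc x z by (auto simp: side_chart_def)
    then have cx: "cnj x = x" by (simp add: complex_eq_iff)
    have "isCont M x" using x(1) by (intro continuous_on_interior[OF holomorphic_on_imp_continuous_on[OF hM]]) auto
    then have "\<forall>\<^sub>F s in nhds x. dist (M s) (M x) < \<epsilon>" using \<epsilon> by (intro tendstoD) (auto simp: isCont_def tendsto_nhds_iff)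
    moreover have "\<forall>\<^sub>F s in nhds x. s \<in> ball (of_real t) e" using x(1) by (intro eventually_nhds_in_open) auto
    ultimately have "\<forall>\<^sub>F s in nhds x. dist (M s) (M x) < \<epsilon> \<and> s \<in> ball (of_real t) e" by eventually_elim auto
    then obtain r where r: "r > 0" "\<And>s. s \<in> ball x r \<Longrightarrow> dist (M s) (M x) < \<epsilon> \<and> s \<in> ball (of_real t) e"
      unfolding eventually_nhds_metric by (auto simp: dist_commute)
    have Mle: "cmod (M s) \<le> cmod (M x) + \<epsilon>" if "s \<in> ball x r" for s
      using r(2)[OF that] norm_triangle_ineq2[of "M s" "M x"] by (simp add: dist_norm)
    have "max (cmod (a w)) (cmod (b w)) \<le> cmod (M x) + \<epsilon>" if w: "w \<in> \<gamma> ` ball x r \<inter> D" for w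
    proof -
      obtain s where s: "s \<in> ball x r" "w = \<gamma> s" using w by blast
      have cs: "cnj s \<in> ball x r"
        using s(1) cx by (metis complex_cnj_diff complex_mod_cnj dist_norm mem_ball)
      have "cmod (a w) = cmod (M s)" using Ma[of s] r(2)[OF s(1)] s w by auto
      moreover have "cmod (b w) = cmod (M (cnj s))" using Mb[of "cnj s"] r(2)[OF cs] s w by auto
      ultimately show ?thesis using Mle[OF s(1)] Mle[OF cs] by simp
    qed
    moreover have "open (\<gamma> ` ball x r)" by (rule side_chart_open[OF sc]) (use r in auto)
    ultimately show ?thesis using x(2) r(1) by (intro exI[of _ "\<gamma> ` ball x r"]) auto
  qed
  have clD: "closure D = D \<union> frontier D" using D(1) by (auto simp: frontier_def interior_open closure_def)
  have compD: "compact (closure D)" using D(4) by simp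
  define val where "val w = max (cmod (a w)) (cmod (b w))" for w
  have valc: "isCont val w" if "w \<in> D" for w
    unfolding val_def using that D(1) a b
    by (intro continuous_intros continuous_on_interior[OF holomorphic_on_imp_continuous_on[OF a]]
        continuous_on_interior[OF holomorphic_on_imp_continuous_on[OF b]]) (auto simp: interior_open)
  \<comment> \<open>Boundedness of \<open>a\<close> and \<open>b\<close> is not given. It comes from
    local bounds at every point of the compact closure.\<close>
  have "\<exists>U B. open U \<and> z \<in> U \<and> (\<forall>w\<in>U \<inter> D. val w \<le> B)" if "z \<in> closure D" for z
  proof (cases "z \<in> D")
    case True
    have "\<forall>\<^sub>F w in nhds z. val w < val z + 1"
      using valc[OF True] by (intro order_tendstoD) (auto simp: isCont_def tendsto_nhds_iff)
    then obtain U where "open U" "z \<in> U" "\<And>w. w \<in> U \<Longrightarrow> val w < val z + 1" unfolding eventually_nhds by blast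
    then show ?thesis by (intro exI[of _ U] exI[of _ "val z + 1"]) (auto intro: less_imp_le)
  next
    case False
    then have z: "z \<in> frontier D" using that clD by blast
    obtain \<gamma> t e \<sigma> \<alpha> M x where c: "double_chart D a b \<gamma> t e \<sigma> \<alpha> M" "x \<in> ball (of_real t) e" "z = \<gamma> x"
      using chart[OF z] by blast
    show ?thesis using near[OF z c, of 1] unfolding val_def by auto
  qed
  then obtain U B where UB: "\<And>z. z \<in> closure D \<Longrightarrow> open (U z) \<and> z \<in> U z \<and> (\<forall>w\<in>U z \<inter> D. val w \<le> B z)" by metis
  obtain C where C: "C \<subseteq> closure D" "finite C" "closure D \<subseteq> (\<Union>z\<in>C. U z)"
    using compactE_image[OF compD, of "closure D" U] UB by blast
  have "val w \<le> (\<Sum>z\<in>C. \<bar>B z\<bar>)" if w: "w \<in> D" for w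
  proof -
    obtain z where z: "z \<in> C" "w \<in> U z" using C(3) w closure_subset[of D] by blast
    then have "val w \<le> B z" using UB[of z] C(1) w by blast
    then have "val w \<le> \<bar>B z\<bar>" by linarith
    also have "\<dots> \<le> (\<Sum>z\<in>C. \<bar>B z\<bar>)" using z(1) C(2) by (intro member_le_sum) auto
    finally show ?thesis .
  qed
  then have bdd: "bdd_above (val ` D)" by (rule bdd_aboveI2)
  define s where "s = Sup (val ` D)"
  have le_s: "val w \<le> s" if "w \<in> D" for w unfolding s_def using bdd that by (intro cSup_upper) auto
  have "\<exists>w\<in>D. s - 1 / real (Suc n) < val w" for n
    using less_cSup_iff[OF _ bdd, of "s - 1 / real (Suc n)"] D(3) by (auto simp: s_def)
  \<comment> \<open>A maximising sequence; a limit point of it in \<open>closure D\<close> is where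
    the supremum is attained.\<close>
  then obtain w where w: "\<And>n. w n \<in> D" "\<And>n. s - 1 / real (Suc n) < val (w n)" by metis
  have "\<And>n. w n \<in> closure D" using w(1) closure_subset by blast
  then obtain z r where z: "z \<in> closure D" "strict_mono (r :: nat \<Rightarrow> nat)" "(w \<circ> r) \<longlonglongrightarrow> z"
    using compD unfolding compact_def by blast
  have lower: "(\<lambda>n. s - 1 / real (Suc (r n))) \<longlonglongrightarrow> s - 0"
    using LIMSEQ_subseq_LIMSEQ[OF lim_inverse_n' z(2)]
    by (intro tendsto_diff tendsto_const) (rule LIMSEQ_subseq_LIMSEQ[OF LIMSEQ_Suc[OF lim_inverse_n'] z(2), unfolded o_def])
  show ?thesis
  proof (cases "z \<in> D")
    case True
    have "(\<lambda>n. val (w (r n))) \<longlonglongrightarrow> val z"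
      using isCont_tendsto_compose[OF valc[OF True] z(3)] by (simp add: o_def)
    from LIMSEQ_le[OF lower this] have "s \<le> val z" using w(2) by (auto intro: less_imp_le)
    then have "cmod (a z) = s \<or> cmod (b z) = s" using le_s[OF True] by (auto simp: val_def max_def split: if_splits)
    then show ?thesis
    proof
      assume "cmod (a z) = s"
      then have "a constant_on D"
        using le_s by (intro maximum_modulus_principle[OF a D(1,2,1) order_refl True]) (auto simp: val_def)
      then show ?thesis by (auto simp: constant_on_def)
    next
      assume "cmod (b z) = s"
      then have "b constant_on D"
        using le_s by (intro maximum_modulus_principle[OF b D(1,2,1) order_refl True]) (auto simp: val_def)
      then show ?thesis using b_const by (auto simp: constant_on_def)
    qed
  next
    case False
    then have zf: "z \<in> frontier D" using z(1) clD by blast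
    obtain \<gamma> t e \<sigma> \<alpha> M x where c: "double_chart D a b \<gamma> t e \<sigma> \<alpha> M" and x: "x \<in> ball (of_real t) e" "z = \<gamma> x"
      using chart[OF zf] by blast
    have "s \<le> cmod (M x) + \<epsilon>" if \<epsilon>: "\<epsilon> > 0" for \<epsilon>
    proof -
      obtain U where U: "open U" "z \<in> U" "\<And>w. w \<in> U \<inter> D \<Longrightarrow> val w \<le> cmod (M x) + \<epsilon>"
        using near[OF zf c x \<epsilon>] unfolding val_def by blast
      have "\<forall>\<^sub>F n in sequentially. w (r n) \<in> U" using topological_tendstoD[OF z(3) U(1,2)] by (simp add: o_def)
      then have "\<forall>\<^sub>F n in sequentially. s - 1 / real (Suc (r n)) \<le> cmod (M x) + \<epsilon>"
        by eventually_elim (use U(3) w in \<open>metis IntI less_imp_le order.trans\<close>)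
      from tendsto_upperbound[OF lower this] show ?thesis by simp
    qed
    then have sM: "s \<le> cmod (M x)" by (rule field_le_epsilon)
    have sc: "side_chart D \<gamma> t e \<sigma> \<alpha>" and hM: "M holomorphic_on ball (of_real t) e"
      and Ma: "\<And>s. s \<in> ball (of_real t) e \<Longrightarrow> \<gamma> s \<in> D \<Longrightarrow> M s = a (\<gamma> s)"
      and Mb: "\<And>s. s \<in> ball (of_real t) e \<Longrightarrow> \<gamma> (cnj s) \<in> D \<Longrightarrow> M s = cnj (b (\<gamma> (cnj s)))"
      using c by (auto simp: double_chart_def)
    note h = side_chart_halves[OF sc]
    have offline: "cmod (M y) \<le> s" if y: "y \<in> ball (of_real t) e" "Im y \<noteq> 0" for y
    proof -
      have "\<sigma> * Im y > 0 \<or> \<sigma> * Im y < 0" using y sc by (auto simp: side_chart_def)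
      then show ?thesis
      proof
        assume "\<sigma> * Im y > 0"
        then show ?thesis using Ma[OF y(1)] h(5)[OF y(1)] le_s[of "\<gamma> y"] by (simp add: val_def)
      next
        assume "\<sigma> * Im y < 0"
        then show ?thesis using Mb[OF y(1)] h(6)[OF y(1)] le_s[of "\<gamma> (cnj y)"] by (simp add: val_def)
      qed
    qed
    \<comment> \<open>Real parameters belong to neither sheet. Their values are limits along
      \<open>y + \<i> / (n + 1)\<close>, which eventually avoids the real axis.\<close>
    have "cmod (M y) \<le> s" if y: "y \<in> ball (of_real t) e" for y
    proof -
      have "isCont M y" using y by (intro continuous_on_interior[OF holomorphic_on_imp_continuous_on[OF hM]]) auto
      moreover have "(\<lambda>n. y + \<i> * of_real (1 / real (Suc n))) \<longlonglongrightarrow> y + \<i> * of_real 0"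
        by (intro tendsto_intros LIMSEQ_Suc[OF lim_inverse_n'])
      then have ly: "(\<lambda>n. y + \<i> * of_real (1 / real (Suc n))) \<longlonglongrightarrow> y" by simp
      ultimately have limM: "(\<lambda>n. cmod (M (y + \<i> * of_real (1 / real (Suc n))))) \<longlonglongrightarrow> cmod (M y)"
        by (intro tendsto_norm isCont_tendsto_compose[of y M])
      have "\<forall>\<^sub>F n in sequentially. y + \<i> * of_real (1 / real (Suc n)) \<in> ball (of_real t) e"
        using topological_tendstoD[OF ly open_ball y] .
      moreover have "\<forall>\<^sub>F n in sequentially. Im (y + \<i> * of_real (1 / real (Suc n))) \<noteq> 0"
      proof (cases "Im y < 0")
        case True
        have "(\<lambda>n. Im (y + \<i> * of_real (1 / real (Suc n)))) \<longlonglongrightarrow> Im y" using tendsto_Im[OF ly] .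
        then have "\<forall>\<^sub>F n in sequentially. Im (y + \<i> * of_real (1 / real (Suc n))) < 0" using True by (rule order_tendstoD(2))
        then show ?thesis by eventually_elim auto
      next
        case False
        then have "Im (y + \<i> * of_real (1 / real (Suc n))) > 0" for n by (simp add: add_nonneg_pos)
        then show ?thesis by (intro always_eventually allI) (metis less_irrefl)
      qed
      ultimately have "\<forall>\<^sub>F n in sequentially. cmod (M (y + \<i> * of_real (1 / real (Suc n)))) \<le> s"
        by eventually_elim (rule offline)
      from tendsto_upperbound[OF limM this] show ?thesis by simp
    qed
    then have "M constant_on ball (of_real t) e"
      using sM x(1) by (intro maximum_modulus_principle[OF hM open_ball connected_ball open_ball order_refl x(1)])
        (meson order_trans)
    then obtain A where "\<And>s. s \<in> ball (of_real t) e \<Longrightarrow> M s = A" by (auto simp: constant_on_def)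
    from M_const[OF c this] show ?thesis .
  qed
qed

section \<open>Algebraic dependence\<close>

lemma removable_atD:
  assumes "removable_at f z"
  shows "remove_sings f analytic_on {z}" "\<forall>\<^sub>F x in at z. f x = remove_sings f x"
proof -
  obtain v where v: "v analytic_on {z}" "\<forall>\<^sub>F x in at z. f x = v x" using assms by (auto simp: removable_at_def)
  have "isolated_singularity_at v z" using v(1) by (rule isolated_singularity_at_analytic)
  then have iso: "isolated_singularity_at f z" using isolated_singularity_at_cong[OF v(2) refl] by simp
  have "v \<midarrow>z\<rightarrow> v z" using v(1) analytic_at_imp_isCont by (auto simp: isCont_def)
  then have "f \<midarrow>z\<rightarrow> v z" using v(2) by (simp add: tendsto_cong)
  then show "remove_sings f analytic_on {z}" using iso by (intro remove_sings_analytic_at)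
  show "\<forall>\<^sub>F x in at z. f x = remove_sings f x" using eventually_remove_sings_eq_at[OF iso] by eventually_elim simp
qed

lemma removable_at_cong:
  "\<forall>\<^sub>F x in at z. f x = g x \<Longrightarrow> removable_at g z \<Longrightarrow> removable_at f z"
proof -
  assume fg: "\<forall>\<^sub>F x in at z. f x = g x" and "removable_at g z"
  then obtain v where v: "v analytic_on {z}" "\<forall>\<^sub>F x in at z. g x = v x" by (auto simp: removable_at_def)
  have "\<forall>\<^sub>F x in at z. f x = v x" using fg v(2) by eventually_elim simp
  then show ?thesis using v(1) by (auto simp: removable_at_def)
qed

lemma removable_at_image:
  assumes \<gamma>: "\<gamma> holomorphic_on B" "open B" "inj_on \<gamma> B" and x: "x \<in> B"
    and r: "removable_at (\<lambda>y. f (\<gamma> y)) x"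
  shows "removable_at f (\<gamma> x)"
proof -
  obtain v where v: "v analytic_on {x}" "\<forall>\<^sub>F y in at x. f (\<gamma> y) = v y" using r by (auto simp: removable_at_def)
  obtain \<delta> where \<delta>: "\<delta> holomorphic_on (\<gamma> ` B)" "\<And>z. z \<in> B \<Longrightarrow> \<delta> (\<gamma> z) = z"
    using holomorphic_has_inverse[OF \<gamma>] by metis
  have oi: "open (\<gamma> ` B)" by (rule open_mapping_thm3[OF \<gamma>])
  have "inj_on \<delta> (\<gamma> ` B)" using \<delta>(2) by (auto simp: inj_on_def)
  from filterlim_at_injective[OF \<delta>(1) oi this, of "\<gamma> x"] have l: "filterlim \<delta> (at x) (at (\<gamma> x))"
    using x \<delta>(2) by simp
  have an: "(\<lambda>w. v (\<delta> w)) analytic_on {\<gamma> x}"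
  proof -
    have "\<delta> analytic_on {\<gamma> x}" using \<delta>(1) oi x by (meson analytic_at imageI)
    then have "(v \<circ> \<delta>) analytic_on {\<gamma> x}" by (rule analytic_on_compose) (use v(1) \<delta>(2) x in auto)
    then show ?thesis by (simp add: o_def)
  qed
  have "\<forall>\<^sub>F w in at (\<gamma> x). f (\<gamma> (\<delta> w)) = v (\<delta> w)" using v(2) l by (rule eventually_compose_filterlim)
  moreover have "\<forall>\<^sub>F w in at (\<gamma> x). w \<in> \<gamma> ` B" using oi x by (intro eventually_at_in_open') auto
  ultimately have "\<forall>\<^sub>F w in at (\<gamma> x). f w = v (\<delta> w)" by eventually_elim (use \<delta>(2) in auto)
  then show ?thesis using an by (auto simp: removable_at_def)
qed

lemma removable_at_cnj:
  assumes "removable_at f (cnj x)" shows "removable_at (\<lambda>y. cnj (f (cnj y))) x"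
proof -
  obtain v where v: "v analytic_on {cnj x}" "\<forall>\<^sub>F y in at (cnj x). f y = v y" using assms by (auto simp: removable_at_def)
  obtain A where A: "open A" "cnj x \<in> A" "v holomorphic_on A" using v(1) by (auto simp: analytic_at)
  have "open (cnj -` A)" using A(1) by (intro open_vimage continuous_intros)
  moreover have "cnj ` (cnj -` A) = A" by (auto intro!: image_eqI[of _ cnj "cnj _"])
  ultimately have "cnj \<circ> v \<circ> cnj holomorphic_on cnj -` A"
    using A(3) by (intro holomorphic_on_compose_cnj_cnj) auto
  then have "(\<lambda>y. cnj (v (cnj y))) analytic_on {x}"
    using \<open>open (cnj -` A)\<close> A(2) by (auto simp: analytic_at o_def)
  moreover have "filterlim cnj (at (cnj x)) (at x)"
    unfolding filterlim_at by (auto intro!: tendsto_intros simp: eventually_at_filter)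
  from eventually_compose_filterlim[OF v(2) this]
  have "\<forall>\<^sub>F y in at x. cnj (f (cnj y)) = cnj (v (cnj y))" by eventually_elim simp
  ultimately show ?thesis by (auto simp: removable_at_def)
qed

lemma eq_if_eventually_eq_at:
  fixes f g :: "complex \<Rightarrow> complex"
  assumes "isCont f s" "isCont g s" "\<forall>\<^sub>F x in at s. f x = g x" shows "f s = g s"
proof -
  have "(g \<longlongrightarrow> f s) (at s)" using assms(1,3) by (auto simp: isCont_def elim: Lim_transform_eventually)
  then show ?thesis using assms(2) by (intro tendsto_unique[of "at s"]) (auto simp: isCont_def)
qed

lemma eval2_cong: "f x = f' y \<Longrightarrow> g x = g' y \<Longrightarrow> eval2 k c f g x = eval2 k c f' g' y"
  by (simp add: eval2_def)

lemma cnj_eval2: "cnj (eval2 k c f g x) = eval2 k (\<lambda>p. cnj (c p)) (\<lambda>x. cnj (f x)) (\<lambda>x. cnj (g x)) x"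
  by (simp add: eval2_def)

lemma algebraic_on_if_eval2_constant:
  assumes c: "\<exists>p\<in>exponents k. c p \<noteq> 0" and eq: "\<And>z. z \<in> \<Omega> \<Longrightarrow> \<forall>\<^sub>F x in at z. eval2 k c (\<lambda>x. x) H x = A"
  shows "algebraic_on \<Omega> H"
proof -
  define P where "P = (\<Sum>p\<in>exponents k. monom (monom (c p) (fst p)) (snd p)) - [:[:A:]:]"
  have coeffP: "coeff (coeff P l) j = c (j, l)" if "(j, l) \<in> exponents k" for j l
  proof -
    have "coeff (coeff P l) j = (\<Sum>p\<in>exponents k. if p = (j, l) then c p else 0) - coeff (coeff [:[:A:]:] l) j"
      unfolding P_def coeff_diff coeff_sum by (intro arg_cong2[where f = minus] sum.cong refl) auto
    also have "coeff (coeff [:[:A:]:] l) j = 0" using that by (cases l; cases j) (auto simp: exponents_def)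
    finally show ?thesis using that by simp
  qed
  obtain j l where "(j, l) \<in> exponents k" "c (j, l) \<noteq> 0" using c by auto
  then have "P \<noteq> 0" using coeffP[of j l] by auto
  moreover have "poly (map_poly (\<lambda>c. poly c x) P) y = (\<Sum>p\<in>exponents k. c p * (x ^ fst p * y ^ snd p)) - A" for x y
  proof -
    \<comment> \<open>Evaluating the outer variable at the constant polynomial \<open>[:y:]\<close>
      respects sums and monomials directly, so no calculation with \<open>map_poly\<close> is
      left.\<close>
    have hom: "poly (map_poly (\<lambda>c. poly c x) Q) y = poly (poly Q [:y:]) x" for Q :: "complex poly poly"
    proof (induction Q)
      case (pCons a Q)
      then show ?case by (simp add: map_poly_pCons)
    qed simp
    show ?thesis unfolding hom P_def
      by (simp add: poly_sum poly_monom mult_ac)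
  qed
  ultimately show ?thesis unfolding algebraic_on_def
    using eq by (intro exI[of _ P]) (auto simp: eval2_def elim!: eventually_mono)
qed

context quadrature_map
begin

text \<open>The poles on the double must be confined to finitely many points before any degree is
  chosen, so that the number of conditions grows linearly in \<open>k\<close>. Finitely many
  boundary charts cover the frontier, each singular at its centre only, and the remainder of
  \<open>D\<close> is compact. A nontrivial combination whose poles are all removed is then a
  holomorphic function on the double, hence constant.\<close>

lemma algebraic_if_extends_to_double_of:
  assumes quad: "quadrature_domain \<Omega>" and D: "analytic_boundary_domain D m G"
    and H: "H meromorphic_on \<Omega>" and ext: "extends_to_double_of D m G (H \<circ> \<Psi>)"
  shows "algebraic_on \<Omega> H"
proof -
  define h where "h = H \<circ> \<Psi>"
  obtain S where S: "S meromorphic_on D"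
    "\<And>\<gamma> t e \<sigma> a. side_chart D \<gamma> t e \<sigma> a \<Longrightarrow>
       \<exists>e' M. 0 < e' \<and> e' \<le> e \<and> M holomorphic_on ball (of_real t) e' \<and>
         (\<forall>s\<in>ball (of_real t) e'. \<gamma> s \<in> D \<longrightarrow> M s = \<Psi> (\<gamma> s)) \<and>
         (\<forall>s\<in>ball (of_real t) e'. \<gamma> (cnj s) \<in> D \<longrightarrow> M s = cnj (S (\<gamma> (cnj s))))"
    using schwarz_function[OF quad] by metis
  obtain g where h: "h meromorphic_on D" and g: "g meromorphic_on D"
    "\<And>i t0::real. i < m \<Longrightarrow> \<exists>e>0. \<exists>M. M meromorphic_on ball (of_real t0) e \<and>
            (\<forall>s\<in>ball (of_real t0) e. G i s \<in> D \<longrightarrow> (\<forall>\<^sub>F x in at s. M x = h (G i x))) \<and>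
            (\<forall>s\<in>ball (of_real t0) e. G i (cnj s) \<in> D \<longrightarrow> (\<forall>\<^sub>F x in at s. M x = cnj (g (G i (cnj x)))))"
    using ext unfolding extends_to_double_of_def h_def by blast
  have D': "open D" "connected D" "D \<noteq> {}" "bounded D" "frontier D = (\<Union>i<m. curve_image (G i))"
    using D by (auto simp: analytic_boundary_domain_def)
  \<comment> \<open>The radius is so small that the glued form of \<open>H\<close> is analytic
    except possibly at the centre; each chart then needs conditions at one point only.\<close>
  define good where "good z \<gamma> t e \<sigma> \<alpha> Z M \<longleftrightarrow> side_chart D \<gamma> t e \<sigma> \<alpha> \<and> z = \<gamma> (of_real t) \<and>
     Z holomorphic_on ball (of_real t) e \<and> M meromorphic_on {of_real t} \<and> M analytic_on ball (of_real t) e - {of_real t} \<and>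
     (\<forall>s\<in>ball (of_real t) e. \<gamma> s \<in> D \<longrightarrow> Z s = \<Psi> (\<gamma> s)) \<and>
     (\<forall>s\<in>ball (of_real t) e. \<gamma> (cnj s) \<in> D \<longrightarrow> Z s = cnj (S (\<gamma> (cnj s)))) \<and>
     (\<forall>s\<in>ball (of_real t) e. \<gamma> s \<in> D \<longrightarrow> (\<forall>\<^sub>F x in at s. M x = h (\<gamma> x))) \<and>
     (\<forall>s\<in>ball (of_real t) e. \<gamma> (cnj s) \<in> D \<longrightarrow> (\<forall>\<^sub>F x in at s. M x = cnj (g (\<gamma> (cnj x)))))"
    for z \<gamma> t e \<sigma> \<alpha> Z M
  have "\<exists>\<gamma> t e \<sigma> \<alpha> Z M. good z \<gamma> t e \<sigma> \<alpha> Z M" if z: "z \<in> frontier D" for z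
  proof -
    obtain i t where i: "i < m" and t: "z = G i (of_real t)" using z D'(5) by (auto simp: curve_image_def)
    let ?\<gamma> = "G i"
    obtain e1 M where M: "e1 > 0" "M meromorphic_on ball (of_real t) e1"
      "\<And>s. s \<in> ball (of_real t) e1 \<Longrightarrow> ?\<gamma> s \<in> D \<Longrightarrow> \<forall>\<^sub>F x in at s. M x = h (?\<gamma> x)"
      "\<And>s. s \<in> ball (of_real t) e1 \<Longrightarrow> ?\<gamma> (cnj s) \<in> D \<Longrightarrow> \<forall>\<^sub>F x in at s. M x = cnj (g (?\<gamma> (cnj x)))"
      using g(2)[OF i, of t] by metis
    obtain e2 \<sigma> a where c: "side_chart D ?\<gamma> t e2 \<sigma> a" using side_chart_exists[OF D i] .
    obtain e3 Z where Z: "0 < e3" "e3 \<le> e2" "Z holomorphic_on ball (of_real t) e3"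
       "\<And>s. s \<in> ball (of_real t) e3 \<Longrightarrow> ?\<gamma> s \<in> D \<Longrightarrow> Z s = \<Psi> (?\<gamma> s)"
       "\<And>s. s \<in> ball (of_real t) e3 \<Longrightarrow> ?\<gamma> (cnj s) \<in> D \<Longrightarrow> Z s = cnj (S (?\<gamma> (cnj s)))"
      using S(2)[OF c] by metis
    have Mt: "M meromorphic_on {of_real t}" using M(1) by (intro meromorphic_on_subset[OF M(2)]) auto
    then obtain e4 where e4: "e4 > 0" "M analytic_on ball (of_real t) e4 - {of_real t}"
      by (auto simp: meromorphic_at_iff isolated_singularity_at_def)
    define e where "e = min e1 (min e3 e4)"
    have e: "e > 0" "e \<le> e2" "ball (complex_of_real t) e \<subseteq> ball (of_real t) e1" "ball (complex_of_real t) e \<subseteq> ball (of_real t) e3"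
      "ball (complex_of_real t) e \<subseteq> ball (of_real t) e4"
      using M(1) Z(1,2) e4(1) by (auto simp: e_def)
    have "good z ?\<gamma> t e \<sigma> a Z M"
      unfolding good_def
    proof (intro conjI ballI impI)
      show "side_chart D ?\<gamma> t e \<sigma> a" by (rule side_chart_subset[OF c e(1,2)])
      show "Z holomorphic_on ball (of_real t) e" by (rule holomorphic_on_subset[OF Z(3) e(4)])
      show "M analytic_on ball (of_real t) e - {of_real t}"
        by (rule analytic_on_subset[OF e4(2)]) (use e(5) in blast)
    next
      fix s assume s: "s \<in> ball (complex_of_real t) e"
      have s': "s \<in> ball (of_real t) e1" "s \<in> ball (of_real t) e3" using s e(3,4) by blast+
      show "?\<gamma> s \<in> D \<Longrightarrow> Z s = \<Psi> (?\<gamma> s)" by (rule Z(4)[OF s'(2)])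
      show "?\<gamma> (cnj s) \<in> D \<Longrightarrow> Z s = cnj (S (?\<gamma> (cnj s)))" by (rule Z(5)[OF s'(2)])
      show "?\<gamma> s \<in> D \<Longrightarrow> \<forall>\<^sub>F x in at s. M x = h (?\<gamma> x)" by (rule M(3)[OF s'(1)])
      show "?\<gamma> (cnj s) \<in> D \<Longrightarrow> \<forall>\<^sub>F x in at s. M x = cnj (g (?\<gamma> (cnj x)))" by (rule M(4)[OF s'(1)])
    qed (use t Mt in auto)
    then show ?thesis by blast
  qed
  then obtain \<gamma> t e \<sigma> \<alpha> Z M where good: "\<And>z. z \<in> frontier D \<Longrightarrow> good z (\<gamma> z) (t z) (e z) (\<sigma> z) (\<alpha> z) (Z z) (M z)"
    by metis
  define B where "B z = ball (complex_of_real (t z)) (e z)" for z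
  define U where "U z = \<gamma> z ` B z" for z
  have sc: "side_chart D (\<gamma> z) (t z) (e z) (\<sigma> z) (\<alpha> z)" if "z \<in> frontier D" for z
    using good[OF that] by (simp add: good_def)
  have \<gamma>B: "\<gamma> z holomorphic_on B z" "inj_on (\<gamma> z) (B z)" if "z \<in> frontier D" for z
    using sc[OF that] side_chart_inj[OF sc[OF that]] by (auto simp: side_chart_def B_def)
  have openU: "open (U z)" if "z \<in> frontier D" for z
    unfolding U_def B_def by (rule side_chart_open[OF sc[OF that]]) auto
  have tB: "of_real (t z) \<in> B z" "z = \<gamma> z (of_real (t z))" if "z \<in> frontier D" for z
    using good[OF that] by (auto simp: good_def side_chart_def B_def)
  have "compact (frontier D)" using D'(4) by (rule compact_frontier_bounded)
  then obtain C where C: "C \<subseteq> frontier D" "finite C" "frontier D \<subseteq> (\<Union>z\<in>C. U z)"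
  proof (rule compactE_image[of "frontier D" "frontier D" U])
    show "frontier D \<subseteq> (\<Union>z\<in>frontier D. U z)" using tB by (fastforce simp: U_def)
  qed (use openU in auto)
  \<comment> \<open>Removing the open charts from the compact closure leaves a compact subset of
    \<open>D\<close>, on which a meromorphic function has finitely many singularities.\<close>
  define K where "K = closure D - (\<Union>z\<in>C. U z)"
  have "compact K" unfolding K_def
    using D'(4) C(1) openU by (intro compact_diff) (auto simp: compact_closure)
  have KD: "K \<subseteq> D" using C(3) D'(1) by (auto simp: K_def frontier_def interior_open)
  define X where "X = K \<inter> {w. \<not> h analytic_on {w} \<or> \<not> g analytic_on {w} \<or> \<not> S analytic_on {w}}"
  have finite_sing: "finite (K \<inter> {w. \<not> f analytic_on {w}})" if f: "f meromorphic_on D" for f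
  proof (rule finite_not_islimpt_in_compact[OF \<open>compact K\<close>])
    fix w assume "w \<in> K"
    then have "\<forall>\<^sub>F x in at w. f analytic_on {x}" using KD by (intro meromorphic_on_eventually_analytic[OF f]) auto
    then show "\<not> w islimpt {w. \<not> f analytic_on {w}}" by (auto simp: islimpt_conv_frequently_at frequently_def)
  qed
  have "X = K \<inter> {w. \<not> h analytic_on {w}} \<union> K \<inter> {w. \<not> g analytic_on {w}} \<union> K \<inter> {w. \<not> S analytic_on {w}}"
    by (auto simp: X_def)
  then have finX: "finite X" using finite_sing[OF h] finite_sing[OF g(1)] finite_sing[OF S(1)] by simp
  have XD: "X \<subseteq> D" using KD by (auto simp: X_def)
  have an\<Psi>: "\<Psi> analytic_on {w}" if "w \<in> D" for w using that hol\<Psi> D'(1) by (meson analytic_at)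
  have cd1: "\<exists>A. codim_le (\<lambda>k c. removable_at (eval2 k c \<Psi> h) w) A" if "w \<in> X" for w
  proof (rule codim_le_removable)
    show "\<Psi> meromorphic_on {w}" using that XD by (intro analytic_on_imp_meromorphic_on an\<Psi>) auto
    show "h meromorphic_on {w}" using that XD by (intro meromorphic_on_subset[OF h]) auto
  qed
  \<comment> \<open>\<open>b\<close> is conjugated when it is read in a chart, so its coefficients
    have to be conjugated beforehand to match \<open>c\<close>.\<close>
  have cd2: "\<exists>A. codim_le (\<lambda>k c. removable_at (eval2 k (\<lambda>p. cnj (c p)) S g) w) A" if "w \<in> X" for w
  proof -
    have "\<exists>A. codim_le (\<lambda>k c. removable_at (eval2 k c S g) w) A"
      using that XD by (intro codim_le_removable meromorphic_on_subset[OF g(1)] meromorphic_on_subset[OF S(1)]) auto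
    then show ?thesis using codim_le_cnj by blast
  qed
  have cd3: "\<exists>A. codim_le (\<lambda>k c. removable_at (eval2 k c (Z z) (M z)) (of_real (t z))) A" if z: "z \<in> C" for z
  proof -
    have zf: "z \<in> frontier D" using z C(1) by blast
    have "Z z analytic_on B z" using good[OF zf] unfolding good_def B_def by (simp add: analytic_on_open)
    then have "Z z analytic_on {of_real (t z)}" using tB(1)[OF zf] by (auto intro: analytic_on_subset)
    moreover have "M z meromorphic_on {of_real (t z)}" using good[OF zf] by (simp add: good_def)
    ultimately show ?thesis by (intro codim_le_removable) (auto intro: analytic_on_imp_meromorphic_on)
  qed
  obtain A1 A2 A3 where A: "codim_le (\<lambda>k c. \<forall>w\<in>X. removable_at (eval2 k c \<Psi> h) w) A1"
    "codim_le (\<lambda>k c. \<forall>w\<in>X. removable_at (eval2 k (\<lambda>p. cnj (c p)) S g) w) A2"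
    "codim_le (\<lambda>k c. \<forall>z\<in>C. removable_at (eval2 k c (Z z) (M z)) (of_real (t z))) A3"
    using codim_le_finite_Ball[of X "\<lambda>w k c. removable_at (eval2 k c \<Psi> h) w"]
      codim_le_finite_Ball[of X "\<lambda>w k c. removable_at (eval2 k (\<lambda>p. cnj (c p)) S g) w"]
      codim_le_finite_Ball[of C "\<lambda>z k c. removable_at (eval2 k c (Z z) (M z)) (of_real (t z))"]
      finX C(2) cd1 cd2 cd3 by auto
  obtain k c where c: "\<exists>p\<in>exponents k. c p \<noteq> 0"
    and Q1: "\<And>w. w \<in> X \<Longrightarrow> removable_at (eval2 k c \<Psi> h) w"
    and Q2: "\<And>w. w \<in> X \<Longrightarrow> removable_at (eval2 k (\<lambda>p. cnj (c p)) S g) w"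
    and Q3: "\<And>z. z \<in> C \<Longrightarrow> removable_at (eval2 k c (Z z) (M z)) (of_real (t z))"
    using codim_le_nontrivial[OF codim_le_conj[OF A(1) codim_le_conj[OF A(2,3)]]] by metis
  define a b where "a = eval2 k c \<Psi> h" and "b = eval2 k (\<lambda>p. cnj (c p)) S g"
  define N where "N z = eval2 k c (Z z) (M z)" for z
  have cB: "cnj s \<in> B z" if "s \<in> B z" for s z using that unfolding B_def by (rule cnj_in_ball_of_real)
  have openB: "open (B z)" for z by (simp add: B_def)
  have remN: "removable_at (N z) s" if z: "z \<in> C" and s: "s \<in> B z" for z s
  proof (cases "s = of_real (t z)")
    case True then show ?thesis using Q3[OF z] by (simp add: N_def)
  next
    case False
    have zf: "z \<in> frontier D" using z C(1) by blast
    have "Z z analytic_on B z" "M z analytic_on B z - {of_real (t z)}"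
      using good[OF zf] unfolding good_def B_def by (simp_all add: analytic_on_open)
    then show ?thesis unfolding N_def using s False
      by (intro removable_at_eval2) (auto intro: analytic_on_subset)
  qed
  have ev_in: "\<forall>\<^sub>F x in at s. \<gamma> z x \<in> D \<and> x \<in> B z" if "z \<in> frontier D" "s \<in> B z" "\<gamma> z s \<in> D" for z s
  proof -
    have "open (B z \<inter> \<gamma> z -` D)"
      using continuous_open_preimage[OF holomorphic_on_imp_continuous_on[OF \<gamma>B(1)[OF that(1)]] openB D'(1)] .
    from eventually_at_in_open'[OF this, of s] that show ?thesis by (auto elim!: eventually_mono)
  qed
  have cnjlim: "filterlim cnj (at (cnj s)) (at s)" for s
    unfolding filterlim_at by (auto intro!: tendsto_intros simp: eventually_at_filter)
  have up: "\<forall>\<^sub>F x in at s. N z x = a (\<gamma> z x)" if z: "z \<in> C" and s: "s \<in> B z" "\<gamma> z s \<in> D" for z s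
  proof -
    have zf: "z \<in> frontier D" using z C(1) by blast
    have "\<forall>\<^sub>F x in at s. M z x = h (\<gamma> z x)" using good[OF zf] s unfolding good_def B_def by blast
    then show ?thesis using ev_in[OF zf s]
    proof eventually_elim
      case (elim x)
      have "Z z x = \<Psi> (\<gamma> z x)" using good[OF zf] elim(2) unfolding good_def B_def by blast
      then show ?case unfolding N_def a_def using elim(1) by (rule eval2_cong)
    qed
  qed
  have dn: "\<forall>\<^sub>F x in at s. N z x = cnj (b (\<gamma> z (cnj x)))" if z: "z \<in> C" and s: "s \<in> B z" "\<gamma> z (cnj s) \<in> D" for z s
  proof -
    have zf: "z \<in> frontier D" using z C(1) by blast
    have "\<forall>\<^sub>F x in at s. M z x = cnj (g (\<gamma> z (cnj x)))" using good[OF zf] s unfolding good_def B_def by blast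
    moreover have "\<forall>\<^sub>F x in at s. \<gamma> z (cnj x) \<in> D \<and> cnj x \<in> B z"
      by (rule eventually_compose_filterlim[OF ev_in[OF zf cB[OF s(1)] s(2)] cnjlim])
    ultimately show ?thesis
    proof eventually_elim
      case (elim x)
      have "x \<in> B z" using elim(2) cB[of "cnj x"] by simp
      then have "Z z x = cnj (S (\<gamma> z (cnj x)))" using good[OF zf] elim(2) unfolding good_def B_def by blast
      then show ?case unfolding N_def b_def cnj_eval2 complex_cnj_cnj using elim(1) by (rule eval2_cong)
    qed
  qed
  \<comment> \<open>Poles inside the charts received no conditions of their own. There
    \<open>a\<close> and \<open>b\<close> are pulled back to \<open>N\<close>, which is already
    removable on the whole disc.\<close>
  have rem: "removable_at a w \<and> removable_at b w" if w: "w \<in> D" for w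
  proof (cases "w \<in> (\<Union>z\<in>C. U z)")
    case True
    then obtain z x where z: "z \<in> C" and x: "x \<in> B z" "w = \<gamma> z x" by (auto simp: U_def)
    have zf: "z \<in> frontier D" using z C(1) by blast
    have xD: "\<gamma> z x \<in> D" using x w by simp
    have "\<forall>\<^sub>F y in at x. a (\<gamma> z y) = N z y" using up[OF z x(1) xD] by eventually_elim simp
    then have "removable_at (\<lambda>y. a (\<gamma> z y)) x" using remN[OF z x(1)] by (rule removable_at_cong)
    from removable_at_image[OF \<gamma>B(1)[OF zf] openB \<gamma>B(2)[OF zf] x(1) this] have 1: "removable_at a w" using x by simp
    have "\<forall>\<^sub>F y in at (cnj x). N z y = cnj (b (\<gamma> z (cnj y)))" using dn[OF z cB[OF x(1)]] xD by simp
    from eventually_compose_filterlim[OF this cnjlim]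
    have "\<forall>\<^sub>F y in at x. b (\<gamma> z y) = cnj (N z (cnj y))" by eventually_elim simp
    then have "removable_at (\<lambda>y. b (\<gamma> z y)) x"
      using removable_at_cnj[OF remN[OF z cB[OF x(1)]]] by (rule removable_at_cong)
    from removable_at_image[OF \<gamma>B(1)[OF zf] openB \<gamma>B(2)[OF zf] x(1) this] have "removable_at b w" using x by simp
    with 1 show ?thesis by blast
  next
    case False
    then have wK: "w \<in> K" using w closure_subset[of D] by (auto simp: K_def)
    show ?thesis
    proof (cases "w \<in> X")
      case True then show ?thesis using Q1 Q2 by (simp add: a_def b_def)
    next
      case False
      then show ?thesis using wK an\<Psi>[OF w] unfolding a_def b_def by (auto simp: X_def intro!: removable_at_eval2)
    qed
  qed
  let ?a = "remove_sings a" and ?b = "remove_sings b"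
  have ana: "?a analytic_on D" "?b analytic_on D"
    using rem removable_atD(1) by (meson analytic_on_analytic_at)+
  have "\<exists>A. \<forall>w\<in>D. ?a w = A"
  proof (rule holomorphic_on_double_constant[OF D'(1-4)])
    show "?a holomorphic_on D" "?b holomorphic_on D" using ana by (auto intro: analytic_imp_holomorphic)
    fix y assume "y \<in> frontier D"
    then obtain z x where z: "z \<in> C" and x: "x \<in> B z" "y = \<gamma> z x" using C(3) by (auto simp: U_def)
    have zf: "z \<in> frontier D" using z C(1) by blast
    let ?N = "remove_sings (N z)"
    have anN: "?N analytic_on B z" using remN[OF z] removable_atD(1) analytic_on_analytic_at by blast
    have lim: "filterlim (\<gamma> z) (at (\<gamma> z s)) (at s)" if "s \<in> B z" for s
      by (rule filterlim_at_injective[OF \<gamma>B(1)[OF zf] openB \<gamma>B(2)[OF zf] that])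
    have c\<gamma>: "isCont (\<gamma> z) s" if "s \<in> B z" for s
      using that openB by (intro continuous_on_interior[OF holomorphic_on_imp_continuous_on[OF \<gamma>B(1)[OF zf]]]) (simp add: interior_open)
    have contN: "isCont ?N s" if "s \<in> B z" for s
      using anN that by (meson analytic_at_imp_isCont analytic_on_analytic_at)
    have cont: "isCont ?a w" "isCont ?b w" if "w \<in> D" for w
      using ana that by (meson analytic_at_imp_isCont analytic_on_analytic_at)+
    have "double_chart D ?a ?b (\<gamma> z) (t z) (e z) (\<sigma> z) (\<alpha> z) ?N"
      unfolding double_chart_def B_def[symmetric]
    proof (intro conjI ballI impI)
      show "side_chart D (\<gamma> z) (t z) (e z) (\<sigma> z) (\<alpha> z)" by (rule sc[OF zf])
      show "?N holomorphic_on B z" using anN by (rule analytic_imp_holomorphic)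
    next
      fix s assume s: "s \<in> B z" "\<gamma> z s \<in> D"
      have "isCont (\<lambda>x. ?a (\<gamma> z x)) s" by (rule isCont_o2[OF c\<gamma>[OF s(1)] cont(1)[OF s(2)]])
      moreover have "\<forall>\<^sub>F x in at s. a (\<gamma> z x) = ?a (\<gamma> z x)"
        using eventually_compose_filterlim[OF removable_atD(2)[of a] lim[OF s(1)]] rem[OF s(2)] by blast
      with up[OF z s] removable_atD(2)[OF remN[OF z s(1)]] have "\<forall>\<^sub>F x in at s. ?N x = ?a (\<gamma> z x)"
        by eventually_elim simp
      ultimately show "?N s = ?a (\<gamma> z s)" by (intro eq_if_eventually_eq_at[OF contN[OF s(1)]])
    next
      fix s assume s: "s \<in> B z" "\<gamma> z (cnj s) \<in> D"
      have "isCont (\<lambda>x. \<gamma> z (cnj x)) s"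
        by (rule isCont_o2[where f = cnj and g = "\<gamma> z"]) (use c\<gamma>[OF cB[OF s(1)]] in \<open>auto intro: continuous_intros\<close>)
      from isCont_o2[OF this cont(2)[OF s(2)]]
      have "isCont (\<lambda>x. cnj (?b (\<gamma> z (cnj x)))) s" by (intro continuous_intros)
      moreover have "\<forall>\<^sub>F x in at s. b (\<gamma> z (cnj x)) = ?b (\<gamma> z (cnj x))"
        using eventually_compose_filterlim[OF removable_atD(2)[of b] filterlim_compose[OF lim[OF cB[OF s(1)]] cnjlim]] rem[OF s(2)] by blast
      with dn[OF z s] removable_atD(2)[OF remN[OF z s(1)]] have "\<forall>\<^sub>F x in at s. ?N x = cnj (?b (\<gamma> z (cnj x)))"
        by eventually_elim simp
      ultimately show "?N s = cnj (?b (\<gamma> z (cnj s)))" by (intro eq_if_eventually_eq_at[OF contN[OF s(1)]])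
    qed
    then show "\<exists>\<gamma> t e \<sigma> \<alpha> M x. double_chart D ?a ?b \<gamma> t e \<sigma> \<alpha> M \<and> x \<in> ball (complex_of_real t) e \<and> y = \<gamma> x"
      using x unfolding B_def by blast
  qed
  then obtain A where Aconst: "\<And>w. w \<in> D \<Longrightarrow> ?a w = A" by blast
  have inj\<Phi>: "inj_on \<Phi> \<Omega>" using \<Psi>_\<Phi> by (metis inj_onI)
  have "\<forall>\<^sub>F x in at z. eval2 k c (\<lambda>x. x) H x = A" if z: "z \<in> \<Omega>" for z
  proof -
    have wD: "\<Phi> z \<in> D" using z img_\<Phi> by blast
    have l: "filterlim \<Phi> (at (\<Phi> z)) (at z)" by (rule filterlim_at_injective[OF hol_\<Phi> open_\<Omega> inj\<Phi> z])
    have "\<forall>\<^sub>F x in at z. a (\<Phi> x) = ?a (\<Phi> x)"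
      using eventually_compose_filterlim[OF removable_atD(2)[of a] l] rem[OF wD] by blast
    moreover have "\<forall>\<^sub>F x in at z. x \<in> \<Omega>" using open_\<Omega> z by (rule eventually_at_in_open')
    ultimately show ?thesis
    proof eventually_elim
      case (elim x)
      have "\<Phi> x \<in> D" using elim(2) img_\<Phi> by blast
      then have "a (\<Phi> x) = A" using elim(1) Aconst by simp
      moreover have "a (\<Phi> x) = eval2 k c (\<lambda>x. x) H x"
        unfolding a_def by (rule eval2_cong) (use \<Psi>_\<Phi>[OF elim(2)] in \<open>auto simp: h_def\<close>)
      ultimately show ?case by simp
    qed
  qed
  with c show ?thesis by (rule algebraic_on_if_eval2_constant)
qed

end

theorem theorem1p4:
  fixes \<Omega> :: "complex set" and n :: nat and H :: "complex \<Rightarrow> complex"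
  assumes "open \<Omega>" and "connected \<Omega>" and "\<Omega> \<noteq> {}"
    and "n_connected \<Omega> n"
    and "no_point_boundary_component \<Omega>"
    and "quadrature_domain \<Omega>"
    and "\<Omega> \<in> lmeasurable"
    and "H meromorphic_on \<Omega>"
    and "extends_to_double \<Omega> H"
  shows "extends_to_double \<Omega> (deriv H) \<and> algebraic_on \<Omega> H"
proof -
  obtain D m G \<Phi> \<Psi> where D: "analytic_boundary_domain D m G"
    and \<Phi>\<Psi>: "\<Phi> holomorphic_on \<Omega>" "\<Psi> holomorphic_on D" "\<Phi> ` \<Omega> = D"
      "\<forall>z\<in>\<Omega>. \<Psi> (\<Phi> z) = z" "\<forall>w\<in>D. \<Phi> (\<Psi> w) = w"
    and ext: "extends_to_double_of D m G (H \<circ> \<Psi>)"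
    using assms(9) unfolding extends_to_double_def by blast
  interpret quadrature_map \<Omega> D \<Phi> \<Psi>
    using assms D \<Phi>\<Psi> by unfold_locales (auto simp: analytic_boundary_domain_def)
  have "extends_to_double_of D m G (deriv H \<circ> \<Psi>)"
    by (rule extends_to_double_of_deriv[OF assms(6) D assms(8) ext])
  then have "extends_to_double \<Omega> (deriv H)"
    unfolding extends_to_double_def using D \<Phi>\<Psi> by blast
  moreover have "algebraic_on \<Omega> H"
    by (rule algebraic_if_extends_to_double_of[OF assms(6) D assms(8) ext])
  ultimately show ?thesis ..
qed

end
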